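(* Let $\mathbf k$ be a commutative domain with field of fractions $\mathbb K$, let $\underline x$ be a (possibly empty) family of indeterminates over $\mathbf k$, let $R_n(\mathbf k[\underline x])$ be a deformed cyclotomic KLR algebra attached to a cyclotomic KLR datum over $\mathbf k[\underline x]$ for a quiver $\Gamma$, with a (graded) content system $(\mathsf c,\mathsf r)$ with values in $\mathbf k[\underline x]$, and let $\lambda\in\mathcal P_n$. Suppose that there exist scalars $\{\beta_k(t)\in\mathbb K[\underline x^\pm]:1\le k<n\text{ and }t,\sigma_kt\in\mathrm{Std}(\lambda)\}$ satisfying the following conditions: (a) $\beta_k(\sigma_kt)\beta_k(t)=Q_k(t)$ if $1\le k<n$ and $\sigma_kt\in\mathrm{Std}(\lambda)$; (b) $\beta_k(t)\beta_l(\sigma_kt)=\beta_l(t)\beta_k(\sigma_lt)$ if $1\le k,l<n$, $|k-l|\neq 1$ and $\sigma_kt,\sigma_lt\in\mathrm{Std}(\lambda)$; (c) $\beta_k(\sigma_{k+1}\sigma_kt)\beta_{k+1}(\sigma_kt)\beta_k(t)=\beta_{k+1}(\sigma_k\sigma_{k+1}t)\beta_k(\sigma_{k+1}t)\beta_{k+1}(t)$ if $1\le k<n-1$ and all the tableaux appearing in this equation are standard. Then there exists a graded $R_n(\mathbb K[\underline x^\pm])$-module $V_\lambda$ that is free as a $\mathbb K[\underline x^\pm]$-module with homogeneous basis $\{v_t:t\in\mathrm{Std}(\lambda)\}$ and where the $R_n(\mathbb K[\underline x^\pm])$-action is determined by \[ 1_{\mathbf i}v_t=\delta_{\mathbf i,\mathsf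 r(t)}v_t,\qquad y_kv_t=\mathsf c_k(t)v_t,\qquad \psi_kv_t=\beta_k(t)v_{\sigma_kt}+\frac{\delta_{\mathsf r_k(t),\mathsf r_{k+1}(t)}}{\mathsf c_{k+1}(t)-\mathsf c_k(t)}v_t \] for all admissible $k$, $\mathbf i\in I^n$ and $t\in\mathrm{Std}(\lambda)$, where $v_s=0$ if $s\notin\mathrm{Std}(\lambda)$. Moreover, if $\mathbb K[\underline x^\pm]$ is a graded field then $V_\lambda$ is irreducible (as a graded $R_n(\mathbb K[\underline x^\pm])$-module).
   Context: Quiver. $\Gamma$ is a symmetrisable quiver with vertex set $I$ and Cartan matrix $C=(c_{ij})_{i,j\in I}$: $c_{ii}=2$, $c_{ij}\le0$ for $i\ne j$, $c_{ij}=0$ whenever $c_{ji}=0$, and there is a diagonal matrix $\mathrm{diag}(d_i)$ (positive integers $d_i$) with $\mathrm{diag}(d_i)C$ symmetric. Simple roots $\alpha_i$, fundamental weights $\Lambda_i$, $Q^+_n$ = elements of height $n$ of $\bigoplus_i\mathbb N\alpha_i$; $(\alpha_i|\alpha_j)=d_ic_{ij}$. Cyclotomic KLR algebras. Let $K$ be a $\mathbb Z$-graded commutative domain. A cyclotomic KLR datum over $K$ is $\Gamma$ with the following polynomials. $Q$-polynomials: $Q_{ij}(u,v)=\sum_{p,q}t_{ij;pq}u^pv^q\in K[u,v]$ with $Q_{ij}(u,v)=Q_{ji}(v,u)$, $Q_{ii}=0$ and, for $i\ne j$, $t_{ij;pq}$ homogeneous (or zero) of degree $-2(\alpha_i|\alpha_j)-p(\alpha_i|\alpha_i)-q(\alpha_j|\alpha_j)$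 and $t_{ij;-c_{ij},0}$ a unit of degree $0$. Weight polynomials: monic $W_i(u)\in K[u]$, homogeneous when $\deg u=2d_i$; put $l_i=\deg_uW_i$, $\Lambda=\sum_il_i\Lambda_i$, $\ell=\sum_il_i\ge1$. Put $Q_{ijk}(u,v,w)=\delta_{ik}\frac{Q_{ij}(u,v)-Q_{jk}(v,w)}{u-w}$. For $\alpha\in Q^+_n$ let $I^\alpha=\{\mathbf i\in I^n:\sum_k\alpha_{i_k}=\alpha\}$; $R_\alpha$ is the unital $K$-algebra generated by $1_{\mathbf i}$ ($\mathbf i\in I^\alpha$), $\psi_1,\dots,\psi_{n-1}$, $y_1,\dots,y_n$ with relations: $1_{\mathbf i}1_{\mathbf j}=\delta_{\mathbf i\mathbf j}1_{\mathbf i}$; $\sum1_{\mathbf i}=1$; $y_k1_{\mathbf i}=1_{\mathbf i}y_k$; $y_ky_m=y_my_k$; $\psi_ky_m=y_m\psi_k$ ($m\ne k,k+1$); $\psi_k\psi_m=\psi_m\psi_k$ ($|k-m|>1$); $\psi_k1_{\mathbf i}=1_{\sigma_k\mathbf i}\psi_k$ ($\sigma_k=(k,k+1)$ acts by place permutation); $(\psi_ky_{k+1}-y_k\psi_k)1_{\mathbf i}=\delta_{i_ki_{k+1}}1_{\mathbf i}=(y_{k+1}\psi_k-\psi_ky_k)1_{\mathbf i}$; $\psi_k^21_{\mathbf i}=Q_{i_ki_{k+1}}(y_k,y_{k+1})1_{\mathbf i}$; $(\psi_{k+1}\psi_k\psi_{k+1}-\psi_k\psi_{k+1}\psi_k)1_{\mathbf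 i}=Q_{i_ki_{k+1}i_{k+2}}(y_k,y_{k+1},y_{k+2})1_{\mathbf i}$; $W_{i_1}(y_1)1_{\mathbf i}=0$. Grading: $\deg1_{\mathbf i}=0$, $\deg y_m1_{\mathbf i}=2d_{i_m}$, $\deg\psi_k1_{\mathbf i}=-(\alpha_{i_k}|\alpha_{i_{k+1}})$. $R_n=\bigoplus_{\alpha\in Q^+_n}R_\alpha$. Deformation and content system. $\mathbf k$ is in degree $0$ and every $x\in\underline x$ has degree $1$. $\mathbf k[\underline x]$ is the polynomial ring and $\mathbb K[\underline x^\pm]$ the Laurent polynomial ring. $R_n(\mathbf k[\underline x])$ is the algebra above over $K=\mathbf k[\underline x]$ for given $Q_{ij},W_i$ over $\mathbf k[\underline x]$ (a deformation of the datum over $\mathbf k$ obtained by setting $\underline x=0$), and $R_n(\mathbb K[\underline x^\pm])=\mathbb K[\underline x^\pm]\otimes_{\mathbf k[\underline x]}R_n(\mathbf k[\underline x])$. Fix $\rho\in I^\ell$ with $\Lambda=\sum_l\Lambda_{\rho_l}$. A content system with values in $\mathbf k[\underline x]$ is a pair of maps $\mathsf c:\{1,\dots,\ell\}\times\mathbb Z\to\mathbf k[\underline x]$, $\mathsf r:\{1,\dots,\ell\}\times\mathbb Z\to I$ with (a) $\mathsf r(l,0)=\rho_l$ and $W_i(u)=\prod_{l:\rho_l=i}(u-\mathsf c(l,0))$; (b) for all $(k,a)$ and $j\in\{\mathsf r(k,a-1),\mathsf r(k,a+1)\}$ there is $\epsilon\in\mathbf k^\times$ with $Q_{\mathsf r(k,a),j}(\mathsf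 c(k,a),v)=\epsilon\prod_{b\in\{a-1,a+1\},\,\mathsf r(k,b)=j}(\mathsf c(k,b)-v)$; (c) for $-n<a,b<n$, $(\mathsf r(k,a),\mathsf c(k,a))=(\mathsf r(l,b),\mathsf c(l,b))$ iff $(k,a)=(l,b)$. It is graded if each $\mathsf c(k,a)$ is zero or homogeneous of degree $2d_{\mathsf r(k,a)}$; the gradings in the claim refer to graded content systems. Tableaux. $\mathcal P_n$ is the set of $\ell$-partitions $\lambda=(\lambda^{(1)}|\dots|\lambda^{(\ell)})$ of $n$, identified with $\{(k,r,c):1\le c\le\lambda^{(k)}_r\}$. $\mathrm{Std}(\lambda)$ is the set of bijections $t:\lambda\to\{1,\dots,n\}$ increasing along rows and down columns of each component; $\mathfrak S_n$ acts on tableaux by permuting entries. If $t^{-1}(m)=(k,r,c)$ then $\mathsf c_m(t)=\mathsf c(k,c-r)$ and $\mathsf r_m(t)=\mathsf r(k,c-r)$; $\mathsf r(t)=(\mathsf r_1(t),\dots,\mathsf r_n(t))$. For $1\le m<n$, $Q_m(t)=Q_{\mathsf r_m(t),\mathsf r_{m+1}(t)}(\mathsf c_m(t),\mathsf c_{m+1}(t))-\dfrac{\delta_{\mathsf r_m(t),\mathsf r_{m+1}(t)}}{(\mathsf c_{m+1}(t)-\mathsf c_m(t))^2}$, regarded as a scalar in $\mathbb K[\underline x^\pm]$. A graded field is a graded ring in which every nonzero homogeneous element is invertible. An irreducible graded module is a nonzero graded module with no proper nonzero graded submodules.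
   Formalization: The grading (with homogeneous basis) and the irreducibility are proved under the added assumption that Q_k(t) is nonzero whenever t and σ_k t are standard; without it both can fail. The module, its basis and the action formulas are proved without this assumption. *)

theory Defs
  imports
    "HOL-Library.Poly_Mapping"
    "HOL-Library.Multiset"
    "HOL-Computational_Algebra.Polynomial"
    "HOL-Computational_Algebra.Fraction_Field"
    "HOL-Combinatorics.Transposition"
    "HOL-Algebra.QuotRing"
    "HOL-Algebra.Module"
begin

section \<open>Coefficient rings\<close>

definition subring_of :: "'a::comm_ring_1 set \<Rightarrow> 'a ring" where
  "subring_of A = \<lparr>carrier = A, mult = (*), one = 1, zero = 0, add = (+)\<rparr>"

text \<open>
  For a domain \<open>k\<close> with field of fractions \<open>k fract\<close>, the Laurent polynomial ring in a set \<open>X\<close> of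
  indeterminates over \<open>k fract\<close> consists of the elements of the following type all of whose
  exponents are supported in \<open>X\<close>; in this way \<open>X\<close> may be empty. The polynomial ring over \<open>k\<close> is
  used as a subring of it.
\<close>

type_synonym ('x, 'k) laurent = "('x \<Rightarrow>\<^sub>0 int) \<Rightarrow>\<^sub>0 'k fract"

definition laurent_ring :: "'x set \<Rightarrow> ('x, 'k::idom) laurent set" where
  "laurent_ring X = {f. \<forall>m \<in> Poly_Mapping.keys f. Poly_Mapping.keys m \<subseteq> X}"

definition poly_ring :: "'x set \<Rightarrow> ('x, 'k::idom) laurent set" where
  "poly_ring X = {f \<in> laurent_ring X. \<forall>m \<in> Poly_Mapping.keys f.
     (\<forall>x. 0 \<le> Poly_Mapping.lookup m x) \<and> Poly_Mapping.lookup f m \<in> range (\<lambda>a. Fract a 1)}"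

text \<open>Homogeneous components (each containing 0): every indeterminate has degree 1.\<close>

definition laurent_homog :: "'x set \<Rightarrow> int \<Rightarrow> ('x, 'k::idom) laurent set" where
  "laurent_homog X d = {f \<in> laurent_ring X. \<forall>m \<in> Poly_Mapping.keys f.
     (\<Sum>x \<in> Poly_Mapping.keys m. Poly_Mapping.lookup m x) = d}"

definition poly_homog :: "'x set \<Rightarrow> int \<Rightarrow> ('x, 'k::idom) laurent set" where
  "poly_homog X d = poly_ring X \<inter> laurent_homog X d"

definition graded_field :: "'a::comm_ring_1 set \<Rightarrow> (int \<Rightarrow> 'a set) \<Rightarrow> bool" where
  "graded_field A G \<longleftrightarrow> (\<forall>d. \<forall>f \<in> G d. f \<noteq> 0 \<longrightarrow> f \<in> Units (subring_of A))"

section \<open>Cyclotomic KLR data\<close>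

text \<open>
  An element of \<open>K[u,v]\<close> is a polynomial in \<open>v\<close> whose coefficients are polynomials in \<open>u\<close>.
\<close>

record (overloaded) ('i, 'a) klr_datum =
  cartan :: "'i \<Rightarrow> 'i \<Rightarrow> int"
  symm :: "'i \<Rightarrow> nat"
  Qpol :: "'i \<Rightarrow> 'i \<Rightarrow> 'a poly poly"
  Wpol :: "'i \<Rightarrow> 'a poly"

definition coeff2 :: "'a::zero poly poly \<Rightarrow> nat \<Rightarrow> nat \<Rightarrow> 'a" where
  "coeff2 Q p q = coeff (coeff Q q) p"

text \<open>\<open>Q(u,v)\<close> as a polynomial in \<open>v\<close> for a scalar \<open>u\<close>, and for scalars \<open>u\<close> and \<open>v\<close>.\<close>

definition eval_fst :: "'a::comm_semiring_1 poly poly \<Rightarrow> 'a \<Rightarrow> 'a poly" where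
  "eval_fst Q u = map_poly (\<lambda>p. poly p u) Q"

definition eval2 :: "'a::comm_semiring_1 poly poly \<Rightarrow> 'a \<Rightarrow> 'a \<Rightarrow> 'a" where
  "eval2 Q u v = poly (eval_fst Q u) v"

definition root_form :: "('i, 'a) klr_datum \<Rightarrow> 'i \<Rightarrow> 'i \<Rightarrow> int" where
  "root_form D i j = int (symm D i) * cartan D i j"

definition symmetrisable_cartan :: "('i, 'a) klr_datum \<Rightarrow> bool" where
  "symmetrisable_cartan D \<longleftrightarrow>
     (\<forall>i. cartan D i i = 2) \<and>
     (\<forall>i j. i \<noteq> j \<longrightarrow> cartan D i j \<le> 0) \<and>
     (\<forall>i j. cartan D j i = 0 \<longrightarrow> cartan D i j = 0) \<and>
     (\<forall>i. 0 < symm D i) \<and>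
     (\<forall>i j. int (symm D i) * cartan D i j = int (symm D j) * cartan D j i)"

definition klr_datum_over ::
  "'a::comm_ring_1 set \<Rightarrow> (int \<Rightarrow> 'a set) \<Rightarrow> ('i, 'a) klr_datum \<Rightarrow> bool" where
  "klr_datum_over A G D \<longleftrightarrow>
     symmetrisable_cartan D \<and>
     (\<forall>i j p q. coeff2 (Qpol D i j) p q = coeff2 (Qpol D j i) q p) \<and>
     (\<forall>i. Qpol D i i = 0) \<and>
     (\<forall>i j p q. i \<noteq> j \<longrightarrow> coeff2 (Qpol D i j) p q \<in>
        G (- 2 * root_form D i j - int p * root_form D i i - int q * root_form D j j)) \<and>
     (\<forall>i j. i \<noteq> j \<longrightarrow>
        coeff2 (Qpol D i j) (nat (- cartan D i j)) 0 \<in> Units (subring_of A) \<inter> G 0) \<and>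
     (\<forall>i. lead_coeff (Wpol D i) = 1) \<and>
     (\<forall>i. \<forall>p \<le> degree (Wpol D i).
        coeff (Wpol D i) p \<in> G (2 * int (symm D i) * (int (degree (Wpol D i)) - int p)))"

section \<open>Free algebras\<close>

datatype 'g word = Word (letters: "'g list")

instantiation word :: (type) monoid_add
begin

definition zero_word :: "'a word" where "zero_word = Word []"

definition plus_word :: "'a word \<Rightarrow> 'a word \<Rightarrow> 'a word" where
  "plus_word v w = Word (letters v @ letters w)"

instance
  by standard (simp_all add: zero_word_def plus_word_def)

end

definition free_algebra :: "'a::comm_ring_1 set \<Rightarrow> 'g set \<Rightarrow> ('g word \<Rightarrow>\<^sub>0 'a) ring" where
  "free_algebra A S =
     \<lparr>carrier = {f. (\<forall>w. Poly_Mapping.lookup f w \<in> A) \<and>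
        (\<forall>w \<in> Poly_Mapping.keys f. set (letters w) \<subseteq> S)},
      mult = (*), one = 1, zero = 0, add = (+)\<rparr>"

definition scal :: "'a::comm_ring_1 \<Rightarrow> ('g word \<Rightarrow>\<^sub>0 'a)" where
  "scal a = Poly_Mapping.single 0 a"

definition gen :: "'g \<Rightarrow> ('g word \<Rightarrow>\<^sub>0 'a::comm_ring_1)" where
  "gen g = Poly_Mapping.single (Word [g]) 1"

text \<open>
  Evaluation of polynomials at elements of a ring, along a map \<open>\<phi>\<close> of the coefficients;
  in \<open>peval2\<close> the powers of the first argument stand to the left.
\<close>

definition peval :: "('a::comm_ring_1 \<Rightarrow> 'b::ring_1) \<Rightarrow> 'a poly \<Rightarrow> 'b \<Rightarrow> 'b" where
  "peval \<phi> P y = (\<Sum>p \<le> degree P. \<phi> (coeff P p) * y ^ p)"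

definition peval2 :: "('a::comm_ring_1 \<Rightarrow> 'b::ring_1) \<Rightarrow> 'a poly poly \<Rightarrow> 'b \<Rightarrow> 'b \<Rightarrow> 'b" where
  "peval2 \<phi> Q y z = (\<Sum>q \<le> degree Q. \<Sum>p \<le> degree (coeff Q q). \<phi> (coeff2 Q p q) * y ^ p * z ^ q)"

text \<open>
  The value of the polynomial \<open>(Q(u,v) - Q(w,v)) / (u - w)\<close>, obtained from
  \<open>(u^p - w^p) / (u - w) = (\<Sum>s<p. u^s w^(p-1-s))\<close>.
\<close>

definition ddiff ::
  "('a::comm_ring_1 \<Rightarrow> 'b::ring_1) \<Rightarrow> 'a poly poly \<Rightarrow> 'b \<Rightarrow> 'b \<Rightarrow> 'b \<Rightarrow> 'b" where
  "ddiff \<phi> Q x y z = (\<Sum>q \<le> degree Q. \<Sum>p \<le> degree (coeff Q q).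
     \<phi> (coeff2 Q p q) * (\<Sum>s<p. x ^ s * z ^ (p - 1 - s)) * y ^ q)"

definition Q3 ::
  "('a::comm_ring_1 \<Rightarrow> 'b::ring_1) \<Rightarrow> ('i, 'a) klr_datum \<Rightarrow> 'i \<Rightarrow> 'i \<Rightarrow> 'i \<Rightarrow> 'b \<Rightarrow> 'b \<Rightarrow> 'b \<Rightarrow> 'b" where
  "Q3 \<phi> D i j k x y z = (if i = k then ddiff \<phi> (Qpol D i j) x y z else 0)"

section \<open>Cyclotomic KLR algebras\<close>

text \<open>
  An element of \<open>Q\<^sup>+\<close> is a multiset of vertices, its height being the size; sequences in \<open>I\<^sup>n\<close> are
  lists, whose entries are numbered from 1 by \<open>ent\<close>.
\<close>

definition seqs_of :: "'i multiset \<Rightarrow> 'i list set" where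
  "seqs_of \<alpha> = {s. mset s = \<alpha>}"

definition ent :: "'i list \<Rightarrow> nat \<Rightarrow> 'i" where
  "ent s k = s ! (k - 1)"

definition swap_seq :: "nat \<Rightarrow> 'i list \<Rightarrow> 'i list" where
  "swap_seq k s = s[k - 1 := ent s (k + 1), k := ent s k]"

datatype 'i klr_gen = Idp "'i list" | Psi nat | Y nat

definition klr_gens :: "'i multiset \<Rightarrow> 'i klr_gen set" where
  "klr_gens \<alpha> = Idp ` seqs_of \<alpha> \<union> Psi ` {1..<size \<alpha>} \<union> Y ` {1..size \<alpha>}"

type_synonym ('i, 'a) klr_free = "'i klr_gen word \<Rightarrow>\<^sub>0 'a"

abbreviation idp :: "'i list \<Rightarrow> ('i, 'a::comm_ring_1) klr_free" where "idp s \<equiv> gen (Idp s)"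
abbreviation psi :: "nat \<Rightarrow> ('i, 'a::comm_ring_1) klr_free" where "psi k \<equiv> gen (Psi k)"
abbreviation yy :: "nat \<Rightarrow> ('i, 'a::comm_ring_1) klr_free" where "yy k \<equiv> gen (Y k)"

text \<open>A relation \<open>a = b\<close> is encoded by the element \<open>a - b\<close>; here \<open>n\<close> is \<open>size \<alpha>\<close>.\<close>

definition klr_relators ::
  "('i, 'a::comm_ring_1) klr_datum \<Rightarrow> 'i multiset \<Rightarrow> ('i, 'a) klr_free set" where
  "klr_relators D \<alpha> = (let n = size \<alpha>; \<delta> = (\<lambda>i j. if i = j then 1 else 0) in
     {idp s * idp s' - (if s = s' then idp s else 0) | s s'. s \<in> seqs_of \<alpha> \<and> s' \<in> seqs_of \<alpha>} \<union>
     {(\<Sum>s \<in> seqs_of \<alpha>. idp s) - 1} \<union>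
     {yy k * idp s - idp s * yy k | k s. k \<in> {1..n} \<and> s \<in> seqs_of \<alpha>} \<union>
     {yy k * yy m - yy m * yy k | k m. k \<in> {1..n} \<and> m \<in> {1..n}} \<union>
     {psi k * yy m - yy m * psi k | k m. k \<in> {1..<n} \<and> m \<in> {1..n} \<and> m \<noteq> k \<and> m \<noteq> k + 1} \<union>
     {psi k * psi m - psi m * psi k | k m.
        k \<in> {1..<n} \<and> m \<in> {1..<n} \<and> \<bar>int k - int m\<bar> > 1} \<union>
     {psi k * idp s - idp (swap_seq k s) * psi k | k s. k \<in> {1..<n} \<and> s \<in> seqs_of \<alpha>} \<union>
     {(psi k * yy (k + 1) - yy k * psi k) * idp s - \<delta> (ent s k) (ent s (k + 1)) * idp s | k s.
        k \<in> {1..<n} \<and> s \<in> seqs_of \<alpha>} \<union>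
     {(yy (k + 1) * psi k - psi k * yy k) * idp s - \<delta> (ent s k) (ent s (k + 1)) * idp s | k s.
        k \<in> {1..<n} \<and> s \<in> seqs_of \<alpha>} \<union>
     {psi k * psi k * idp s -
        peval2 scal (Qpol D (ent s k) (ent s (k + 1))) (yy k) (yy (k + 1)) * idp s | k s.
        k \<in> {1..<n} \<and> s \<in> seqs_of \<alpha>} \<union>
     {(psi (k + 1) * psi k * psi (k + 1) - psi k * psi (k + 1) * psi k) * idp s -
        Q3 scal D (ent s k) (ent s (k + 1)) (ent s (k + 2)) (yy k) (yy (k + 1)) (yy (k + 2)) * idp s | k s.
        1 \<le> k \<and> k + 1 < n \<and> s \<in> seqs_of \<alpha>} \<union>
     {peval scal (Wpol D (ent s 1)) (yy 1) * idp s | s. 1 \<le> n \<and> s \<in> seqs_of \<alpha>})"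

definition klr_ideal ::
  "'a::comm_ring_1 set \<Rightarrow> ('i, 'a) klr_datum \<Rightarrow> 'i multiset \<Rightarrow> ('i, 'a) klr_free set" where
  "klr_ideal A D \<alpha> = genideal (free_algebra A (klr_gens \<alpha>)) (klr_relators D \<alpha>)"

text \<open>The algebra \<open>R\<^sub>\<alpha>\<close> over \<open>A\<close>, and the class in it of an element of the free algebra.\<close>

definition klr_block ::
  "'a::comm_ring_1 set \<Rightarrow> ('i, 'a) klr_datum \<Rightarrow> 'i multiset \<Rightarrow> ('i, 'a) klr_free set ring" where
  "klr_block A D \<alpha> = free_algebra A (klr_gens \<alpha>) Quot klr_ideal A D \<alpha>"

definition klr_class ::
  "'a::comm_ring_1 set \<Rightarrow> ('i, 'a) klr_datum \<Rightarrow> 'i multiset \<Rightarrow> ('i, 'a) klr_free \<Rightarrow>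
   ('i, 'a) klr_free set" where
  "klr_class A D \<alpha> f = klr_ideal A D \<alpha> +>\<^bsub>free_algebra A (klr_gens \<alpha>)\<^esub> f"

text \<open>The homogeneous component of degree \<open>d\<close> of \<open>R\<^sub>\<alpha>\<close>, where \<open>G\<close> is the grading of \<open>A\<close>.\<close>

inductive klr_block_homog ::
  "'a::comm_ring_1 set \<Rightarrow> (int \<Rightarrow> 'a set) \<Rightarrow> ('i, 'a) klr_datum \<Rightarrow> 'i multiset \<Rightarrow>
   int \<Rightarrow> ('i, 'a) klr_free set \<Rightarrow> bool"
  for A G D \<alpha> where
  zero: "klr_block_homog A G D \<alpha> d \<zero>\<^bsub>klr_block A D \<alpha>\<^esub>"
| scalar: "a \<in> G d \<Longrightarrow> klr_block_homog A G D \<alpha> d (klr_class A D \<alpha> (scal a))"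
| idp: "s \<in> seqs_of \<alpha> \<Longrightarrow> klr_block_homog A G D \<alpha> 0 (klr_class A D \<alpha> (idp s))"
| y: "s \<in> seqs_of \<alpha> \<Longrightarrow> m \<in> {1..size \<alpha>} \<Longrightarrow>
    klr_block_homog A G D \<alpha> (2 * int (symm D (ent s m))) (klr_class A D \<alpha> (yy m * idp s))"
| psi: "s \<in> seqs_of \<alpha> \<Longrightarrow> k \<in> {1..<size \<alpha>} \<Longrightarrow>
    klr_block_homog A G D \<alpha> (- root_form D (ent s k) (ent s (k + 1))) (klr_class A D \<alpha> (psi k * idp s))"
| add: "klr_block_homog A G D \<alpha> d x \<Longrightarrow> klr_block_homog A G D \<alpha> d y \<Longrightarrow>
    klr_block_homog A G D \<alpha> d (x \<oplus>\<^bsub>klr_block A D \<alpha>\<^esub> y)"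
| mult: "klr_block_homog A G D \<alpha> d x \<Longrightarrow> klr_block_homog A G D \<alpha> e y \<Longrightarrow>
    klr_block_homog A G D \<alpha> (d + e) (x \<otimes>\<^bsub>klr_block A D \<alpha>\<^esub> y)"

text \<open>
  \<open>R\<^sub>n\<close> is the direct sum of the \<open>R\<^sub>\<alpha>\<close> with \<open>\<alpha>\<close> of height \<open>n\<close>, as an algebra over \<open>A\<close>. If there are
  infinitely many vertices then \<open>R\<^sub>n\<close> has no unit: the \<open>one\<close> of the record is not in the carrier.
  For a ring \<open>B\<close> containing \<open>A\<close>, extension of scalars along \<open>A \<subseteq> B\<close> turns \<open>R\<^sub>n\<close> over \<open>A\<close> into the
  algebra with the same generators and relations over \<open>B\<close>, that is, \<open>klr_algebra B D n\<close>.
\<close>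

definition klr_algebra ::
  "'a::comm_ring_1 set \<Rightarrow> ('i, 'a) klr_datum \<Rightarrow> nat \<Rightarrow>
   ('a, 'i multiset \<Rightarrow> ('i, 'a) klr_free set) module" where
  "klr_algebra A D n = (let H = {\<alpha>. size \<alpha> = n}; R = klr_block A D in
     \<lparr>carrier = {f \<in> (\<Pi>\<^sub>E \<alpha> \<in> H. carrier (R \<alpha>)). finite {\<alpha> \<in> H. f \<alpha> \<noteq> \<zero>\<^bsub>R \<alpha>\<^esub>}},
      mult = (\<lambda>f g. \<lambda>\<alpha>\<in>H. f \<alpha> \<otimes>\<^bsub>R \<alpha>\<^esub> g \<alpha>),
      one = (\<lambda>\<alpha>\<in>H. \<one>\<^bsub>R \<alpha>\<^esub>),
      zero = (\<lambda>\<alpha>\<in>H. \<zero>\<^bsub>R \<alpha>\<^esub>),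
      add = (\<lambda>f g. \<lambda>\<alpha>\<in>H. f \<alpha> \<oplus>\<^bsub>R \<alpha>\<^esub> g \<alpha>),
      smult = (\<lambda>a f. \<lambda>\<alpha>\<in>H. klr_class A D \<alpha> (scal a) \<otimes>\<^bsub>R \<alpha>\<^esub> f \<alpha>)\<rparr>)"

definition klr_homog ::
  "'a::comm_ring_1 set \<Rightarrow> (int \<Rightarrow> 'a set) \<Rightarrow> ('i, 'a) klr_datum \<Rightarrow> nat \<Rightarrow>
   int \<Rightarrow> ('i multiset \<Rightarrow> ('i, 'a) klr_free set) set" where
  "klr_homog A G D n d =
     {f \<in> carrier (klr_algebra A D n). \<forall>\<alpha>. size \<alpha> = n \<longrightarrow> klr_block_homog A G D \<alpha> d (f \<alpha>)}"

text \<open>The image in \<open>R\<^sub>n\<close> of the class in \<open>R\<^sub>\<alpha>\<close> of an element of the free algebra.\<close>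

definition klr_elt ::
  "'a::comm_ring_1 set \<Rightarrow> ('i, 'a) klr_datum \<Rightarrow> 'i multiset \<Rightarrow> ('i, 'a) klr_free \<Rightarrow>
   'i multiset \<Rightarrow> ('i, 'a) klr_free set" where
  "klr_elt A D \<alpha> f =
     (\<lambda>\<gamma>\<in>{\<gamma>. size \<gamma> = size \<alpha>}. if \<gamma> = \<alpha> then klr_class A D \<alpha> f else \<zero>\<^bsub>klr_block A D \<gamma>\<^esub>)"

section \<open>Graded modules\<close>

text \<open>
  Left modules over an algebra \<open>R\<close> over the commutative ring \<open>K\<close>. The last condition is
  \<open>1 v = v\<close> if \<open>R\<close> has a unit, and says that the local units of \<open>R\<close> act as the identity otherwise.
\<close>

definition algebra_module ::
  "'a ring \<Rightarrow> ('a, 'r) module \<Rightarrow> ('a, 'v) module \<Rightarrow> ('r \<Rightarrow> 'v \<Rightarrow> 'v) \<Rightarrow> bool" where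
  "algebra_module K R V act \<longleftrightarrow>
     module K V \<and>
     (\<forall>r \<in> carrier R. \<forall>v \<in> carrier V. act r v \<in> carrier V) \<and>
     (\<forall>r \<in> carrier R. \<forall>v \<in> carrier V. \<forall>w \<in> carrier V.
        act r (v \<oplus>\<^bsub>V\<^esub> w) = act r v \<oplus>\<^bsub>V\<^esub> act r w) \<and>
     (\<forall>r \<in> carrier R. \<forall>s \<in> carrier R. \<forall>v \<in> carrier V.
        act (r \<oplus>\<^bsub>R\<^esub> s) v = act r v \<oplus>\<^bsub>V\<^esub> act s v \<and>
        act (r \<otimes>\<^bsub>R\<^esub> s) v = act r (act s v)) \<and>
     (\<forall>a \<in> carrier K. \<forall>r \<in> carrier R. \<forall>v \<in> carrier V.
        act (a \<odot>\<^bsub>R\<^esub> r) v = a \<odot>\<^bsub>V\<^esub> act r v \<and> act r (a \<odot>\<^bsub>V\<^esub> v) = a \<odot>\<^bsub>V\<^esub> act r v) \<and>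
     (\<forall>v \<in> carrier V. \<exists>e \<in> carrier R. act e v = v)"

definition decomposes :: "('a, 'v) module \<Rightarrow> (int \<Rightarrow> 'v set) \<Rightarrow> 'v \<Rightarrow> (int \<Rightarrow> 'v) \<Rightarrow> bool" where
  "decomposes V U v f \<longleftrightarrow>
     (\<forall>d. f d \<in> U d) \<and> finite {d. f d \<noteq> \<zero>\<^bsub>V\<^esub>} \<and> v = (\<Oplus>\<^bsub>V\<^esub>d\<in>{d. f d \<noteq> \<zero>\<^bsub>V\<^esub>}. f d)"

text \<open>\<open>U\<close> is a grading of \<open>V\<close>, compatible with the gradings \<open>G\<close> of \<open>K\<close> and \<open>H\<close> of \<open>R\<close>.\<close>

definition graded_module ::
  "'a ring \<Rightarrow> (int \<Rightarrow> 'a set) \<Rightarrow> ('a, 'r) module \<Rightarrow> (int \<Rightarrow> 'r set) \<Rightarrow>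
   ('a, 'v) module \<Rightarrow> ('r \<Rightarrow> 'v \<Rightarrow> 'v) \<Rightarrow> (int \<Rightarrow> 'v set) \<Rightarrow> bool" where
  "graded_module K G R H V act U \<longleftrightarrow>
     algebra_module K R V act \<and>
     (\<forall>d. additive_subgroup (U d) V) \<and>
     (\<forall>v \<in> carrier V. \<exists>!f. decomposes V U v f) \<and>
     (\<forall>d e. \<forall>a \<in> G d. \<forall>v \<in> U e. a \<odot>\<^bsub>V\<^esub> v \<in> U (d + e)) \<and>
     (\<forall>d e. \<forall>r \<in> H d. \<forall>v \<in> U e. act r v \<in> U (d + e))"

definition graded_submodule ::
  "'a ring \<Rightarrow> ('a, 'r) module \<Rightarrow> ('a, 'v) module \<Rightarrow> ('r \<Rightarrow> 'v \<Rightarrow> 'v) \<Rightarrow> (int \<Rightarrow> 'v set) \<Rightarrow>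
   'v set \<Rightarrow> bool" where
  "graded_submodule K R V act U N \<longleftrightarrow>
     submodule N K V \<and>
     (\<forall>r \<in> carrier R. \<forall>v \<in> N. act r v \<in> N) \<and>
     (\<forall>v \<in> N. \<exists>f. decomposes V (\<lambda>d. N \<inter> U d) v f)"

definition graded_irreducible ::
  "'a ring \<Rightarrow> (int \<Rightarrow> 'a set) \<Rightarrow> ('a, 'r) module \<Rightarrow> (int \<Rightarrow> 'r set) \<Rightarrow>
   ('a, 'v) module \<Rightarrow> ('r \<Rightarrow> 'v \<Rightarrow> 'v) \<Rightarrow> (int \<Rightarrow> 'v set) \<Rightarrow> bool" where
  "graded_irreducible K G R H V act U \<longleftrightarrow>
     graded_module K G R H V act U \<and> carrier V \<noteq> {\<zero>\<^bsub>V\<^esub>} \<and>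
     (\<forall>N. graded_submodule K R V act U N \<longrightarrow> N = {\<zero>\<^bsub>V\<^esub>} \<or> N = carrier V)"

definition free_basis :: "'a ring \<Rightarrow> ('a, 'v) module \<Rightarrow> 's set \<Rightarrow> ('s \<Rightarrow> 'v) \<Rightarrow> bool" where
  "free_basis K V S v \<longleftrightarrow>
     finite S \<and> (\<forall>s \<in> S. v s \<in> carrier V) \<and>
     (\<forall>x \<in> carrier V. \<exists>!a. a \<in> (\<Pi>\<^sub>E s \<in> S. carrier K) \<and> x = (\<Oplus>\<^bsub>V\<^esub>s\<in>S. a s \<odot>\<^bsub>V\<^esub> v s))"

section \<open>Tableaux\<close>

type_synonym box = "nat \<times> nat \<times> nat"

definition is_partition :: "nat list \<Rightarrow> bool" where
  "is_partition p \<longleftrightarrow> sorted_wrt (\<ge>) p \<and> 0 \<notin> set p"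

definition multipartitions :: "nat \<Rightarrow> nat \<Rightarrow> nat list list set" where
  "multipartitions l n = {lam. length lam = l \<and> (\<forall>p \<in> set lam. is_partition p) \<and>
     sum_list (map sum_list lam) = n}"

definition diagram :: "nat list list \<Rightarrow> box set" where
  "diagram lam = {(k, r, c). k \<in> {1..length lam} \<and> r \<in> {1..length (lam ! (k - 1))} \<and>
     c \<in> {1..lam ! (k - 1) ! (r - 1)}}"

text \<open>Tableaux are \<open>undefined\<close> outside of the diagram, so that distinct functions are distinct tableaux.\<close>

definition Std :: "nat list list \<Rightarrow> (box \<Rightarrow> nat) set" where
  "Std lam = {t \<in> extensional (diagram lam).
     bij_betw t (diagram lam) {1..card (diagram lam)} \<and>
     (\<forall>k r c c'. (k, r, c) \<in> diagram lam \<and> (k, r, c') \<in> diagram lam \<and> c < c' \<longrightarrow>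
        t (k, r, c) < t (k, r, c')) \<and>
     (\<forall>k r r' c. (k, r, c) \<in> diagram lam \<and> (k, r', c) \<in> diagram lam \<and> r < r' \<longrightarrow>
        t (k, r, c) < t (k, r', c))}"

definition swap_tab :: "nat list list \<Rightarrow> nat \<Rightarrow> (box \<Rightarrow> nat) \<Rightarrow> (box \<Rightarrow> nat)" where
  "swap_tab lam k t = (\<lambda>b\<in>diagram lam. transpose k (k + 1) (t b))"

text \<open>The value \<open>f(k, c - r)\<close>, where \<open>(k, r, c)\<close> is the box of \<open>t\<close> containing \<open>m\<close>.\<close>

definition at_entry :: "nat list list \<Rightarrow> (nat \<Rightarrow> int \<Rightarrow> 'b) \<Rightarrow> (box \<Rightarrow> nat) \<Rightarrow> nat \<Rightarrow> 'b" where
  "at_entry lam f t m = (case inv_into (diagram lam) t m of (k, r, c) \<Rightarrow> f k (int c - int r))"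

definition residue_seq :: "nat list list \<Rightarrow> nat \<Rightarrow> (nat \<Rightarrow> int \<Rightarrow> 'i) \<Rightarrow> (box \<Rightarrow> nat) \<Rightarrow> 'i list" where
  "residue_seq lam n res t = map (at_entry lam res t) [1..<n + 1]"

section \<open>Content systems\<close>

definition content_system ::
  "'x set \<Rightarrow> ('i, ('x, 'k::idom) laurent) klr_datum \<Rightarrow> 'i list \<Rightarrow> nat \<Rightarrow>
   (nat \<Rightarrow> int \<Rightarrow> ('x, 'k) laurent) \<Rightarrow> (nat \<Rightarrow> int \<Rightarrow> 'i) \<Rightarrow> bool" where
  "content_system X D \<rho> n con res \<longleftrightarrow> (let L = {1..length \<rho>} in
     (\<forall>k \<in> L. \<forall>a. con k a \<in> poly_ring X) \<and>
     (\<forall>l \<in> L. res l 0 = ent \<rho> l) \<and>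
     (\<forall>i. Wpol D i = (\<Prod>l \<in> {l \<in> L. ent \<rho> l = i}. [:- con l 0, 1:])) \<and>
     (\<forall>k \<in> L. \<forall>a. \<forall>j \<in> {res k (a - 1), res k (a + 1)}. \<exists>\<epsilon>::'k. \<epsilon> dvd 1 \<and>
        eval_fst (Qpol D (res k a) j) (con k a) =
        Polynomial.smult (Poly_Mapping.single 0 (Fract \<epsilon> 1))
          (\<Prod>b \<in> {b \<in> {a - 1, a + 1}. res k b = j}. [:con k b, - 1:])) \<and>
     (\<forall>k \<in> L. \<forall>l \<in> L. \<forall>a b. - int n < a \<and> a < int n \<and> - int n < b \<and> b < int n \<longrightarrow>
        ((res k a, con k a) = (res l b, con l b) \<longleftrightarrow> (k, a) = (l, b))))"

definition graded_contents ::
  "'x set \<Rightarrow> ('i, ('x, 'k::idom) laurent) klr_datum \<Rightarrow> 'i list \<Rightarrow>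
   (nat \<Rightarrow> int \<Rightarrow> ('x, 'k) laurent) \<Rightarrow> (nat \<Rightarrow> int \<Rightarrow> 'i) \<Rightarrow> bool" where
  "graded_contents X D \<rho> con res \<longleftrightarrow>
     (\<forall>k \<in> {1..length \<rho>}. \<forall>a. con k a \<in> poly_homog X (2 * int (symm D (res k a))))"

text \<open>
  \<open>is_Q D lam con res m t z\<close> says that \<open>z = Q\<^sub>m(t)\<close>. If the two residues are equal then \<open>Q\<^sub>m(t)\<close>
  involves \<open>1 / (v - u)\<^sup>2\<close>, where \<open>v - u\<close> is nonzero but need not be invertible in the Laurent
  polynomial ring, so the equation is read in its field of fractions, by clearing denominators.
  For \<open>z\<close> in the Laurent polynomial ring it implies that \<open>v - u\<close> is invertible there, because
  \<open>Q\<^sub>i\<^sub>i = 0\<close>.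
\<close>

definition is_Q ::
  "('i, 'a::comm_ring_1) klr_datum \<Rightarrow> nat list list \<Rightarrow> (nat \<Rightarrow> int \<Rightarrow> 'a) \<Rightarrow> (nat \<Rightarrow> int \<Rightarrow> 'i) \<Rightarrow>
   nat \<Rightarrow> (box \<Rightarrow> nat) \<Rightarrow> 'a \<Rightarrow> bool" where
  "is_Q D lam con res m t z \<longleftrightarrow>
     (let i = at_entry lam res t m; j = at_entry lam res t (m + 1);
          u = at_entry lam con t m; v = at_entry lam con t (m + 1)
      in if i = j then z * (v - u)\<^sup>2 = eval2 (Qpol D i j) u v * (v - u)\<^sup>2 - 1
         else z = eval2 (Qpol D i j) u v)"

section \<open>Consistency checks\<close>

lemma is_Q_unit:
  assumes "is_Q D lam con res m t z" "at_entry lam res t m = at_entry lam res t (m + 1)"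
    and "\<And>i. Qpol D i i = 0"
  shows "(at_entry lam con t (m + 1) - at_entry lam con t m) *
         (- z * (at_entry lam con t (m + 1) - at_entry lam con t m)) = 1"
  using assms
  by (simp add: is_Q_def eval2_def eval_fst_def power2_eq_square algebra_simps Let_def)

lemma ddiff_eq:
  fixes u v w :: "'b::comm_ring_1"
  shows "(u - w) * ddiff \<phi> Q u v w = peval2 \<phi> Q u v - peval2 \<phi> Q w v"
proof -
  have "(u - w) * (\<phi> (coeff2 Q p q) * (\<Sum>s<p. u ^ s * w ^ (p - 1 - s)) * v ^ q)
        = \<phi> (coeff2 Q p q) * u ^ p * v ^ q - \<phi> (coeff2 Q p q) * w ^ p * v ^ q" for p q
  proof -
    have "(u - w) * (\<phi> (coeff2 Q p q) * (\<Sum>s<p. u ^ s * w ^ (p - 1 - s)) * v ^ q)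
        = \<phi> (coeff2 Q p q) * ((u - w) * (\<Sum>s<p. w ^ (p - Suc s) * u ^ s)) * v ^ q"
      by (simp add: ac_simps)
    also have "\<dots> = \<phi> (coeff2 Q p q) * (u ^ p - w ^ p) * v ^ q"
      by (simp add: power_diff_sumr2)
    finally show ?thesis
      by (simp add: algebra_simps)
  qed
  then show ?thesis
    by (simp add: ddiff_def peval2_def sum_distrib_left sum_subtractf)
qed

end

(*
The module is the space of functions on Std(lambda), on which y_k acts by multiplication with the
contents and psi_k by (psi_k v)(t) = beta_k(s t) v(s t) + d_k(t) v(t), where s = sigma_k and d_k(t) is
the inverse of c_{k+1}(t) - c_k(t) if the residues of k and k+1 agree, and 0 otherwise. The defining
relations are checked pointwise. For the braid relation one compares the coefficients of the six
tableaux of a hexagon; the only one that does not cancel formally is that of v(t), where the relation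
beta_k(s t) beta_k(t) = Q_k(t) produces the divided difference of Q. If s t is not standard then k and
k+1 lie in adjacent boxes, so the content system forces their residues to differ and Q_k(t) to vanish.

A product of Laurent polynomials that is nonzero and homogeneous has homogeneous factors, so each beta_k(t) is
homogeneous, which prescribes the differences deg(t) - deg(s t). They come from a function deg because
every loop of neighbouring standard tableaux is filled by squares and hexagons: the descents of a tableau
form a terminating and locally confluent rewriting system with the row reading tableau as its only
normal form, and conditions (b) and (c) are exactly what local confluence with weights requires.

Over a graded field distinct tableaux are separated by residues and contents, so a graded submodule
that is not zero contains some v_t, and then all of them as Std(lambda) is connected.
*)

theory Submission
  imports Defs "HOL-Library.Product_Lexorder"
begin

section \<open>Operators on functions\<close>

text \<open>The action is written on coordinates rather than on basis vectors: the value at t of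
  \<open>psi k\<close> applied to v reads v at t and at its neighbour. Functions that vanish off the
  standard tableaux take care of the convention v_s = 0. The coefficient attached to t is then
  \<beta>_k of the neighbour, which is why conditions (b) and (c) are applied at the opposite corner
  of a square or hexagon. Two inverses must be found in the Laurent ring, which need not be a field.
  That of c_{k+1}(t) - c_k(t) comes from (a): for equal residues the Q-polynomial is zero, so (a)
  makes the product of two scalars minus the square of an inverse. That of c_{k+2}(t) - c_k(t),
  needed in the braid relation, is supplied by a neighbour of t in which these two contents belong
  to consecutive entries. If no such neighbour is standard, the divided difference is shown to
  vanish by cancelling a nonzero factor in a domain. Nonvanishing of Q_k(t) enters on the graded
  side: it makes each scalar \<beta>_k(t) nonzero, hence of one definite degree.\<close>

definition linear_op :: "(('t \<Rightarrow> 'a::comm_ring_1) \<Rightarrow> 't \<Rightarrow> 'a) \<Rightarrow> bool" where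
  "linear_op L \<longleftrightarrow> (\<forall>v w. L (\<lambda>t. v t + w t) = (\<lambda>t. L v t + L w t)) \<and>
     (\<forall>a v. L (\<lambda>t. a * v t) = (\<lambda>t. a * L v t))"

text \<open>\<open>foldr\<close> lets the last letter act first, so that concatenation of words
  becomes composition and the result is a left action.\<close>

definition word_act :: "('g \<Rightarrow> ('t \<Rightarrow> 'a) \<Rightarrow> 't \<Rightarrow> 'a) \<Rightarrow> 'g word \<Rightarrow> ('t \<Rightarrow> 'a) \<Rightarrow> 't \<Rightarrow> 'a" where
  "word_act h w = foldr h (letters w)"

definition free_act ::
  "('g \<Rightarrow> ('t \<Rightarrow> 'a::comm_ring_1) \<Rightarrow> 't \<Rightarrow> 'a) \<Rightarrow> ('g word \<Rightarrow>\<^sub>0 'a) \<Rightarrow> ('t \<Rightarrow> 'a) \<Rightarrow> 't \<Rightarrow> 'a" where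
  "free_act h f v t = (\<Sum>w \<in> Poly_Mapping.keys f. Poly_Mapping.lookup f w * word_act h w v t)"

lemma word_act_zero [simp]: "word_act h 0 v = v"
  by (simp add: word_act_def zero_word_def)

lemma word_act_plus: "word_act h (u + w) v = word_act h u (word_act h w v)"
  by (simp add: word_act_def plus_word_def)

lemma linear_word_act:
  assumes "\<And>g. linear_op (h g)"
  shows "linear_op (word_act h w)"
proof -
  have "linear_op (foldr h ls)" for ls
    by (induction ls) (use assms in \<open>auto simp: linear_op_def\<close>)
  then show ?thesis by (simp add: word_act_def)
qed

text \<open>Provides a common index set for two elements of the free algebra; cancellation can make
  the keys of a sum smaller than the union of the keys.\<close>

lemma free_act_superset:
  assumes "finite F" "Poly_Mapping.keys f \<subseteq> F"
  shows "free_act h f v t = (\<Sum>w\<in>F. Poly_Mapping.lookup f w * word_act h w v t)"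
  unfolding free_act_def using assms
  by (intro sum.mono_neutral_left) (auto simp: in_keys_iff)

lemma free_act_add: "free_act h (f + g) v t = free_act h f v t + free_act h g v t"
  using Poly_Mapping.keys_add[of f g]
  by (simp add: free_act_superset[of "Poly_Mapping.keys f \<union> Poly_Mapping.keys g"] lookup_add
      distrib_right sum.distrib)

lemma free_act_zero [simp]: "free_act h 0 v t = 0"
  by (simp add: free_act_def)

lemma free_act_diff: "free_act h (f - g) v t = free_act h f v t - free_act h g v t"
  using free_act_add[of h "f - g" g v t] by simp

lemma free_act_uminus: "free_act h (- f) v t = - free_act h f v t"
  using free_act_diff[of h 0 f v t] by simp

lemma free_act_sum: "free_act h (sum f F) v t = (\<Sum>x\<in>F. free_act h (f x) v t)"
  by (induction F rule: infinite_finite_induct) (auto simp: free_act_add)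

lemma free_act_single: "free_act h (Poly_Mapping.single w a) v t = a * word_act h w v t"
  by (simp add: free_act_def)

lemma free_act_scal [simp]: "free_act h (scal a) v t = a * v t"
  by (simp add: scal_def free_act_single)

lemma free_act_one [simp]: "free_act h 1 v t = v t"
  using free_act_scal[of h 1 v t] by (simp add: scal_def)

lemma free_act_gen: "free_act h (gen g) v = h g v"
  by (rule ext) (simp add: gen_def free_act_single word_act_def)

lemma poly_mapping_sum_singles:
  "f = (\<Sum>w\<in>Poly_Mapping.keys f. Poly_Mapping.single w (Poly_Mapping.lookup f w))"
  by (rule poly_mapping_eqI)
     (auto simp: lookup_sum lookup_single when_def in_keys_iff)

text \<open>Linearity of the generators moves the coefficients of the second factor out of the words
  of the first; as the scalars commute, what remains is composition of words.\<close>

lemma free_act_mult: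
  fixes h :: "'g \<Rightarrow> ('t \<Rightarrow> 'a::comm_ring_1) \<Rightarrow> 't \<Rightarrow> 'a"
  assumes "\<And>g. linear_op (h g)"
  shows "free_act h (f * g) v = free_act h f (free_act h g v)"
proof (rule ext)
  fix t
  let ?s = "\<lambda>f w. Poly_Mapping.single w (Poly_Mapping.lookup f w)"
  have lin: "linear_op (word_act h w)" for w by (rule linear_word_act[OF assms])
  have lin_sum: "word_act h u (\<lambda>t. \<Sum>w\<in>F. b w * x w t) t = (\<Sum>w\<in>F. b w * word_act h u (x w) t)"
    if "finite F" for u b x and F :: "'g word set" and t
    using that
  proof (induction F arbitrary: t rule: finite_induct)
    case empty
    from lin[of u] have "word_act h u (\<lambda>t. a * v t) = (\<lambda>t. a * word_act h u v t)" for a v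
      by (simp add: linear_op_def)
    from this[of 0 "\<lambda>t. 0"] show ?case by simp
  next
    case (insert w F)
    then show ?case using lin[of u] unfolding linear_op_def by simp
  qed
  have "f * g = (\<Sum>u\<in>Poly_Mapping.keys f. \<Sum>w\<in>Poly_Mapping.keys g. ?s f u * ?s g w)"
    by (subst poly_mapping_sum_singles[of f], subst poly_mapping_sum_singles[of g])
       (simp add: sum_product)
  then have "free_act h (f * g) v t = (\<Sum>u\<in>Poly_Mapping.keys f. \<Sum>w\<in>Poly_Mapping.keys g.
      free_act h (?s f u * ?s g w) v t)"
    by (simp add: free_act_sum)
  also have "\<dots> = (\<Sum>u\<in>Poly_Mapping.keys f. Poly_Mapping.lookup f u *
      (\<Sum>w\<in>Poly_Mapping.keys g. Poly_Mapping.lookup g w * word_act h u (word_act h w v) t))"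
    by (simp add: mult_single free_act_single word_act_plus sum_distrib_left mult_ac)
  also have "\<dots> = free_act h f (free_act h g v) t"
    by (simp add: free_act_def[abs_def] lin_sum)
  finally show "free_act h (f * g) v t = free_act h f (free_act h g v) t" .
qed

lemma linear_free_act:
  assumes "\<And>g. linear_op (h g)"
  shows "linear_op (free_act h f)"
  using linear_word_act[of h, OF assms]
  by (auto simp: linear_op_def free_act_def[abs_def] distrib_left sum.distrib sum_distrib_left mult_ac)

text \<open>Polynomials in the y's act diagonally. Only points of \<open>S\<close> are recorded,
  since the generators give 0 elsewhere whereas \<open>scal a\<close> still multiplies by a, and a
  uniform formula exists only on \<open>S\<close>.\<close>

definition scalar_on :: "'t set \<Rightarrow> (('t \<Rightarrow> 'a::comm_ring_1) \<Rightarrow> 't \<Rightarrow> 'a) \<Rightarrow> ('t \<Rightarrow> 'a) \<Rightarrow> bool" where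
  "scalar_on S L \<phi> \<longleftrightarrow> (\<forall>v. \<forall>t\<in>S. L v t = \<phi> t * v t)"

locale free_action =
  fixes h :: "'g \<Rightarrow> ('t \<Rightarrow> 'a::comm_ring_1) \<Rightarrow> 't \<Rightarrow> 'a" and S :: "'t set"
  assumes linear: "linear_op (h g)"
begin

lemma mult: "free_act h (f * g) v = free_act h f (free_act h g v)"
  by (rule free_act_mult) (rule linear)

lemma scalar_scal: "scalar_on S (free_act h (scal a)) (\<lambda>t. a)"
  by (simp add: scalar_on_def)

lemma scalar_mult:
  "scalar_on S (free_act h f) \<phi> \<Longrightarrow> scalar_on S (free_act h g) \<psi> \<Longrightarrow>
   scalar_on S (free_act h (f * g)) (\<lambda>t. \<phi> t * \<psi> t)"
  by (auto simp: scalar_on_def mult mult_ac)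

lemma scalar_power:
  "scalar_on S (free_act h f) \<phi> \<Longrightarrow> scalar_on S (free_act h (f ^ p)) (\<lambda>t. \<phi> t ^ p)"
proof (induction p)
  case 0 then show ?case by (simp add: scalar_on_def)
next
  case (Suc p) then show ?case by (simp add: scalar_mult)
qed

lemma scalar_sum:
  "(\<And>x. x \<in> F \<Longrightarrow> scalar_on S (free_act h (f x)) (\<phi> x)) \<Longrightarrow>
   scalar_on S (free_act h (sum f F)) (\<lambda>t. \<Sum>x\<in>F. \<phi> x t)"
  by (simp add: scalar_on_def free_act_sum sum_distrib_right)

lemma scalar_peval:
  "scalar_on S (free_act h y) \<phi> \<Longrightarrow>
   scalar_on S (free_act h (peval scal P y)) (\<lambda>t. peval (\<lambda>a. a) P (\<phi> t))"
  unfolding peval_def by (intro scalar_sum scalar_mult scalar_scal scalar_power)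

lemma scalar_peval2:
  "scalar_on S (free_act h y) \<phi> \<Longrightarrow> scalar_on S (free_act h z) \<psi> \<Longrightarrow>
   scalar_on S (free_act h (peval2 scal Q y z)) (\<lambda>t. peval2 (\<lambda>a. a) Q (\<phi> t) (\<psi> t))"
  unfolding peval2_def by (intro scalar_sum scalar_mult scalar_scal scalar_power)

lemma scalar_ddiff:
  "scalar_on S (free_act h x) \<phi> \<Longrightarrow> scalar_on S (free_act h y) \<psi> \<Longrightarrow> scalar_on S (free_act h z) \<chi> \<Longrightarrow>
   scalar_on S (free_act h (ddiff scal Q x y z)) (\<lambda>t. ddiff (\<lambda>a. a) Q (\<phi> t) (\<psi> t) (\<chi> t))"
  unfolding ddiff_def by (intro scalar_sum scalar_mult scalar_scal scalar_power)

lemma scalar_Q3: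
  assumes "scalar_on S (free_act h x) \<phi>" "scalar_on S (free_act h y) \<psi>" "scalar_on S (free_act h z) \<chi>"
  shows "scalar_on S (free_act h (Q3 scal D i j k x y z))
    (\<lambda>t. Q3 (\<lambda>a. a) D i j k (\<phi> t) (\<psi> t) (\<chi> t))"
  using scalar_ddiff[OF assms] by (simp add: Q3_def scalar_on_def)

end

section \<open>Evaluation of polynomials in one and two variables\<close>

lemma peval_eq_poly: "peval (\<lambda>a. a) P x = poly P (x::'a::comm_ring_1)"
  by (simp add: peval_def poly_altdef)

lemma poly_eq_sum_upto:
  "degree P \<le> N \<Longrightarrow> poly P (x::'a::comm_ring_1) = (\<Sum>i\<le>N. coeff P i * x ^ i)"
  unfolding poly_altdef by (rule sum.mono_neutral_left) (auto simp: coeff_eq_0)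

text \<open>Joins the evaluation used for contents to the monomial sums of the relators.
  Substituting a scalar for u may lower the degree in v, hence the detour through a degree
  bound.\<close>

lemma eval2_eq_peval2: "eval2 Q x y = peval2 (\<lambda>a. a) Q (x::'a::comm_ring_1) y"
proof -
  have "degree (eval_fst Q x) \<le> degree Q"
    by (intro degree_le) (auto simp: eval_fst_def coeff_map_poly coeff_eq_0)
  then have "eval2 Q x y = (\<Sum>q\<le>degree Q. coeff (eval_fst Q x) q * y ^ q)"
    unfolding eval2_def by (rule poly_eq_sum_upto)
  also have "\<dots> = (\<Sum>q\<le>degree Q. (\<Sum>p\<le>degree (coeff Q q). coeff2 Q p q * x ^ p) * y ^ q)"
    by (simp add: eval_fst_def coeff_map_poly poly_altdef coeff2_def)
  finally show ?thesis by (simp add: peval2_def sum_distrib_right)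
qed

text \<open>The symmetry is given for coefficients, while the double sums run over ranges that
  depend on the degrees. Once both are enlarged to the square {..N} x {..N}, with N above all
  degrees involved, it is an interchange of summation.\<close>

lemma eval2_sym:
  assumes "\<And>p q. coeff2 Q p q = coeff2 Q' q p"
  shows "eval2 Q x y = eval2 Q' y (x::'a::comm_ring_1)"
proof -
  define N where "N = Max (insert (degree Q) (insert (degree Q') ((\<lambda>q. degree (coeff Q q)) ` {..degree Q} \<union>
     (\<lambda>q. degree (coeff Q' q)) ` {..degree Q'})))"
  have bounds: "degree Q \<le> N" "degree Q' \<le> N"
    "q \<le> degree Q \<Longrightarrow> degree (coeff Q q) \<le> N" "q \<le> degree Q' \<Longrightarrow> degree (coeff Q' q) \<le> N" for q
    unfolding N_def by (rule Max_ge; force)+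
  have *: "peval2 (\<lambda>a. a) P x y = (\<Sum>q\<le>N. \<Sum>p\<le>N. coeff2 P p q * x ^ p * y ^ q)"
    if "degree P \<le> N" "\<And>q. q \<le> degree P \<Longrightarrow> degree (coeff P q) \<le> N" for P and x y :: 'a
  proof -
    have "peval2 (\<lambda>a. a) P x y = (\<Sum>q\<le>degree P. \<Sum>p\<le>N. coeff2 P p q * x ^ p * y ^ q)"
      unfolding peval2_def using that
      by (intro sum.cong refl sum.mono_neutral_left) (auto simp: coeff2_def coeff_eq_0)
    also have "\<dots> = (\<Sum>q\<le>N. \<Sum>p\<le>N. coeff2 P p q * x ^ p * y ^ q)"
      using that by (intro sum.mono_neutral_left) (auto simp: coeff2_def coeff_eq_0)
    finally show ?thesis .
  qed
  have "eval2 Q x y = (\<Sum>q\<le>N. \<Sum>p\<le>N. coeff2 Q p q * x ^ p * y ^ q)"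
    unfolding eval2_eq_peval2 by (rule *) (use bounds in auto)
  also have "\<dots> = (\<Sum>p\<le>N. \<Sum>q\<le>N. coeff2 Q p q * x ^ p * y ^ q)"
    by (rule sum.swap)
  also have "\<dots> = eval2 Q' y x"
    unfolding eval2_eq_peval2 using *[of Q' y x] bounds assms by (simp add: mult_ac)
  finally show ?thesis .
qed

section \<open>Seminormal representations\<close>

text \<open>The inverse is described in the ambient type because the coefficient ring is a subset of
  it and need not be a field. The value is meaningful when an inverse exists; its membership in the
  subset is a separate matter.\<close>

definition uinv :: "'a::comm_ring_1 \<Rightarrow> 'a" where
  "uinv x = (THE y. x * y = 1)"

lemma uinv_eq: "x * y = 1 \<Longrightarrow> uinv x = y"
  unfolding uinv_def
proof (rule the_equality)
  fix z assume "x * y = 1" "x * z = 1"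
  then have "z = z * (x * y)" by simp
  also have "\<dots> = (x * z) * y" by (simp only: mult_ac)
  also have "\<dots> = y" using \<open>x * z = 1\<close> by simp
  finally show "z = y" .
qed

lemma inverse_uminus: "x * y = 1 \<Longrightarrow> uinv (- x) = - (y::'a::comm_ring_1)"
  by (rule uinv_eq) simp

text \<open>This is 1/x + 1/y = (x + y)/(xy) divided by x + y. With x and y the differences of
  successive contents it cancels two of the coefficients in the braid relation.\<close>

lemma inverse_sum_identity:
  fixes x y p q r :: "'a::comm_ring_1"
  assumes "x * p = 1" "y * q = 1" "(x + y) * r = 1"
  shows "q * r + r * p = p * q"
proof -
  have "p + q = p * (y * q) + q * (x * p)" using assms by simp
  also have "\<dots> = p * q * (x + y)" by (simp add: algebra_simps)
  finally have "(p + q) * r = p * q * ((x + y) * r)" by (simp only: mult_ac)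
  then show ?thesis unfolding assms(3) by (simp add: algebra_simps)
qed

text \<open>The diagonal coefficient of psi_k as a function of two residues and two contents, so
  that moving to another tableau merely permutes its arguments.\<close>

definition link :: "'i \<Rightarrow> 'i \<Rightarrow> 'a::comm_ring_1 \<Rightarrow> 'a \<Rightarrow> 'a" where
  "link i j x y = (if i = j then uinv (y - x) else 0)"

section \<open>Place permutations of residue sequences\<close>

lemma length_swap_seq [simp]: "length (swap_seq k s) = length s"
  by (simp add: swap_seq_def)

lemma ent_swap_seq:
  assumes "1 \<le> k" "k < length s" "1 \<le> m" "m \<le> length s"
  shows "ent (swap_seq k s) m = ent s (transpose k (k + 1) m)"
  using assms by (auto simp: ent_def swap_seq_def nth_list_update transpose_def)

lemma seq_eqI:
  assumes "length s = length s'" "\<And>m. 1 \<le> m \<Longrightarrow> m \<le> length s \<Longrightarrow> ent s m = ent s' m"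
  shows "s = s'"
  using assms(1)
proof (rule nth_equalityI)
  fix i assume "i < length s"
  then show "s ! i = s' ! i" using assms(2)[of "i + 1"] by (simp add: ent_def)
qed

lemma swap_seq_twice:
  assumes "1 \<le> k" "k < length s"
  shows "swap_seq k (swap_seq k s) = s"
proof (rule seq_eqI)
  fix m assume "1 \<le> m" "m \<le> length (swap_seq k (swap_seq k s))"
  then show "ent (swap_seq k (swap_seq k s)) m = ent s m"
    using assms by (simp add: ent_swap_seq) (auto simp: transpose_def ent_swap_seq)
qed simp

lemma swap_seq_same:
  assumes "1 \<le> k" "k < length s" "ent s k = ent s (k + 1)"
  shows "swap_seq k s = s"
  using assms by (intro seq_eqI) (auto simp: ent_swap_seq transpose_def)

lemma finite_seqs_of [simp]: "finite (seqs_of \<alpha>)"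
proof (cases "\<exists>s. mset s = \<alpha>")
  case True then show ?thesis unfolding seqs_of_def using mset_eq_finite by blast
qed (simp add: seqs_of_def)

lemma length_seqs_of: "s \<in> seqs_of \<alpha> \<Longrightarrow> length s = size \<alpha>"
  by (auto simp: seqs_of_def)

lemma swap_seq_in_seqs_of:
  assumes "s \<in> seqs_of \<alpha>" "1 \<le> k" "k < size \<alpha>"
  shows "swap_seq k s \<in> seqs_of \<alpha>"
proof -
  have "mset (s[k - 1 := s ! k, k := s ! (k - 1)]) = mset s"
    using assms length_seqs_of[OF assms(1)] by (intro mset_swap) auto
  then show ?thesis using assms by (simp add: seqs_of_def swap_seq_def ent_def)
qed

locale coeff_ring =
  fixes A :: "'a::comm_ring_1 set"
  assumes one_A: "1 \<in> A"
    and add_A: "x \<in> A \<Longrightarrow> y \<in> A \<Longrightarrow> x + y \<in> A"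
    and mult_A: "x \<in> A \<Longrightarrow> y \<in> A \<Longrightarrow> x * y \<in> A"
    and uminus_A: "x \<in> A \<Longrightarrow> - x \<in> A"
begin

lemma zero_A: "0 \<in> A"
  using add_A[OF one_A uminus_A[OF one_A]] by simp

lemma sum_A: "(\<And>x. x \<in> F \<Longrightarrow> f x \<in> A) \<Longrightarrow> sum f F \<in> A"
  by (induction F rule: infinite_finite_induct) (auto intro: zero_A add_A)

end

text \<open>Retains of the tableaux just what the relations use. \<open>\<sigma> k\<close> may lead
  out of \<open>S\<close>; by \<open>B_zero\<close> the coefficients are extended by zero there, so
  \<open>commute\<close> and \<open>braid\<close> can be demanded without conditions on intermediate
  points. \<open>B k t\<close> is the coefficient of v (\<open>\<sigma> k t\<close>) in the value at
  t. \<open>chain\<close> is the case of the braid relation in which both neighbours lie outside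
  \<open>S\<close>.\<close>

locale seminormal = coeff_ring A for A :: "'a::comm_ring_1 set" +
  fixes D :: "('i, 'a) klr_datum"
    and \<alpha> :: "'i multiset"
    and S :: "'t set"
    and \<sigma> :: "nat \<Rightarrow> 't \<Rightarrow> 't"
    and rs :: "'t \<Rightarrow> 'i list"
    and c :: "'t \<Rightarrow> nat \<Rightarrow> 'a"
    and B :: "nat \<Rightarrow> 't \<Rightarrow> 'a"
  assumes finite_S: "finite S"
    and Q_A: "coeff2 (Qpol D i j) p q \<in> A"
    and W_A: "coeff (Wpol D i) p \<in> A"
    and Q_sym: "coeff2 (Qpol D i j) p q = coeff2 (Qpol D j i) q p"
    and rs_seq: "t \<in> S \<Longrightarrow> rs t \<in> seqs_of \<alpha>"
    and c_A: "t \<in> S \<Longrightarrow> 1 \<le> k \<Longrightarrow> k \<le> size \<alpha> \<Longrightarrow> c t k \<in> A"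
    and B_A: "t \<in> S \<Longrightarrow> 1 \<le> k \<Longrightarrow> k < size \<alpha> \<Longrightarrow> B k t \<in> A"
    and B_zero: "t \<in> S \<Longrightarrow> 1 \<le> k \<Longrightarrow> k < size \<alpha> \<Longrightarrow> \<sigma> k t \<notin> S \<Longrightarrow> B k t = 0"
    and \<sigma>_twice: "t \<in> S \<Longrightarrow> \<sigma> k (\<sigma> k t) = t"
    and \<sigma>_commute: "t \<in> S \<Longrightarrow> \<bar>int k - int m\<bar> > 1 \<Longrightarrow> \<sigma> k (\<sigma> m t) = \<sigma> m (\<sigma> k t)"
    and \<sigma>_braid: "t \<in> S \<Longrightarrow> \<sigma> k (\<sigma> (k + 1) (\<sigma> k t)) = \<sigma> (k + 1) (\<sigma> k (\<sigma> (k + 1) t))"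
    and rs_\<sigma>: "t \<in> S \<Longrightarrow> 1 \<le> k \<Longrightarrow> k < size \<alpha> \<Longrightarrow> rs (\<sigma> k t) = swap_seq k (rs t)"
    and c_\<sigma>: "t \<in> S \<Longrightarrow> 1 \<le> k \<Longrightarrow> k < size \<alpha> \<Longrightarrow> 1 \<le> m \<Longrightarrow> m \<le> size \<alpha> \<Longrightarrow>
      c (\<sigma> k t) m = c t (transpose k (k + 1) m)"
    and invertible: "t \<in> S \<Longrightarrow> 1 \<le> k \<Longrightarrow> k < size \<alpha> \<Longrightarrow> ent (rs t) k = ent (rs t) (k + 1) \<Longrightarrow>
      \<exists>y\<in>A. (c t (k + 1) - c t k) * y = 1"
    and adjacent: "t \<in> S \<Longrightarrow> 1 \<le> k \<Longrightarrow> k < size \<alpha> \<Longrightarrow> \<sigma> k t \<notin> S \<Longrightarrow>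
      ent (rs t) k \<noteq> ent (rs t) (k + 1) \<and>
      eval2 (Qpol D (ent (rs t) k) (ent (rs t) (k + 1))) (c t k) (c t (k + 1)) = 0"
    and quadratic: "t \<in> S \<Longrightarrow> 1 \<le> k \<Longrightarrow> k < size \<alpha> \<Longrightarrow> \<sigma> k t \<in> S \<Longrightarrow>
      B k t * B k (\<sigma> k t) =
      eval2 (Qpol D (ent (rs t) k) (ent (rs t) (k + 1))) (c t k) (c t (k + 1)) -
      (link (ent (rs t) k) (ent (rs t) (k + 1)) (c t k) (c t (k + 1)))\<^sup>2"
    and commute: "t \<in> S \<Longrightarrow> 1 \<le> k \<Longrightarrow> k < size \<alpha> \<Longrightarrow> 1 \<le> m \<Longrightarrow> m < size \<alpha> \<Longrightarrow>
      \<bar>int k - int m\<bar> > 1 \<Longrightarrow> B k t * B m (\<sigma> k t) = B m t * B k (\<sigma> m t)"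
    and braid: "t \<in> S \<Longrightarrow> 1 \<le> k \<Longrightarrow> k + 1 < size \<alpha> \<Longrightarrow>
      B k t * B (k + 1) (\<sigma> k t) * B k (\<sigma> (k + 1) (\<sigma> k t)) =
      B (k + 1) t * B k (\<sigma> (k + 1) t) * B (k + 1) (\<sigma> k (\<sigma> (k + 1) t))"
    and chain: "t \<in> S \<Longrightarrow> 1 \<le> k \<Longrightarrow> k + 1 < size \<alpha> \<Longrightarrow> \<sigma> k t \<notin> S \<Longrightarrow> \<sigma> (k + 1) t \<notin> S \<Longrightarrow>
      ent (rs t) k = ent (rs t) (k + 2) \<Longrightarrow>
      ddiff (\<lambda>a. a) (Qpol D (ent (rs t) k) (ent (rs t) (k + 1))) (c t k) (c t (k + 1)) (c t (k + 2)) = 0"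
    and weight: "t \<in> S \<Longrightarrow> 1 \<le> size \<alpha> \<Longrightarrow> poly (Wpol D (ent (rs t) 1)) (c t 1) = 0"
begin

definition d :: "nat \<Rightarrow> 't \<Rightarrow> 'a" where
  "d k t = link (ent (rs t) k) (ent (rs t) (k + 1)) (c t k) (c t (k + 1))"

text \<open>The argument is read at \<open>\<sigma> k t\<close> even if this lies outside
  \<open>S\<close>: for admissible k the factor \<open>B k t\<close> is then zero. The value 0 off
  \<open>S\<close> keeps the functions supported on \<open>S\<close> stable.\<close>

definition gen_act :: "'i klr_gen \<Rightarrow> ('t \<Rightarrow> 'a) \<Rightarrow> 't \<Rightarrow> 'a" where
  "gen_act g v t = (if t \<in> S then (case g of
       Idp s \<Rightarrow> if rs t = s then v t else 0
     | Psi k \<Rightarrow> B k t * v (\<sigma> k t) + d k t * v t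
     | Y k \<Rightarrow> c t k * v t) else 0)"

lemma linear_gen_act: "linear_op (gen_act g)"
  by (cases g) (auto simp: linear_op_def gen_act_def fun_eq_iff algebra_simps)

sublocale free_action gen_act S
  by standard (rule linear_gen_act)

abbreviation act :: "('i, 'a) klr_free \<Rightarrow> ('t \<Rightarrow> 'a) \<Rightarrow> 't \<Rightarrow> 'a" where
  "act \<equiv> free_act gen_act"

lemma act_idp: "t \<in> S \<Longrightarrow> act (idp s) v t = (if rs t = s then v t else 0)"
  by (simp add: free_act_gen gen_act_def)

lemma act_yy: "t \<in> S \<Longrightarrow> act (yy k) v t = c t k * v t"
  by (simp add: free_act_gen gen_act_def)

lemma act_psi: "t \<in> S \<Longrightarrow> act (psi k) v t = B k t * v (\<sigma> k t) + d k t * v t"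
  by (simp add: free_act_gen gen_act_def)

lemma scalar_yy: "scalar_on S (act (yy k)) (\<lambda>t. c t k)"
  by (simp add: scalar_on_def act_yy)

text \<open>The inner operator has its formula only at points of \<open>S\<close>; if
  \<open>\<sigma> k t\<close> is not one, the factor \<open>B k t\<close> removes the offending
  term, so the expansion needs no case distinction.\<close>

lemma act_psi_psi:
  assumes "t \<in> S" "1 \<le> k" "k < size \<alpha>"
  shows "act (psi k) (act (psi m) v) t =
    B k t * (B m (\<sigma> k t) * v (\<sigma> m (\<sigma> k t)) + d m (\<sigma> k t) * v (\<sigma> k t)) +
    d k t * (B m t * v (\<sigma> m t) + d m t * v t)"
proof (cases "\<sigma> k t \<in> S")
  case True then show ?thesis using assms by (simp add: act_psi)
next
  case False then show ?thesis using assms B_zero[of t k] by (simp add: act_psi)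
qed

lemma length_rs: "t \<in> S \<Longrightarrow> length (rs t) = size \<alpha>"
  using rs_seq length_seqs_of by blast

lemma ent_\<sigma>:
  assumes "t \<in> S" "1 \<le> k" "k < size \<alpha>" "1 \<le> m" "m \<le> size \<alpha>"
  shows "ent (rs (\<sigma> k t)) m = ent (rs t) (transpose k (k + 1) m)"
  using assms by (simp add: rs_\<sigma> ent_swap_seq length_rs)

lemma d_eq:
  assumes "t \<in> S" "1 \<le> k" "k < size \<alpha>"
  shows "d k t * (c t (k + 1) - c t k) = (if ent (rs t) k = ent (rs t) (k + 1) then 1 else 0)"
  using invertible[OF assms] by (auto simp: d_def link_def uinv_eq mult.commute)

lemma d_zero: "ent (rs t) k \<noteq> ent (rs t) (k + 1) \<Longrightarrow> d k t = 0"
  by (simp add: d_def link_def)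

lemma d_A: "t \<in> S \<Longrightarrow> 1 \<le> k \<Longrightarrow> k < size \<alpha> \<Longrightarrow> d k t \<in> A"
  using invertible[of t k] zero_A by (auto simp: d_def link_def uinv_eq)

lemma d_\<sigma>:
  assumes "t \<in> S" "1 \<le> k" "k < size \<alpha>" "1 \<le> m" "m < size \<alpha>"
  shows "d m (\<sigma> k t) = link (ent (rs t) (transpose k (k + 1) m)) (ent (rs t) (transpose k (k + 1) (m + 1)))
    (c t (transpose k (k + 1) m)) (c t (transpose k (k + 1) (m + 1)))"
  using assms by (simp add: d_def ent_\<sigma> c_\<sigma>)

lemma d_\<sigma>_same:
  assumes "t \<in> S" "1 \<le> k" "k < size \<alpha>"
  shows "d k (\<sigma> k t) = - d k t"
proof -
  have "d k (\<sigma> k t) = link (ent (rs t) (k + 1)) (ent (rs t) k) (c t (k + 1)) (c t k)"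
    using d_\<sigma>[OF assms assms(2,3)] by (simp add: transpose_def)
  then show ?thesis
  proof (cases "ent (rs t) k = ent (rs t) (k + 1)")
    case True
    then obtain y where y: "(c t (k + 1) - c t k) * y = 1" using invertible assms by blast
    show ?thesis
      using \<open>d k (\<sigma> k t) = _\<close> True uinv_eq[OF y] inverse_uminus[OF y]
      by (simp add: link_def d_def)
  qed (simp add: link_def d_def)
qed

lemma d_\<sigma>_far:
  assumes "t \<in> S" "1 \<le> k" "k < size \<alpha>" "1 \<le> m" "m < size \<alpha>" "\<bar>int k - int m\<bar> > 1"
  shows "d m (\<sigma> k t) = d m t"
proof -
  have "m \<noteq> k" "m \<noteq> k + 1" "m + 1 \<noteq> k" using assms(6) by auto
  then show ?thesis using d_\<sigma>[OF assms(1-5)] by (simp add: transpose_def d_def)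
qed

text \<open>Extends \<open>quadratic\<close> to neighbours outside \<open>S\<close>: there
  \<open>B k t\<close> is zero, the Q-value is zero by \<open>adjacent\<close>, and the residues
  differ, which makes the diagonal coefficient zero too.\<close>

lemma B_B:
  assumes "t \<in> S" "1 \<le> k" "k < size \<alpha>"
  shows "B k t * B k (\<sigma> k t) =
    eval2 (Qpol D (ent (rs t) k) (ent (rs t) (k + 1))) (c t k) (c t (k + 1)) - (d k t)\<^sup>2"
proof (cases "\<sigma> k t \<in> S")
  case True then show ?thesis using quadratic assms by (simp add: d_def)
next
  case False
  then show ?thesis using adjacent[OF assms] B_zero[OF assms] d_zero[of t k] by simp
qed

section \<open>The defining relations, checked pointwise\<close>

lemma relation_psi_psi_commute:
  assumes "t \<in> S" "1 \<le> k" "k < size \<alpha>" "1 \<le> m" "m < size \<alpha>" "\<bar>int k - int m\<bar> > 1"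
  shows "act (psi k * psi m - psi m * psi k) v t = 0"
proof -
  have "\<bar>int m - int k\<bar> > 1" using assms by linarith
  then have far: "d m (\<sigma> k t) = d m t" "d k (\<sigma> m t) = d k t"
    using d_\<sigma>_far assms by blast+
  have "act (psi k * psi m - psi m * psi k) v t =
      (B k t * B m (\<sigma> k t) - B m t * B k (\<sigma> m t)) * v (\<sigma> m (\<sigma> k t))"
    using assms \<sigma>_commute[of t k m]
    by (simp add: free_act_diff mult act_psi_psi far algebra_simps)
  then show ?thesis using commute[OF assms] by simp
qed

text \<open>The off-diagonal part permutes residues as required. The diagonal part can be nonzero
  only if the residues at k and k + 1 agree, and then the place permutation fixes the
  sequence.\<close>

lemma relation_psi_idp:
  assumes "t \<in> S" "1 \<le> k" "k < size \<alpha>" "s \<in> seqs_of \<alpha>"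
  shows "act (psi k * idp s - idp (swap_seq k s) * psi k) v t = 0"
proof -
  have len: "k < length (rs t)" "k < length s" using assms length_rs[of t] length_seqs_of[of s] by auto
  have 1: "B k t * act (idp s) v (\<sigma> k t) = (if rs t = swap_seq k s then B k t * v (\<sigma> k t) else 0)"
  proof (cases "\<sigma> k t \<in> S")
    case True
    have "swap_seq k (rs t) = s \<longleftrightarrow> rs t = swap_seq k s"
      using swap_seq_twice len assms by metis
    then show ?thesis using True assms by (auto simp: act_idp rs_\<sigma>)
  next
    case False then show ?thesis using B_zero assms by simp
  qed
  have 2: "d k t * act (idp s) v t = (if rs t = swap_seq k s then d k t * v t else 0)"
  proof (cases "ent (rs t) k = ent (rs t) (k + 1)")
    case True
    then have "swap_seq k (rs t) = rs t" using swap_seq_same len assms by blast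
    then have "rs t = s \<longleftrightarrow> rs t = swap_seq k s"
      using swap_seq_twice len assms by metis
    then show ?thesis using assms by (auto simp: act_idp)
  qed (use d_zero[of t k] in simp)
  show ?thesis
    using 1 2 assms by (auto simp: free_act_diff mult act_psi act_idp)
qed

lemma act_psi_yy:
  assumes "t \<in> S" "1 \<le> k" "k < size \<alpha>" "1 \<le> m" "m \<le> size \<alpha>"
  shows "act (psi k) (act (yy m) v) t = B k t * c t (transpose k (k + 1) m) * v (\<sigma> k t) + d k t * c t m * v t"
proof (cases "\<sigma> k t \<in> S")
  case True then show ?thesis using assms by (simp add: act_psi act_yy c_\<sigma> mult.assoc)
next
  case False then show ?thesis using assms B_zero[of t k] by (simp add: act_psi act_yy mult.assoc)
qed

lemma relation_psi_yy_far:
  assumes "t \<in> S" "1 \<le> k" "k < size \<alpha>" "1 \<le> m" "m \<le> size \<alpha>" "m \<noteq> k" "m \<noteq> k + 1"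
  shows "act (psi k * yy m - yy m * psi k) v t = 0"
  using assms
  by (simp add: free_act_diff mult act_psi_yy act_yy) (simp add: act_psi algebra_simps)

text \<open>The off-diagonal terms cancel because entry k + 1 of the neighbour has the content of
  entry k of t; the diagonal leaves \<open>d k t\<close> times the difference it inverts.\<close>

lemma relation_psi_yy:
  assumes "t \<in> S" "1 \<le> k" "k < size \<alpha>"
  shows "act (psi k * yy (k + 1) - yy k * psi k) v t =
    (if ent (rs t) k = ent (rs t) (k + 1) then v t else 0)"
proof -
  have "act (psi k * yy (k + 1) - yy k * psi k) v t = d k t * (c t (k + 1) - c t k) * v t"
    using assms
  by (simp add: free_act_diff mult act_psi_yy act_yy) (simp add: act_psi algebra_simps)
  then show ?thesis using d_eq[OF assms] by simp
qed

lemma relation_yy_psi: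
  assumes "t \<in> S" "1 \<le> k" "k < size \<alpha>"
  shows "act (yy (k + 1) * psi k - psi k * yy k) v t =
    (if ent (rs t) k = ent (rs t) (k + 1) then v t else 0)"
proof -
  have "act (yy (k + 1) * psi k - psi k * yy k) v t = d k t * (c t (k + 1) - c t k) * v t"
    using assms
  by (simp add: free_act_diff mult act_psi_yy act_yy) (simp add: act_psi algebra_simps)
  then show ?thesis using d_eq[OF assms] by simp
qed

text \<open>The mixed terms cancel since \<open>d k\<close> changes sign from t to
  \<open>\<sigma> k t\<close>; the square of \<open>d k t\<close> is what was subtracted in the
  quadratic condition.\<close>

lemma relation_psi_psi:
  assumes "t \<in> S" "1 \<le> k" "k < size \<alpha>"
  shows "act (psi k * psi k) v t =
    eval2 (Qpol D (ent (rs t) k) (ent (rs t) (k + 1))) (c t k) (c t (k + 1)) * v t"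
proof -
  have "act (psi k * psi k) v t = (B k t * B k (\<sigma> k t) + (d k t)\<^sup>2) * v t"
    using assms by (simp add: mult act_psi_psi d_\<sigma>_same \<sigma>_twice power2_eq_square algebra_simps)
  then show ?thesis using B_B[OF assms] by simp
qed

lemma eval2_Q_sym: "eval2 (Qpol D i j) x y = eval2 (Qpol D j i) y x"
  by (rule eval2_sym) (rule Q_sym)

lemma ddiff_Q:
  "(x - z) * ddiff (\<lambda>a. a) (Qpol D i j) x y z = eval2 (Qpol D i j) x y - eval2 (Qpol D j i) y z"
  using ddiff_eq[of x z "\<lambda>a. a" "Qpol D i j" y] eval2_Q_sym[of j i y z] by (simp add: eval2_eq_peval2)

text \<open>\<open>invertible\<close> speaks of consecutive entries only. The contents of k and k +
  2 become consecutive in \<open>\<sigma> k t\<close> (at k + 1, k + 2) and in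
  \<open>\<sigma> (k + 1) t\<close> (at k, k + 1), so one of these points in \<open>S\<close> is
  enough.\<close>

lemma links:
  assumes t: "t \<in> S" "1 \<le> k" "k + 1 < size \<alpha>"
  defines "r \<equiv> link (ent (rs t) k) (ent (rs t) (k + 2)) (c t k) (c t (k + 2))"
  assumes S: "\<sigma> k t \<in> S \<or> \<sigma> (k + 1) t \<in> S"
  shows "ent (rs t) k = ent (rs t) (k + 2) \<Longrightarrow> (c t (k + 2) - c t k) * r = 1"
    and "d (k + 1) t * r + r * d k t = d k t * d (k + 1) t"
proof -
  have ex: "\<exists>y. (c t (k + 2) - c t k) * y = 1" if e: "ent (rs t) k = ent (rs t) (k + 2)"
  proof (cases "\<sigma> k t \<in> S")
    case True
    then show ?thesis using invertible[of "\<sigma> k t" "k + 1"] t e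
      by (auto simp: ent_\<sigma> c_\<sigma> transpose_def)
  next
    case False
    then have "\<sigma> (k + 1) t \<in> S" using S by simp
    then show ?thesis using invertible[of "\<sigma> (k + 1) t" k] t e
      by (auto simp: ent_\<sigma> c_\<sigma> transpose_def)
  qed
  show r: "(c t (k + 2) - c t k) * r = 1" if e: "ent (rs t) k = ent (rs t) (k + 2)"
    using ex[OF e] e by (auto simp: r_def link_def uinv_eq)
  show "d (k + 1) t * r + r * d k t = d k t * d (k + 1) t"
  proof (cases "ent (rs t) k = ent (rs t) (k + 1) \<and> ent (rs t) k = ent (rs t) (k + 2)")
    case True
    then have "(c t (k + 1) - c t k) * d k t = 1" "(c t (k + 2) - c t (k + 1)) * d (k + 1) t = 1"
      using d_eq[of t k] d_eq[of t "k + 1"] t by (auto simp: mult.commute)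
    then show ?thesis
      by (rule inverse_sum_identity) (use r[OF conjunct2[OF True]] in \<open>simp add: algebra_simps\<close>)
  next
    case False
    then show ?thesis using d_zero[of t k] d_zero[of t "k + 1"] by (auto simp: r_def link_def)
  qed
qed

lemma relation_braid:
  assumes t: "t \<in> S" and k: "1 \<le> k" "k + 1 < size \<alpha>"
  shows "act (psi (k + 1) * psi k * psi (k + 1) - psi k * psi (k + 1) * psi k) v t =
    Q3 (\<lambda>a. a) D (ent (rs t) k) (ent (rs t) (k + 1)) (ent (rs t) (k + 2))
      (c t k) (c t (k + 1)) (c t (k + 2)) * v t"
proof -
  define k' where "k' = k + 1"
  have k': "1 \<le> k'" "k' < size \<alpha>" "k < size \<alpha>" using k by (auto simp: k'_def)
  define i j l where "i = ent (rs t) k" and "j = ent (rs t) (k + 1)" and "l = ent (rs t) (k + 2)"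
  define x y z where "x = c t k" and "y = c t (k + 1)" and "z = c t (k + 2)"
  define t1 t2 where "t1 = \<sigma> k t" and "t2 = \<sigma> k' t"
  define t12 t21 where "t12 = \<sigma> k' t1" and "t21 = \<sigma> k t2"
  define t0 where "t0 = \<sigma> k t12"
  define p q r where "p = d k t" and "q = d k' t" and "r = link i l x z"
  have t0: "\<sigma> k' t21 = t0"
    using \<sigma>_braid[OF t, of k] by (simp add: t0_def t12_def t21_def t1_def t2_def k'_def)
  have inv: "\<sigma> k t1 = t" "\<sigma> k' t2 = t" using \<sigma>_twice t by (simp_all add: t1_def t2_def)
  have B1: "t1 \<notin> S \<Longrightarrow> B k t = 0" and B2: "t2 \<notin> S \<Longrightarrow> B k' t = 0"
    using B_zero t k k' by (auto simp: t1_def t2_def)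
  have dd: "t1 \<in> S \<Longrightarrow> d k t1 = - p" "t1 \<in> S \<Longrightarrow> d k' t1 = r"
    "t2 \<in> S \<Longrightarrow> d k' t2 = - q" "t2 \<in> S \<Longrightarrow> d k t2 = r"
    using d_\<sigma>_same[OF t, of k] d_\<sigma>_same[OF t, of k'] d_\<sigma>[OF t, of k k'] d_\<sigma>[OF t, of k' k] k k'
    by (auto simp: t1_def t2_def p_def q_def r_def i_def l_def x_def z_def k'_def transpose_def)
  have d12: "d k t12 = q" if "t1 \<in> S" "t12 \<in> S"
    using d_\<sigma>[of t1 k' k] that k k' t
    by (simp add: t12_def t1_def q_def d_def k'_def transpose_def ent_\<sigma> c_\<sigma>)
  have d21: "d k' t21 = p" if "t2 \<in> S" "t21 \<in> S"
    using d_\<sigma>[of t2 k k'] that k k' t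
    by (simp add: t21_def t2_def p_def d_def k'_def transpose_def ent_\<sigma> c_\<sigma>)
  have psi3: "act (psi a) w u = B a u * w (\<sigma> a u) + d a u * w u" if "u \<in> S" for a w u
    using that by (rule act_psi)
  have L: "act (psi k' * psi k * psi k') v t =
     B k' t * (B k t2 * (B k' t21 * v t0 + p * v t21) + r * (B k' t2 * v t - q * v t2)) +
     q * (B k t * (B k' t1 * v t12 + r * v t1) + p * (B k' t * v t2 + q * v t))"
  proof -
    have 1: "act (psi k) (act (psi k') v) t =
        B k t * (B k' t1 * v t12 + r * v t1) + p * (B k' t * v t2 + q * v t)"
      using act_psi_psi[OF t k(1) k'(3), of k' v] dd B1
      by (cases "t1 \<in> S") (auto simp: t1_def t2_def t12_def p_def q_def)
    \<comment> \<open>The leading factor allows \<open>t2\<close> to be taken in \<open>S\<close>.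
      If \<open>t21\<close> leaves \<open>S\<close>, then \<open>B k t2 = 0\<close> and the value of
      \<open>d k' t21\<close> does not matter.\<close>
    have 2: "B k' t * act (psi k) (act (psi k') v) t2 =
        B k' t * (B k t2 * (B k' t21 * v t0 + p * v t21) + r * (B k' t2 * v t - q * v t2))"
    proof (cases "t2 \<in> S")
      case True
      have "B k t2 * (B k' t21 * v t0 + d k' t21 * v t21) = B k t2 * (B k' t21 * v t0 + p * v t21)"
        using d21[OF True] B_zero[OF True k(1) k'(3)] by (cases "t21 \<in> S") (auto simp: t21_def)
      then show ?thesis
        using act_psi_psi[OF True k(1) k'(3), of k' v] dd True
        by (simp add: inv t0 t21_def[symmetric])
    qed (simp add: B2)
    show ?thesis
      using 1 2 by (simp add: mult psi3[OF t] mult.assoc t2_def[symmetric] q_def[symmetric])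
  qed
  have R: "act (psi k * psi k' * psi k) v t =
     B k t * (B k' t1 * (B k t12 * v t0 + q * v t12) + r * (B k t1 * v t - p * v t1)) +
     p * (B k' t * (B k t2 * v t21 + r * v t2) + q * (B k t * v t1 + p * v t))"
  proof -
    have 1: "act (psi k') (act (psi k) v) t =
        B k' t * (B k t2 * v t21 + r * v t2) + q * (B k t * v t1 + p * v t)"
      using act_psi_psi[OF t k'(1,2), of k v] dd B2
      by (cases "t2 \<in> S") (auto simp: t1_def t2_def t21_def p_def q_def)
    have 2: "B k t * act (psi k') (act (psi k) v) t1 =
        B k t * (B k' t1 * (B k t12 * v t0 + q * v t12) + r * (B k t1 * v t - p * v t1))"
    proof (cases "t1 \<in> S")
      case True
      have "B k' t1 * (B k t12 * v t0 + d k t12 * v t12) = B k' t1 * (B k t12 * v t0 + q * v t12)"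
        using d12[OF True] B_zero[OF True k'(1,2)] by (cases "t12 \<in> S") (auto simp: t12_def)
      then show ?thesis
        using act_psi_psi[OF True k'(1,2), of k v] dd True
        by (simp add: inv t0_def[symmetric] t12_def[symmetric])
    qed (simp add: B1)
    show ?thesis
      using 1 2 by (simp add: mult psi3[OF t] mult.assoc t1_def[symmetric] p_def[symmetric])
  qed
  have top: "B k t * B k' t1 * B k t12 = B k' t * B k t2 * B k' t21"
    using braid[OF t k] by (simp add: t1_def t2_def t12_def t21_def k'_def)
  have pqr: "q * r + r * p = p * q" if "t1 \<in> S \<or> t2 \<in> S"
    using links(2)[OF t k] that
    by (simp add: p_def q_def r_def i_def l_def x_def z_def k'_def t1_def t2_def)
  \<comment> \<open>\<open>E1\<close> and \<open>E2\<close> are the coefficients at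
    \<open>v t1\<close> and \<open>v t2\<close>: either the outer factor vanishes or the partial
    fraction identity does the cancelling.\<close>
  have E1: "B k t * (q * r + r * p - p * q) = 0" using B1 pqr by (cases "t1 \<in> S") auto
  have E2: "B k' t * (q * r + r * p - p * q) = 0" using B2 pqr by (cases "t2 \<in> S") auto
  define F F' where "F = B k t * B k t1" and "F' = B k' t * B k' t2"
  have F: "F = eval2 (Qpol D i j) x y - p\<^sup>2" "F' = eval2 (Qpol D j l) y z - q\<^sup>2"
    using B_B[OF t, of k] B_B[OF t, of k'] k k'
    by (simp_all add: F_def F'_def t1_def t2_def i_def j_def l_def x_def y_def z_def p_def q_def k'_def)
  have E3: "r * F' - r * F + q\<^sup>2 * p - p\<^sup>2 * q = Q3 (\<lambda>a. a) D i j l x y z"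
  proof (cases "t1 \<in> S \<or> t2 \<in> S")
    case True
    \<comment> \<open>After substituting \<open>F\<close> and \<open>F'\<close>, the terms free of
      Q-polynomials factor through the partial fraction expression once more; the rest is a divided
      difference, as r inverts z - x.\<close>
    have "r * F' - r * F + q\<^sup>2 * p - p\<^sup>2 * q =
        r * (eval2 (Qpol D j l) y z - eval2 (Qpol D i j) x y) + (p - q) * (q * r + r * p - p * q)"
      by (simp add: F power2_eq_square algebra_simps)
    also have "\<dots> = r * (eval2 (Qpol D j l) y z - eval2 (Qpol D i j) x y)"
      using pqr[OF True] by simp
    also have "\<dots> = Q3 (\<lambda>a. a) D i j l x y z"
    proof (cases "i = l")
      case e: True
      have "(z - x) * r = 1"
        using links(1)[OF t k] True e
        by (simp add: r_def i_def l_def x_def z_def t1_def t2_def k'_def)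
      moreover have "(x - z) * Q3 (\<lambda>a. a) D i j l x y z = eval2 (Qpol D i j) x y - eval2 (Qpol D j l) y z"
        using ddiff_Q[of x z i j y] e by (simp add: Q3_def)
      then have "r * (eval2 (Qpol D j l) y z - eval2 (Qpol D i j) x y) =
          ((z - x) * r) * Q3 (\<lambda>a. a) D i j l x y z"
        by (simp add: algebra_simps) (metis (no_types, lifting) distrib_left mult.left_commute)
      ultimately show ?thesis by simp
    qed (simp add: r_def link_def Q3_def)
    finally show ?thesis .
  next
    case False
    \<comment> \<open>Here r may be an unspecified value of \<open>uinv\<close>, but it is only
      multiplied by F and F', which vanish; p = 0 removes the remaining terms, and
      \<open>chain\<close> makes the right-hand side zero.\<close>
    have "F = 0" "F' = 0" using False B1 B2 by (auto simp: F_def F'_def)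
    moreover have "p = 0"
      using adjacent[OF t k(1) k'(3)] False d_zero[of t k] by (auto simp: p_def t1_def)
    moreover have "Q3 (\<lambda>a. a) D i j l x y z = 0"
      using chain[OF t k] False
      by (simp add: Q3_def i_def j_def l_def x_def y_def z_def t1_def t2_def k'_def)
    ultimately show ?thesis by simp
  qed
  have "act (psi k' * psi k * psi k' - psi k * psi k' * psi k) v t =
     (B k' t * B k t2 * B k' t21 - B k t * B k' t1 * B k t12) * v t0 +
     B k t * (q * r + r * p - p * q) * v t1 - B k' t * (q * r + r * p - p * q) * v t2 +
     (r * F' - r * F + q\<^sup>2 * p - p\<^sup>2 * q) * v t"
    unfolding free_act_diff L R F_def F'_def by (simp add: algebra_simps power2_eq_square)
  then show ?thesis
    using top E1 E2 E3 by (simp add: k'_def i_def j_def l_def x_def y_def z_def)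
qed

text \<open>A relator with coefficients depending on s ends in \<open>idp s\<close>. It therefore
  acts on a function whose value at t is zero unless \<open>rs t = s\<close>, which permits
  replacing the residues of s by those of t.\<close>

lemma act_relator:
  assumes g: "g \<in> klr_relators D \<alpha>" and t: "t \<in> S"
  shows "act g v t = 0"
proof -
  have idp_last: "act (f * idp s) v t = act f (act (idp s) v) t" for f s
    by (simp add: mult)
  have sc: "act (f * idp s) v t = \<phi> t * act (idp s) v t" if "scalar_on S (act f) \<phi>" for f s \<phi>
    using that t by (simp add: mult scalar_on_def)
  have yk: "scalar_on S (act (yy m)) (\<lambda>t. c t m)" for m by (rule scalar_yy)
  have delta: "act (if P then 1 else 0) w t = (if P then w t else 0)" for P w by simp
  from g show ?thesis
    unfolding klr_relators_def Let_def
  proof (elim UnE CollectE exE conjE)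
    fix s s' assume "g = idp s * idp s' - (if s = s' then idp s else 0)"
    then show ?thesis using t by (auto simp: free_act_diff mult act_idp)
  next
    assume "g \<in> {(\<Sum>s\<in>seqs_of \<alpha>. idp s) - 1}"
    then show ?thesis using t rs_seq[OF t] by (simp add: free_act_diff free_act_sum act_idp)
  next
    fix k s assume "g = yy k * idp s - idp s * yy k"
    then show ?thesis using t by (simp add: free_act_diff mult act_idp act_yy)
  next
    fix k m assume "g = yy k * yy m - yy m * yy k"
    then show ?thesis using t by (simp add: free_act_diff mult act_yy)
  next
    fix k m assume "g = psi k * yy m - yy m * psi k" "k \<in> {1..<size \<alpha>}" "m \<in> {1..size \<alpha>}"
      "m \<noteq> k" "m \<noteq> k + 1"
    then show ?thesis using relation_psi_yy_far[OF t, of k m v] by auto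
  next
    fix k m assume "g = psi k * psi m - psi m * psi k" "k \<in> {1..<size \<alpha>}" "m \<in> {1..<size \<alpha>}"
      "1 < \<bar>int k - int m\<bar>"
    then show ?thesis using relation_psi_psi_commute[OF t, of k m v] by auto
  next
    fix k s assume "g = psi k * idp s - idp (swap_seq k s) * psi k" "k \<in> {1..<size \<alpha>}" "s \<in> seqs_of \<alpha>"
    then show ?thesis using relation_psi_idp[OF t, of k s v] by auto
  next
    fix k s assume g: "g = (psi k * yy (k + 1) - yy k * psi k) * idp s -
        (if ent s k = ent s (k + 1) then 1 else 0) * idp s" "k \<in> {1..<size \<alpha>}"
    have "act g v t = act (psi k * yy (k + 1) - yy k * psi k) (act (idp s) v) t -
        (if ent s k = ent s (k + 1) then act (idp s) v t else 0)"
      unfolding g(1) by (subst free_act_diff) (simp only: idp_last delta)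
    then show ?thesis using relation_psi_yy[OF t, of k "act (idp s) v"] g(2) t by (simp add: act_idp)
  next
    fix k s assume g: "g = (yy (k + 1) * psi k - psi k * yy k) * idp s -
        (if ent s k = ent s (k + 1) then 1 else 0) * idp s" "k \<in> {1..<size \<alpha>}"
    have "act g v t = act (yy (k + 1) * psi k - psi k * yy k) (act (idp s) v) t -
        (if ent s k = ent s (k + 1) then act (idp s) v t else 0)"
      unfolding g(1) by (subst free_act_diff) (simp only: idp_last delta)
    then show ?thesis using relation_yy_psi[OF t, of k "act (idp s) v"] g(2) t by (simp add: act_idp)
  next
    fix k s assume g: "g = psi k * psi k * idp s -
        peval2 scal (Qpol D (ent s k) (ent s (k + 1))) (yy k) (yy (k + 1)) * idp s" "k \<in> {1..<size \<alpha>}"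
    have "act g v t = act (psi k * psi k) (act (idp s) v) t -
        eval2 (Qpol D (ent s k) (ent s (k + 1))) (c t k) (c t (k + 1)) * act (idp s) v t"
      unfolding g(1) eval2_eq_peval2 free_act_diff idp_last[of "psi k * psi k"]
      by (simp only: sc[OF scalar_peval2[OF yk yk]])
    then show ?thesis using relation_psi_psi[OF t, of k "act (idp s) v"] g(2) t by (simp add: act_idp)
  next
    fix k s assume g: "g = (psi (k + 1) * psi k * psi (k + 1) - psi k * psi (k + 1) * psi k) * idp s -
        Q3 scal D (ent s k) (ent s (k + 1)) (ent s (k + 2)) (yy k) (yy (k + 1)) (yy (k + 2)) * idp s"
      "1 \<le> k" "k + 1 < size \<alpha>"
    have "act g v t = act (psi (k + 1) * psi k * psi (k + 1) - psi k * psi (k + 1) * psi k) (act (idp s) v) t -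
        Q3 (\<lambda>a. a) D (ent s k) (ent s (k + 1)) (ent s (k + 2)) (c t k) (c t (k + 1)) (c t (k + 2)) *
        act (idp s) v t"
      unfolding g(1) free_act_diff[of _ "_ * _"]
        idp_last[of "psi (k + 1) * psi k * psi (k + 1) - psi k * psi (k + 1) * psi k"]
      by (simp only: sc[OF scalar_Q3[OF yk yk yk]])
    then show ?thesis using relation_braid[OF t g(2,3), of "act (idp s) v"] t by (simp add: act_idp)
  next
    fix s assume g: "g = peval scal (Wpol D (ent s 1)) (yy 1) * idp s" "1 \<le> size \<alpha>"
    show ?thesis
      unfolding g(1) sc[OF scalar_peval[OF yk]] peval_eq_poly using weight[OF t g(2)] t by (auto simp: act_idp)
  qed
qed

end

section \<open>The block algebras\<close>

lemma free_algebra_simps: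
  "f \<otimes>\<^bsub>free_algebra A T\<^esub> g = f * g" "f \<oplus>\<^bsub>free_algebra A T\<^esub> g = f + g"
  "\<one>\<^bsub>free_algebra A T\<^esub> = 1" "\<zero>\<^bsub>free_algebra A T\<^esub> = 0"
  by (simp_all add: free_algebra_def)

context coeff_ring
begin

lemma cring_subring_of: "cring (subring_of A)"
proof (rule cringI)
  show "abelian_group (subring_of A)"
    by (rule abelian_groupI) (auto simp: subring_of_def add_A zero_A add_ac intro!: bexI[OF _ uminus_A])
  show "comm_monoid (subring_of A)"
    by (rule comm_monoidI) (auto simp: subring_of_def mult_A one_A mult_ac)
qed (simp add: subring_of_def distrib_right)

lemma free_algebra_zero: "0 \<in> carrier (free_algebra A T)"
  by (simp add: free_algebra_def zero_A)

lemma free_algebra_add: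
  "f \<in> carrier (free_algebra A T) \<Longrightarrow> g \<in> carrier (free_algebra A T) \<Longrightarrow>
   f + g \<in> carrier (free_algebra A T)"
  using Poly_Mapping.keys_add[of f g] by (auto simp: free_algebra_def lookup_add add_A) blast

lemma free_algebra_uminus:
  "f \<in> carrier (free_algebra A T) \<Longrightarrow> - f \<in> carrier (free_algebra A T)"
  by (auto simp: free_algebra_def uminus_A in_keys_iff)

lemma free_algebra_diff:
  "f \<in> carrier (free_algebra A T) \<Longrightarrow> g \<in> carrier (free_algebra A T) \<Longrightarrow>
   f - g \<in> carrier (free_algebra A T)"
  using free_algebra_add[of f T "- g"] free_algebra_uminus[of g T] by simp

lemma free_algebra_sum:
  "(\<And>x. x \<in> F \<Longrightarrow> f x \<in> carrier (free_algebra A T)) \<Longrightarrow> sum f F \<in> carrier (free_algebra A T)"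
  by (induction F rule: infinite_finite_induct) (auto intro: free_algebra_zero free_algebra_add)

lemma free_algebra_single:
  "a \<in> A \<Longrightarrow> set (letters w) \<subseteq> T \<Longrightarrow> Poly_Mapping.single w a \<in> carrier (free_algebra A T)"
  by (auto simp: free_algebra_def lookup_single when_def zero_A split: if_splits)

lemma free_algebra_mult:
  assumes f: "f \<in> carrier (free_algebra A T)" and g: "g \<in> carrier (free_algebra A T)"
  shows "f * g \<in> carrier (free_algebra A T)"
proof -
  let ?s = "\<lambda>f w. Poly_Mapping.single w (Poly_Mapping.lookup f w)"
  have "f * g = (\<Sum>u\<in>Poly_Mapping.keys f. \<Sum>w\<in>Poly_Mapping.keys g. ?s f u * ?s g w)"
    by (subst poly_mapping_sum_singles[of f], subst poly_mapping_sum_singles[of g])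
       (simp add: sum_product)
  also have "\<dots> \<in> carrier (free_algebra A T)"
    unfolding mult_single using f g
    by (intro free_algebra_sum free_algebra_single) (auto simp: free_algebra_def mult_A plus_word_def)
  finally show ?thesis .
qed

lemma free_algebra_scal: "a \<in> A \<Longrightarrow> scal a \<in> carrier (free_algebra A T)"
  unfolding scal_def by (rule free_algebra_single) (auto simp: zero_word_def)

lemma free_algebra_one: "1 \<in> carrier (free_algebra A T)"
  using free_algebra_scal[OF one_A] by (simp add: scal_def)

lemma free_algebra_gen: "g \<in> T \<Longrightarrow> gen g \<in> carrier (free_algebra A T)"
  unfolding gen_def by (rule free_algebra_single) (auto simp: one_A)

lemma free_algebra_power:
  "f \<in> carrier (free_algebra A T) \<Longrightarrow> f ^ p \<in> carrier (free_algebra A T)"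
  by (induction p) (auto intro: free_algebra_one free_algebra_mult)

lemmas free_algebra_closed = free_algebra_zero free_algebra_one free_algebra_add free_algebra_diff
  free_algebra_mult free_algebra_sum free_algebra_power free_algebra_scal

lemma free_algebra_ring: "ring (free_algebra A T)"
proof (rule ringI)
  show "abelian_group (free_algebra A T)"
  proof (rule abelian_groupI)
    fix f assume "f \<in> carrier (free_algebra A T)"
    then show "\<exists>g\<in>carrier (free_algebra A T). g \<oplus>\<^bsub>free_algebra A T\<^esub> f = \<zero>\<^bsub>free_algebra A T\<^esub>"
      by (intro bexI[OF _ free_algebra_uminus]) (simp_all add: free_algebra_simps)
  qed (simp_all add: free_algebra_simps free_algebra_add free_algebra_zero add_ac)
  show "monoid (free_algebra A T)"
    by (rule monoidI) (simp_all add: free_algebra_simps free_algebra_mult free_algebra_one mult.assoc)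
qed (simp_all add: free_algebra_simps algebra_simps)

text \<open>The generated ideal is an ideal of the free algebra over \<open>A\<close> only once its
  generators are known to lie there, which requires the coefficients of all Q- and weight
  polynomials to be in \<open>A\<close>.\<close>

lemma klr_relators_carrier:
  assumes "\<And>i j p q. coeff2 (Qpol D i j) p q \<in> A" "\<And>i p. coeff (Wpol D i) p \<in> A"
  shows "klr_relators D \<gamma> \<subseteq> carrier (free_algebra A (klr_gens \<gamma>))"
proof -
  let ?F = "carrier (free_algebra A (klr_gens \<gamma>))"
  have idp: "s \<in> seqs_of \<gamma> \<Longrightarrow> idp s \<in> ?F" for s
    by (rule free_algebra_gen) (simp add: klr_gens_def)
  have psi: "1 \<le> k \<Longrightarrow> k < size \<gamma> \<Longrightarrow> psi k \<in> ?F" for k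
    by (rule free_algebra_gen) (simp add: klr_gens_def)
  have yy: "1 \<le> k \<Longrightarrow> k \<le> size \<gamma> \<Longrightarrow> yy k \<in> ?F" for k
    by (rule free_algebra_gen) (simp add: klr_gens_def)
  have ite: "f \<in> ?F \<Longrightarrow> g \<in> ?F \<Longrightarrow> (if P then f else g) \<in> ?F" for f g P by simp
  have pv: "peval scal (Wpol D i) y \<in> ?F" if "y \<in> ?F" for i y
    unfolding peval_def using that assms by (intro free_algebra_closed) auto
  have pv2: "peval2 scal (Qpol D i j) y z \<in> ?F" if "y \<in> ?F" "z \<in> ?F" for i j y z
    unfolding peval2_def using that assms by (intro free_algebra_closed) auto
  have q3: "Q3 scal D i j k x y z \<in> ?F" if "x \<in> ?F" "y \<in> ?F" "z \<in> ?F" for i j k x y z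
    unfolding Q3_def ddiff_def using that assms by (intro ite free_algebra_closed) auto
  show ?thesis
    unfolding klr_relators_def Let_def
    by (intro Un_least subsetI; elim CollectE exE conjE singletonE; simp only:;
        intro free_algebra_closed ite idp psi yy pv pv2 q3;
        auto simp: swap_seq_in_seqs_of)
qed

end

locale klr_coeff = coeff_ring A for A :: "'a::comm_ring_1 set" +
  fixes D :: "('i, 'a) klr_datum"
  assumes Q_A: "coeff2 (Qpol D i j) p q \<in> A"
    and W_A: "coeff (Wpol D i) p \<in> A"
begin

lemma klr_ideal: "ideal (klr_ideal A D \<gamma>) (free_algebra A (klr_gens \<gamma>))"
proof -
  interpret F: ring "free_algebra A (klr_gens \<gamma>)" by (rule free_algebra_ring)
  show ?thesis unfolding klr_ideal_def
    by (rule F.genideal_ideal) (rule klr_relators_carrier[OF Q_A W_A])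
qed

lemma klr_class_hom: "klr_class A D \<gamma> \<in> ring_hom (free_algebra A (klr_gens \<gamma>)) (klr_block A D \<gamma>)"
  using ideal.rcos_ring_hom[OF klr_ideal, of \<gamma>]
  by (simp add: klr_block_def klr_class_def[abs_def])

lemma klr_class_add:
  "f \<in> carrier (free_algebra A (klr_gens \<gamma>)) \<Longrightarrow> g \<in> carrier (free_algebra A (klr_gens \<gamma>)) \<Longrightarrow>
   klr_class A D \<gamma> f \<oplus>\<^bsub>klr_block A D \<gamma>\<^esub> klr_class A D \<gamma> g = klr_class A D \<gamma> (f + g)"
  using ring_hom_add[OF klr_class_hom, of f \<gamma> g] by (simp add: free_algebra_simps)

lemma klr_class_mult:
  "f \<in> carrier (free_algebra A (klr_gens \<gamma>)) \<Longrightarrow> g \<in> carrier (free_algebra A (klr_gens \<gamma>)) \<Longrightarrow>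
   klr_class A D \<gamma> f \<otimes>\<^bsub>klr_block A D \<gamma>\<^esub> klr_class A D \<gamma> g = klr_class A D \<gamma> (f * g)"
  using ring_hom_mult[OF klr_class_hom, of f \<gamma> g] by (simp add: free_algebra_simps)

lemma ring_klr_block: "ring (klr_block A D \<gamma>)"
  unfolding klr_block_def by (rule ideal.quotient_is_ring[OF klr_ideal])

text \<open>The class of 0 is idempotent for addition, hence the zero of the quotient.\<close>

lemma klr_class_zero: "\<zero>\<^bsub>klr_block A D \<gamma>\<^esub> = klr_class A D \<gamma> 0"
proof -
  interpret B: ring "klr_block A D \<gamma>" by (rule ring_klr_block)
  have "klr_class A D \<gamma> 0 \<in> carrier (klr_block A D \<gamma>)"
    using ring_hom_closed[OF klr_class_hom free_algebra_zero] .
  then show ?thesis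
    using klr_class_add[OF free_algebra_zero free_algebra_zero, of \<gamma>] by (simp add: B.add.l_cancel_one)
qed

lemma klr_block_carrierE:
  assumes "x \<in> carrier (klr_block A D \<gamma>)"
  obtains f where "f \<in> carrier (free_algebra A (klr_gens \<gamma>))" "x = klr_class A D \<gamma> f"
  using assms by (auto simp: klr_block_def klr_class_def FactRing_def A_RCOSETS_def')

lemma klr_class_carrier:
  "f \<in> carrier (free_algebra A (klr_gens \<gamma>)) \<Longrightarrow> klr_class A D \<gamma> f \<in> carrier (klr_block A D \<gamma>)"
  using ring_hom_closed[OF klr_class_hom] .

lemma klr_elt_carrier:
  assumes "f \<in> carrier (free_algebra A (klr_gens \<gamma>))"
  shows "klr_elt A D \<gamma> f \<in> carrier (klr_algebra A D (size \<gamma>))"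
proof -
  have "finite {\<delta>. size \<delta> = size \<gamma> \<and> klr_elt A D \<gamma> f \<delta> \<noteq> \<zero>\<^bsub>klr_block A D \<delta>\<^esub>}"
    by (rule finite_subset[of _ "{\<gamma>}"]) (auto simp: klr_elt_def)
  moreover have "\<zero>\<^bsub>klr_block A D \<delta>\<^esub> \<in> carrier (klr_block A D \<delta>)" for \<delta>
    using ring_klr_block by (simp add: ring.ring_simprules)
  ultimately show ?thesis
    using klr_class_carrier[OF assms] by (auto simp: klr_algebra_def klr_elt_def Let_def)
qed

end

section \<open>Free modules of functions\<close>

text \<open>Requiring zero off \<open>S\<close> makes equality of functions the same as equality on
  \<open>S\<close>, so that the module is free on the indicator functions.\<close>

definition vecs :: "'a::zero set \<Rightarrow> 't set \<Rightarrow> ('t \<Rightarrow> 'a) set" where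
  "vecs A S = {v. (\<forall>t\<in>S. v t \<in> A) \<and> (\<forall>t. t \<notin> S \<longrightarrow> v t = 0)}"

definition fun_module :: "'a::comm_ring_1 set \<Rightarrow> 't set \<Rightarrow> ('a, 't \<Rightarrow> 'a) module" where
  "fun_module A S = \<lparr>carrier = vecs A S, mult = undefined, one = undefined, zero = (\<lambda>_. 0),
     add = (\<lambda>v w t. v t + w t), smult = (\<lambda>a v t. a * v t)\<rparr>"

definition unit_vec :: "'t \<Rightarrow> 't \<Rightarrow> 'a::comm_ring_1" where
  "unit_vec t s = (if s = t then 1 else 0)"

lemma fun_module_simps [simp]:
  "carrier (fun_module A S) = vecs A S"
  "\<zero>\<^bsub>fun_module A S\<^esub> = (\<lambda>_. 0)"
  "v \<oplus>\<^bsub>fun_module A S\<^esub> w = (\<lambda>t. v t + w t)"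
  "a \<odot>\<^bsub>fun_module A S\<^esub> v = (\<lambda>t. a * v t)"
  by (simp_all add: fun_module_def)

context coeff_ring
begin

lemma abelian_group_fun_module: "abelian_group (fun_module A S)"
proof (rule abelian_groupI)
  fix v assume "v \<in> carrier (fun_module A S)"
  then show "\<exists>w\<in>carrier (fun_module A S). w \<oplus>\<^bsub>fun_module A S\<^esub> v = \<zero>\<^bsub>fun_module A S\<^esub>"
    by (intro bexI[of _ "\<lambda>t. - v t"]) (auto simp: vecs_def uminus_A)
qed (auto simp: vecs_def add_A zero_A add_ac)

lemma module_fun_module: "Module.module (subring_of A) (fun_module A S)"
  by (rule moduleI[OF cring_subring_of abelian_group_fun_module])
     (auto simp: subring_of_def vecs_def mult_A distrib_left distrib_right mult.assoc)

lemma finsum_fun_module: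
  assumes "finite F" "\<And>x. x \<in> F \<Longrightarrow> f x \<in> vecs A S"
  shows "finsum (fun_module A S) f F = (\<lambda>t. \<Sum>x\<in>F. f x t)"
  using assms
proof (induction F rule: finite_induct)
  interpret abelian_group "fun_module A S" by (rule abelian_group_fun_module)
  case empty then show ?case by simp
next
  interpret abelian_group "fun_module A S" by (rule abelian_group_fun_module)
  case (insert x F)
  then have "finsum (fun_module A S) f (insert x F) = f x \<oplus>\<^bsub>fun_module A S\<^esub> finsum (fun_module A S) f F"
    by (intro finsum_insert) auto
  then show ?case using insert by simp
qed

lemma unit_vec_carrier: "t \<in> S \<Longrightarrow> unit_vec t \<in> vecs A S"
  by (auto simp: vecs_def unit_vec_def one_A zero_A)

lemma smult_vecs: "a \<in> A \<Longrightarrow> v \<in> vecs A S \<Longrightarrow> (\<lambda>t. a * v t) \<in> vecs A S"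
  by (auto simp: vecs_def mult_A)

lemma add_vecs: "v \<in> vecs A S \<Longrightarrow> w \<in> vecs A S \<Longrightarrow> (\<lambda>t. v t + w t) \<in> vecs A S"
  by (auto simp: vecs_def add_A)

lemma free_basis_fun_module:
  assumes "finite S"
  shows "free_basis (subring_of A) (fun_module A S) S unit_vec"
proof -
  have sum: "(\<Oplus>\<^bsub>fun_module A S\<^esub>s\<in>S. a s \<odot>\<^bsub>fun_module A S\<^esub> unit_vec s) = (\<lambda>t. if t \<in> S then a t else 0)"
    if "a \<in> S \<rightarrow> A" for a
  proof -
    have "(\<Oplus>\<^bsub>fun_module A S\<^esub>s\<in>S. a s \<odot>\<^bsub>fun_module A S\<^esub> unit_vec s) = (\<lambda>t. \<Sum>s\<in>S. a s * unit_vec s t)"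
      by (subst finsum_fun_module)
         (auto intro!: smult_vecs unit_vec_carrier assms funcset_mem[OF that])
    then show ?thesis using assms by (auto simp: unit_vec_def if_distrib cong: if_cong)
  qed
  have "\<exists>!a. a \<in> (\<Pi>\<^sub>E s\<in>S. carrier (subring_of A)) \<and>
      v = (\<Oplus>\<^bsub>fun_module A S\<^esub>s\<in>S. a s \<odot>\<^bsub>fun_module A S\<^esub> unit_vec s)" if v: "v \<in> vecs A S" for v
  proof (rule ex1I[of _ "restrict v S"])
    show "restrict v S \<in> (\<Pi>\<^sub>E s\<in>S. carrier (subring_of A)) \<and>
        v = (\<Oplus>\<^bsub>fun_module A S\<^esub>s\<in>S. restrict v S s \<odot>\<^bsub>fun_module A S\<^esub> unit_vec s)"
      using v by (subst sum) (auto simp: subring_of_def vecs_def fun_eq_iff)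
  next
    fix a assume a: "a \<in> (\<Pi>\<^sub>E s\<in>S. carrier (subring_of A)) \<and>
      v = (\<Oplus>\<^bsub>fun_module A S\<^esub>s\<in>S. a s \<odot>\<^bsub>fun_module A S\<^esub> unit_vec s)"
    then have aA: "a \<in> S \<rightarrow> A" by (auto simp: subring_of_def PiE_iff)
    have "v = (\<lambda>t. if t \<in> S then a t else 0)" using a sum[OF aA] by simp
    then have "a x = restrict v S x" for x
      using conjunct1[OF a] by (cases "x \<in> S") (auto simp: PiE_iff extensional_def)
    then show "a = restrict v S" ..
  qed
  then show ?thesis using assms by (simp add: free_basis_def unit_vec_carrier)
qed

end

section \<open>The module of a seminormal representation\<close>

sublocale seminormal \<subseteq> klr_coeff A D
  by standard (rule Q_A, rule W_A)

context seminormal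
begin

lemma gen_act_vecs:
  assumes "g \<in> klr_gens \<alpha>" "v \<in> vecs A S"
  shows "gen_act g v \<in> vecs A S"
proof -
  have "gen_act g v t \<in> A" if t: "t \<in> S" for t
  proof -
    from assms(1) consider s where "g = Idp s" | k where "g = Psi k" "1 \<le> k" "k < size \<alpha>"
      | k where "g = Y k" "1 \<le> k" "k \<le> size \<alpha>"
      by (auto simp: klr_gens_def)
    then show ?thesis
    proof cases
      case 1 then show ?thesis using t assms(2) by (simp add: gen_act_def vecs_def zero_A)
    next
      case 2
      have "B k t * v (\<sigma> k t) \<in> A"
        using 2 t assms(2) B_A[OF t] B_zero[OF t] zero_A
        by (cases "\<sigma> k t \<in> S") (auto simp: vecs_def mult_A)
      then show ?thesis using 2 t assms(2) d_A[OF t]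
        by (simp add: gen_act_def vecs_def add_A mult_A)
    next
      case 3 then show ?thesis using t assms(2) c_A[OF t] by (simp add: gen_act_def vecs_def mult_A)
    qed
  qed
  then show ?thesis by (auto simp: vecs_def gen_act_def)
qed

lemma act_vecs:
  assumes f: "f \<in> carrier (free_algebra A (klr_gens \<alpha>))" and v: "v \<in> vecs A S"
  shows "act f v \<in> vecs A S"
proof -
  have "foldr gen_act ls v \<in> vecs A S" if "set ls \<subseteq> klr_gens \<alpha>" for ls
    using that by (induction ls) (auto simp: v gen_act_vecs)
  then have w: "word_act gen_act w v \<in> vecs A S" if "w \<in> Poly_Mapping.keys f" for w
    using f that by (simp add: word_act_def free_algebra_def)
  show ?thesis
    using f w unfolding vecs_def free_act_def[abs_def]
    by (auto intro!: sum_A mult_A sum.neutral simp: free_algebra_def)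
qed

text \<open>The annihilator of \<open>vecs A S\<close> in the free algebra is a two-sided ideal; for
  multiplication on the right this uses that \<open>vecs A S\<close> is stable. It contains the
  relators, hence the ideal they generate.\<close>

lemma klr_ideal_annihilates:
  assumes f: "f \<in> klr_ideal A D \<alpha>" and v: "v \<in> vecs A S"
  shows "act f v = (\<lambda>_. 0)"
proof -
  let ?F = "free_algebra A (klr_gens \<alpha>)"
  interpret F: ring ?F by (rule free_algebra_ring)
  define N where "N = {f \<in> carrier ?F. \<forall>v\<in>vecs A S. act f v = (\<lambda>_. 0)}"
  note F = free_algebra_simps
  have zero: "act g (\<lambda>_. 0) = (\<lambda>_. 0)" for g
  proof -
    have "linear_op (act g)" by (rule linear_free_act) (rule linear)
    then have "act g (\<lambda>t. a * v t) = (\<lambda>t. a * act g v t)" for a v by (simp add: linear_op_def)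
    from this[of 0 "\<lambda>_. 0"] show ?thesis by simp
  qed
  have inv: "\<ominus>\<^bsub>?F\<^esub> f = - f" if "f \<in> carrier ?F" for f
    using that free_algebra_uminus[OF that] by (intro F.minus_equality) (simp_all add: F)
  have "ideal N ?F"
  proof (rule idealI[OF free_algebra_ring])
    show "subgroup N (add_monoid ?F)"
    proof (rule F.add.subgroupI)
      show "N \<subseteq> carrier ?F" by (auto simp: N_def)
      show "N \<noteq> {}"
        using free_algebra_zero[of "klr_gens \<alpha>"] by (auto simp: N_def fun_eq_iff intro!: exI[of _ 0])
      fix f assume f: "f \<in> N"
      then have "f \<in> carrier ?F" by (simp add: N_def)
      then show "\<ominus>\<^bsub>?F\<^esub> f \<in> N" using f
        by (auto simp: N_def inv free_algebra_uminus free_act_uminus fun_eq_iff)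
      fix g assume "g \<in> N"
      with f show "f \<oplus>\<^bsub>?F\<^esub> g \<in> N"
        by (auto simp: N_def F free_algebra_add free_act_add fun_eq_iff)
    qed
  next
    fix f g assume f: "f \<in> N" and g: "g \<in> carrier ?F"
    show "g \<otimes>\<^bsub>?F\<^esub> f \<in> N" using f g by (auto simp: N_def F free_algebra_mult mult zero)
    show "f \<otimes>\<^bsub>?F\<^esub> g \<in> N" using f g by (auto simp: N_def F free_algebra_mult mult act_vecs)
  qed
  moreover have "klr_relators D \<alpha> \<subseteq> N"
  proof
    fix g assume g: "g \<in> klr_relators D \<alpha>"
    then have gF: "g \<in> carrier ?F" using klr_relators_carrier[OF Q_A W_A] by blast
    have "act g v = (\<lambda>_. 0)" if "v \<in> vecs A S" for v
    proof
      \<comment> \<open>The relations are verified at points of \<open>S\<close>; elsewhere the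
        value is zero because the image lies in \<open>vecs A S\<close>.\<close>
      fix t show "act g v t = 0"
        using act_relator[OF g] act_vecs[OF gF that] by (cases "t \<in> S") (auto simp: vecs_def)
    qed
    then show "g \<in> N" using gF by (simp add: N_def)
  qed
  ultimately have "klr_ideal A D \<alpha> \<subseteq> N"
    unfolding klr_ideal_def by (rule F.genideal_minimal)
  then show ?thesis using f v by (auto simp: N_def)
qed

definition class_act :: "('i, 'a) klr_free set \<Rightarrow> ('t \<Rightarrow> 'a) \<Rightarrow> 't \<Rightarrow> 'a" where
  "class_act x = act (SOME f. f \<in> x)"

text \<open>The chosen representative differs from f by an element of the ideal, which annihilates
  v; so the choice in \<open>class_act\<close> is immaterial on \<open>vecs A S\<close>.\<close>

lemma class_act_class:
  assumes f: "f \<in> carrier (free_algebra A (klr_gens \<alpha>))" and v: "v \<in> vecs A S"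
  shows "class_act (klr_class A D \<alpha> f) v = act f v"
proof -
  let ?F = "free_algebra A (klr_gens \<alpha>)"
  interpret ideal "klr_ideal A D \<alpha>" ?F by (rule klr_ideal)
  have "f \<in> klr_class A D \<alpha> f" unfolding klr_class_def by (rule a_rcos_self[OF f])
  then have "(SOME g. g \<in> klr_class A D \<alpha> f) \<in> klr_class A D \<alpha> f" by (rule someI)
  then obtain i where i: "i \<in> klr_ideal A D \<alpha>" "(SOME g. g \<in> klr_class A D \<alpha> f) = i + f"
    by (auto simp: klr_class_def a_r_coset_def' free_algebra_def)
  have "act i v = (\<lambda>_. 0)" by (rule klr_ideal_annihilates[OF i(1) v])
  then show ?thesis unfolding class_act_def i(2) by (auto simp: free_act_add fun_eq_iff)
qed

text \<open>All of \<open>S\<close> has residue content \<alpha>, so R_n acts through its projection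
  to the block \<alpha>, and the other blocks act by zero.\<close>

definition mod_act :: "('i multiset \<Rightarrow> ('i, 'a) klr_free set) \<Rightarrow> ('t \<Rightarrow> 'a) \<Rightarrow> 't \<Rightarrow> 'a" where
  "mod_act r = class_act (r \<alpha>)"

lemma klr_algebra_carrierE:
  assumes "r \<in> carrier (klr_algebra A D (size \<alpha>))"
  obtains f where "f \<in> carrier (free_algebra A (klr_gens \<alpha>))" "r \<alpha> = klr_class A D \<alpha> f"
proof -
  have "r \<alpha> \<in> carrier (klr_block A D \<alpha>)"
    using assms by (auto simp: klr_algebra_def Let_def)
  then show thesis using klr_block_carrierE that by blast
qed

lemma mod_act_elt:
  assumes "f \<in> carrier (free_algebra A (klr_gens \<gamma>))" "size \<gamma> = size \<alpha>" "v \<in> vecs A S"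
  shows "mod_act (klr_elt A D \<gamma> f) v = (if \<gamma> = \<alpha> then act f v else (\<lambda>_. 0))"
proof (cases "\<gamma> = \<alpha>")
  case True then show ?thesis using assms by (simp add: mod_act_def klr_elt_def class_act_class)
next
  case False
  then show ?thesis using assms class_act_class[OF free_algebra_zero assms(3)]
    by (auto simp: mod_act_def klr_elt_def klr_class_zero fun_eq_iff)
qed

lemma algebra_module_fun_module:
  "algebra_module (subring_of A) (klr_algebra A D (size \<alpha>)) (fun_module A S) mod_act"
proof -
  let ?R = "klr_algebra A D (size \<alpha>)"
  have R: "(r \<oplus>\<^bsub>?R\<^esub> s) \<alpha> = r \<alpha> \<oplus>\<^bsub>klr_block A D \<alpha>\<^esub> s \<alpha>" "(r \<otimes>\<^bsub>?R\<^esub> s) \<alpha> = r \<alpha> \<otimes>\<^bsub>klr_block A D \<alpha>\<^esub> s \<alpha>"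
    "(a \<odot>\<^bsub>?R\<^esub> r) \<alpha> = klr_class A D \<alpha> (scal a) \<otimes>\<^bsub>klr_block A D \<alpha>\<^esub> r \<alpha>" for r s a
    by (simp_all add: klr_algebra_def Let_def)
  have lin: "linear_op (act f)" for f by (rule linear_free_act) (rule linear)
  have closed: "mod_act r v \<in> vecs A S" if "r \<in> carrier ?R" "v \<in> vecs A S" for r v
    using that by (elim klr_algebra_carrierE) (simp add: mod_act_def class_act_class act_vecs)
  have add: "mod_act r (\<lambda>t. v t + w t) = (\<lambda>t. mod_act r v t + mod_act r w t)"
    if "r \<in> carrier ?R" "v \<in> vecs A S" "w \<in> vecs A S" for r v w
    using that lin
    by (elim klr_algebra_carrierE) (simp add: mod_act_def class_act_class add_vecs linear_op_def)
  have rs: "mod_act (r \<oplus>\<^bsub>?R\<^esub> s) v = (\<lambda>t. mod_act r v t + mod_act s v t)"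
    "mod_act (r \<otimes>\<^bsub>?R\<^esub> s) v = mod_act r (mod_act s v)"
    if r: "r \<in> carrier ?R" and s: "s \<in> carrier ?R" and v: "v \<in> vecs A S" for r s v
  proof -
    obtain f where f: "f \<in> carrier (free_algebra A (klr_gens \<alpha>))" "r \<alpha> = klr_class A D \<alpha> f"
      using r by (rule klr_algebra_carrierE)
    obtain g where g: "g \<in> carrier (free_algebra A (klr_gens \<alpha>))" "s \<alpha> = klr_class A D \<alpha> g"
      using s by (rule klr_algebra_carrierE)
    show "mod_act (r \<oplus>\<^bsub>?R\<^esub> s) v = (\<lambda>t. mod_act r v t + mod_act s v t)"
      using f g v
      by (simp add: mod_act_def R klr_class_add class_act_class free_algebra_add free_act_add fun_eq_iff)
    show "mod_act (r \<otimes>\<^bsub>?R\<^esub> s) v = mod_act r (mod_act s v)"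
      using f g v
      by (simp add: mod_act_def R klr_class_mult class_act_class free_algebra_mult act_vecs mult)
  qed
  have sm: "mod_act (a \<odot>\<^bsub>?R\<^esub> r) v = (\<lambda>t. a * mod_act r v t)"
    "mod_act r (\<lambda>t. a * v t) = (\<lambda>t. a * mod_act r v t)"
    if a: "a \<in> A" and r: "r \<in> carrier ?R" and v: "v \<in> vecs A S" for a r v
  proof -
    obtain f where f: "f \<in> carrier (free_algebra A (klr_gens \<alpha>))" "r \<alpha> = klr_class A D \<alpha> f"
      using r by (rule klr_algebra_carrierE)
    show "mod_act (a \<odot>\<^bsub>?R\<^esub> r) v = (\<lambda>t. a * mod_act r v t)"
      using f a v
      by (simp add: mod_act_def R klr_class_mult class_act_class free_algebra_mult free_algebra_scal
          mult fun_eq_iff)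
    show "mod_act r (\<lambda>t. a * v t) = (\<lambda>t. a * mod_act r v t)"
      using f a v lin by (simp add: mod_act_def class_act_class smult_vecs linear_op_def)
  qed
  \<comment> \<open>R_n may lack a unit; the unit of the block \<alpha>, extended by zero, serves as
    a local unit for every vector.\<close>
  have "\<exists>e\<in>carrier ?R. mod_act e v = v" if "v \<in> vecs A S" for v
    using klr_elt_carrier[OF free_algebra_one, of \<alpha>] mod_act_elt[OF free_algebra_one refl that]
    by (intro bexI[of _ "klr_elt A D \<alpha> 1"]) (auto simp: fun_eq_iff)
  then show ?thesis
    unfolding algebra_module_def
    using module_fun_module closed add rs sm by (simp add: subring_of_def)
qed

text \<open>Translates from coordinates to basis vectors, using that \<open>\<sigma> k\<close> is an
  involution: the coefficient at the neighbour is \<open>B\<close> taken at the neighbour, which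
  will be \<beta>_k(t) itself.\<close>

lemma act_psi_unit_vec:
  assumes t: "t \<in> S" and k: "1 \<le> k" "k < size \<alpha>"
  shows "act (psi k) (unit_vec t) =
    (\<lambda>x. (if \<sigma> k t \<in> S then B k (\<sigma> k t) * unit_vec (\<sigma> k t) x else 0) + d k t * unit_vec t x)"
proof
  fix x
  show "act (psi k) (unit_vec t) x =
    (if \<sigma> k t \<in> S then B k (\<sigma> k t) * unit_vec (\<sigma> k t) x else 0) + d k t * unit_vec t x"
  proof (cases "x \<in> S")
    case True
    have "\<sigma> k x = t \<longleftrightarrow> x = \<sigma> k t" using \<sigma>_twice[OF True, of k] \<sigma>_twice[OF t, of k] by auto
    then show ?thesis using True by (auto simp: act_psi unit_vec_def)
  next
    case False
    have "psi k \<in> carrier (free_algebra A (klr_gens \<alpha>))"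
      using k by (intro free_algebra_gen) (auto simp: klr_gens_def)
    then have "act (psi k) (unit_vec t) x = 0"
      using act_vecs[OF _ unit_vec_carrier[OF t]] False by (auto simp: vecs_def)
    then show ?thesis using False t by (auto simp: unit_vec_def)
  qed
qed

end

section \<open>Gradings\<close>

text \<open>The grading is presented by its projections \<open>comp\<close>, which reduces existence
  and uniqueness of decompositions in the module to computations with values.\<close>

locale graded_coeff = coeff_ring A for A :: "'a::comm_ring_1 set" +
  fixes G :: "int \<Rightarrow> 'a set" and comp :: "int \<Rightarrow> 'a \<Rightarrow> 'a"
  assumes G_A: "a \<in> G e \<Longrightarrow> a \<in> A"
    and G_add: "a \<in> G e \<Longrightarrow> b \<in> G e \<Longrightarrow> a + b \<in> G e"
    and G_uminus: "a \<in> G e \<Longrightarrow> - a \<in> G e"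
    and G_mult: "a \<in> G d \<Longrightarrow> b \<in> G e \<Longrightarrow> a * b \<in> G (d + e)"
    and G_one: "1 \<in> G 0"
    and comp_G: "a \<in> A \<Longrightarrow> comp e a \<in> G e"
    and comp_add: "comp e (a + b) = comp e a + comp e b"
    and comp_finite: "finite {e. comp e a \<noteq> 0}"
    and comp_total: "(\<Sum>e | comp e a \<noteq> 0. comp e a) = a"
    and comp_homog: "a \<in> G e \<Longrightarrow> comp e' a = (if e' = e then a else 0)"
begin

lemma comp_zero [simp]: "comp e 0 = 0"
  using comp_add[of e 0 0] by simp

lemma G_zero: "0 \<in> G e"
  using comp_G[OF zero_A, of e] by simp

lemma comp_sum: "comp e (sum f F) = (\<Sum>x\<in>F. comp e (f x))"
  by (induction F rule: infinite_finite_induct) (auto simp: comp_add)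

lemma comp_total_superset:
  assumes "finite E" "{e. comp e a \<noteq> 0} \<subseteq> E"
  shows "(\<Sum>e\<in>E. comp e a) = a"
proof -
  have "(\<Sum>e | comp e a \<noteq> 0. comp e a) = (\<Sum>e\<in>E. comp e a)"
    by (rule sum.mono_neutral_left) (use assms in auto)
  then show ?thesis by (simp add: comp_total)
qed

lemma G_sum: "(\<And>x. x \<in> F \<Longrightarrow> f x \<in> G e) \<Longrightarrow> sum f F \<in> G e"
  by (induction F rule: infinite_finite_induct) (auto intro: G_zero G_add)

lemma G_power: "a \<in> G e \<Longrightarrow> a ^ p \<in> G (int p * e)"
proof (induction p)
  case (Suc p)
  then show ?case using G_mult[of a e "a ^ p" "int p * e"] by (simp add: algebra_simps)
qed (simp add: G_one)

text \<open>Comparing components of degree 0 in x y = 1 shows that the component of y in degree -e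
  is already an inverse of x; inverses are unique.\<close>

lemma inverse_homog:
  assumes x: "x \<in> G e" and y: "y \<in> A" and xy: "x * y = 1"
  shows "y \<in> G (- e)"
proof -
  define E where "E = insert (- e) {d. comp d y \<noteq> 0}"
  have E: "finite E" using comp_finite by (simp add: E_def)
  have "1 = comp 0 (x * y)" using comp_homog[OF G_one] xy by simp
  also have "x * y = (\<Sum>d\<in>E. x * comp d y)"
    using comp_total_superset[OF E, of y] by (simp add: sum_distrib_left[symmetric] subset_iff E_def)
  also have "comp 0 \<dots> = (\<Sum>d\<in>E. if d = - e then x * comp d y else 0)"
    unfolding comp_sum using comp_homog[OF G_mult[OF x comp_G[OF y]]] by (intro sum.cong) auto
  also have "\<dots> = x * comp (- e) y" using E by (simp add: E_def)
  finally have "x * comp (- e) y = 1" by simp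
  then have "comp (- e) y = y" using uinv_eq xy by metis
  then show ?thesis using comp_G[OF y, of "- e"] by simp
qed

end

lemma root_form_same: "symmetrisable_cartan D \<Longrightarrow> root_form D i i = 2 * int (symm D i)"
  by (simp add: root_form_def symmetrisable_cartan_def)

lemma root_form_sym: "symmetrisable_cartan D \<Longrightarrow> root_form D i j = root_form D j i"
  by (simp add: root_form_def symmetrisable_cartan_def)

text \<open>\<open>B k t\<close> is the coefficient of v_t in psi_k v_s for s =
  \<open>\<sigma> k t\<close>. The degree asked of it is what remains of deg psi_k + deg v_s, with
  deg psi_k minus the root form, after subtracting deg v_t.\<close>

locale graded_seminormal = seminormal A D \<alpha> S \<sigma> rs c B + graded_coeff A G comp
  for A :: "'a::comm_ring_1 set" and D :: "('i, 'a) klr_datum" and \<alpha> and S :: "'t set"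
    and \<sigma> rs c B G comp +
  fixes deg :: "'t \<Rightarrow> int"
  assumes cartan: "symmetrisable_cartan D"
    and c_homog: "t \<in> S \<Longrightarrow> 1 \<le> k \<Longrightarrow> k \<le> size \<alpha> \<Longrightarrow> c t k \<in> G (2 * int (symm D (ent (rs t) k)))"
    and B_homog: "t \<in> S \<Longrightarrow> 1 \<le> k \<Longrightarrow> k < size \<alpha> \<Longrightarrow> \<sigma> k t \<in> S \<Longrightarrow>
      B k t \<in> G (deg (\<sigma> k t) - deg t - root_form D (ent (rs t) k) (ent (rs t) (k + 1)))"
begin

text \<open>Since v is the sum of the v t times basis vectors of degree \<open>deg t\<close>, total
  degree e means that v t has degree \<open>e - deg t\<close>.\<close>

definition hom_vecs :: "int \<Rightarrow> ('t \<Rightarrow> 'a) set" where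
  "hom_vecs e = {v \<in> vecs A S. \<forall>t\<in>S. v t \<in> G (e - deg t)}"

text \<open>For equal residues i the content difference has degree 2 d_i, which is also
  (\<alpha>_i|\<alpha>_i), and its inverse has the opposite degree. For different residues the
  coefficient is zero, which lies in every component.\<close>

lemma d_homog:
  assumes t: "t \<in> S" "1 \<le> k" "k < size \<alpha>"
  shows "d k t \<in> G (- root_form D (ent (rs t) k) (ent (rs t) (k + 1)))"
proof (cases "ent (rs t) k = ent (rs t) (k + 1)")
  case True
  have "c t (k + 1) - c t k \<in> G (2 * int (symm D (ent (rs t) k)))"
    using G_add[OF _ G_uminus] c_homog[of t k] c_homog[of t "k + 1"] t True by fastforce
  moreover obtain y where y: "y \<in> A" "(c t (k + 1) - c t k) * y = 1"
    using invertible t True by blast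
  ultimately have "y \<in> G (- (2 * int (symm D (ent (rs t) k))))" by (rule inverse_homog)
  moreover have "d k t = y" using True uinv_eq[OF y(2)] by (simp add: d_def link_def)
  ultimately show ?thesis using True by (simp add: root_form_same[OF cartan])
next
  case False then show ?thesis using d_zero[of t k] G_zero by simp
qed

lemma hom_vecs_additive: "additive_subgroup (hom_vecs e) (fun_module A S)"
proof -
  interpret V: abelian_group "fun_module A S" by (rule abelian_group_fun_module)
  have minus: "\<ominus>\<^bsub>fun_module A S\<^esub> v = (\<lambda>t. - v t)" if "v \<in> vecs A S" for v
    by (rule V.minus_equality) (use that in \<open>auto simp: vecs_def uminus_A\<close>)
  have "subgroup (hom_vecs e) (add_monoid (fun_module A S))"
  proof (rule V.add.subgroupI)
    show "hom_vecs e \<subseteq> carrier (fun_module A S)" by (auto simp: hom_vecs_def)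
    have "(\<lambda>_. 0) \<in> hom_vecs e" by (auto simp: hom_vecs_def vecs_def zero_A G_zero)
    then show "hom_vecs e \<noteq> {}" by blast
    fix v assume v: "v \<in> hom_vecs e"
    then show "\<ominus>\<^bsub>fun_module A S\<^esub> v \<in> hom_vecs e"
      using minus[of v] by (auto simp: hom_vecs_def vecs_def uminus_A G_uminus)
    fix w assume "w \<in> hom_vecs e"
    with v show "v \<oplus>\<^bsub>fun_module A S\<^esub> w \<in> hom_vecs e"
      by (auto simp: hom_vecs_def vecs_def add_A G_add)
  qed
  then show ?thesis by (rule additive_subgroup.intro)
qed

lemma hom_vecs_vecs: "v \<in> hom_vecs e \<Longrightarrow> v \<in> vecs A S"
  by (simp add: hom_vecs_def)

definition vcomp :: "('t \<Rightarrow> 'a) \<Rightarrow> int \<Rightarrow> 't \<Rightarrow> 'a" where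
  "vcomp v e t = (if t \<in> S then comp (e - deg t) (v t) else 0)"

lemma vcomp_finite: "finite {e. vcomp v e \<noteq> (\<lambda>_. 0)}"
proof (rule finite_subset)
  show "{e. vcomp v e \<noteq> (\<lambda>_. 0)} \<subseteq> (\<Union>t\<in>S. (\<lambda>e. e + deg t) ` {e. comp e (v t) \<noteq> 0})"
  proof
    fix e assume "e \<in> {e. vcomp v e \<noteq> (\<lambda>_. 0)}"
    then obtain t where "t \<in> S" "comp (e - deg t) (v t) \<noteq> 0"
      by (auto simp: vcomp_def fun_eq_iff split: if_splits)
    then show "e \<in> (\<Union>t\<in>S. (\<lambda>e. e + deg t) ` {e. comp e (v t) \<noteq> 0})"
      by (intro UN_I[of t] image_eqI[of _ _ "e - deg t"]) auto
  qed
qed (use finite_S comp_finite in auto)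

lemma decomposes_iff:
  assumes "\<And>e. U e \<subseteq> vecs A S"
  shows "decomposes (fun_module A S) U v f \<longleftrightarrow>
    (\<forall>e. f e \<in> U e) \<and> finite {e. f e \<noteq> (\<lambda>_. 0)} \<and> v = (\<lambda>t. \<Sum>e | f e \<noteq> (\<lambda>_. 0). f e t)"
proof -
  have "finsum (fun_module A S) f {e. f e \<noteq> (\<lambda>_. 0)} = (\<lambda>t. \<Sum>e | f e \<noteq> (\<lambda>_. 0). f e t)"
    if "finite {e. f e \<noteq> (\<lambda>_. 0)}" "\<forall>e. f e \<in> U e"
    by (rule finsum_fun_module) (use that assms in blast)+
  then show ?thesis unfolding decomposes_def fun_module_simps by metis
qed

text \<open>Both existence and uniqueness are read off at single points: at t, the projection to
  degree \<open>e - deg t\<close> picks out the summand of degree e.\<close>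

lemma ex1_decomposes:
  assumes v: "v \<in> vecs A S"
  shows "\<exists>!f. decomposes (fun_module A S) hom_vecs v f"
proof (rule ex1I[of _ "vcomp v"])
  have hv: "hom_vecs e \<subseteq> vecs A S" for e by (auto simp: hom_vecs_def)
  have 1: "vcomp v e \<in> hom_vecs e" for e
    using v by (auto simp: hom_vecs_def vecs_def vcomp_def intro: comp_G G_A[OF comp_G])
  have 2: "v t = (\<Sum>e | vcomp v e \<noteq> (\<lambda>_. 0). vcomp v e t)" for t
  proof (cases "t \<in> S")
    case True
    define E where "E = {e. vcomp v e \<noteq> (\<lambda>_. 0)}"
    have "(\<Sum>e\<in>E. vcomp v e t) = (\<Sum>e\<in>(\<lambda>e. e - deg t) ` E. comp e (v t))"
      using True by (subst sum.reindex) (auto simp: vcomp_def inj_on_def)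
    also have "\<dots> = v t"
    proof (rule comp_total_superset)
      show "finite ((\<lambda>e. e - deg t) ` E)" using vcomp_finite by (auto simp: E_def)
      show "{e. comp e (v t) \<noteq> 0} \<subseteq> (\<lambda>e. e - deg t) ` E"
      proof
        fix e assume e: "e \<in> {e. comp e (v t) \<noteq> 0}"
        then have "vcomp v (e + deg t) t \<noteq> 0" using True by (simp add: vcomp_def)
        then have "e + deg t \<in> E" by (auto simp: E_def)
        then show "e \<in> (\<lambda>e. e - deg t) ` E" by (intro image_eqI[of _ _ "e + deg t"]) auto
      qed
    qed
    finally show ?thesis by (simp add: E_def)
  qed (use v in \<open>simp add: vcomp_def vecs_def\<close>)
  show "decomposes (fun_module A S) hom_vecs v (vcomp v)"
    unfolding decomposes_iff[OF hv] using 1 2 vcomp_finite by blast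
  fix f assume "decomposes (fun_module A S) hom_vecs v f"
  then have f: "\<And>e. f e \<in> hom_vecs e" "finite {e. f e \<noteq> (\<lambda>_. 0)}"
    "v = (\<lambda>t. \<Sum>e | f e \<noteq> (\<lambda>_. 0). f e t)"
    unfolding decomposes_iff[OF hv] by auto
  show "f = vcomp v"
  proof (intro ext)
    fix e t
    show "f e t = vcomp v e t"
    proof (cases "t \<in> S")
      case True
      have "vcomp v e t = (\<Sum>e' | f e' \<noteq> (\<lambda>_. 0). comp (e - deg t) (f e' t))"
        using True by (subst f(3)) (simp add: vcomp_def comp_sum)
      also have "\<dots> = (\<Sum>e' | f e' \<noteq> (\<lambda>_. 0). if e' = e then f e' t else 0)"
        using f(1) True by (intro sum.cong refl, subst comp_homog) (auto simp: hom_vecs_def)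
      also have "\<dots> = f e t" using f(2) by auto
      finally show ?thesis by simp
    next
      case False then show ?thesis using f(1)[of e] by (simp add: vcomp_def hom_vecs_def vecs_def)
    qed
  qed
qed

lemma psi_homog:
  assumes v: "v \<in> hom_vecs e" and s: "s \<in> seqs_of \<alpha>" and k: "1 \<le> k" "k < size \<alpha>"
  shows "act (psi k * idp s) v \<in> hom_vecs (- root_form D (ent s k) (ent s (k + 1)) + e)"
proof -
  have gens: "gen (Psi k) \<in> carrier (free_algebra A (klr_gens \<alpha>))"
    "gen (Idp s) \<in> carrier (free_algebra A (klr_gens \<alpha>))"
    using s k by (auto simp: klr_gens_def intro!: free_algebra_gen)
  have "act (psi k * idp s) v t \<in> G (- root_form D (ent s k) (ent s (k + 1)) + e - deg t)"
    if t: "t \<in> S" for t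
  proof -
    have 1: "d k t * act (idp s) v t \<in> G (- root_form D (ent s k) (ent s (k + 1)) + e - deg t)"
      using G_mult[OF d_homog[OF t k], of "v t" "e - deg t"] v t G_zero
      by (auto simp: act_idp hom_vecs_def algebra_simps)
    have 2: "B k t * act (idp s) v (\<sigma> k t) \<in> G (- root_form D (ent s k) (ent s (k + 1)) + e - deg t)"
    proof (cases "\<sigma> k t \<in> S \<and> rs (\<sigma> k t) = s")
      case True
      \<comment> \<open>Here s is the residue sequence of \<open>\<sigma> k t\<close>, so t has the
        two residues in the other order; the symmetry of the root form makes up for this.\<close>
      have "ent s k = ent (rs t) (k + 1)" "ent s (k + 1) = ent (rs t) k"
        using ent_\<sigma>[OF t k, of k] ent_\<sigma>[OF t k, of "k + 1"] True k by (auto simp: transpose_def)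
      then show ?thesis
        using G_mult[OF B_homog[OF t k], of "v (\<sigma> k t)" "e - deg (\<sigma> k t)"] v True
          root_form_sym[OF cartan, of "ent s k"]
        by (auto simp: act_idp hom_vecs_def algebra_simps)
    next
      case False
      then have "B k t * act (idp s) v (\<sigma> k t) = 0"
        using B_zero[OF t k] by (cases "\<sigma> k t \<in> S") (auto simp: act_idp)
      then show ?thesis using G_zero by simp
    qed
    show ?thesis using G_add[OF 2 1] t by (simp add: mult act_psi)
  qed
  moreover have "act (psi k * idp s) v \<in> vecs A S"
    using v gens by (intro act_vecs free_algebra_mult) (auto simp: hom_vecs_def)
  ultimately show ?thesis by (simp add: hom_vecs_def)
qed

text \<open>Induction over the generation of homogeneous elements. A representative in the free
  algebra is carried along because the action of a sum or product of classes is computed on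
  representatives.\<close>

lemma klr_block_homog_act:
  assumes "klr_block_homog A G D \<alpha> b x"
  shows "(\<exists>f \<in> carrier (free_algebra A (klr_gens \<alpha>)). x = klr_class A D \<alpha> f) \<and>
    (\<forall>e. \<forall>v\<in>hom_vecs e. class_act x v \<in> hom_vecs (b + e))"
  using assms
proof induction
  case (zero d)
  have "class_act (klr_class A D \<alpha> 0) v \<in> hom_vecs (d + e)" if "v \<in> hom_vecs e" for v e
    unfolding class_act_class[OF free_algebra_zero hom_vecs_vecs[OF that]]
    by (simp add: hom_vecs_def vecs_def zero_A G_zero)
  then show ?case using free_algebra_zero by (auto simp: klr_class_zero)
next
  case (scalar a d)
  have a: "scal a \<in> carrier (free_algebra A (klr_gens \<alpha>))"
    using scalar G_A by (intro free_algebra_scal) blast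
  have "act (scal a) v \<in> hom_vecs (d + e)" if "v \<in> hom_vecs e" for v e
  proof -
    have "a * v t \<in> G (d + e - deg t)" if "t \<in> S" for t
      using G_mult[OF scalar, of "v t" "e - deg t"] \<open>v \<in> hom_vecs e\<close> that
      by (simp add: hom_vecs_def add_diff_eq)
    then show ?thesis using that G_A[OF scalar] by (auto simp: hom_vecs_def vecs_def mult_A)
  qed
  then have "class_act (klr_class A D \<alpha> (scal a)) v \<in> hom_vecs (d + e)" if "v \<in> hom_vecs e" for v e
    unfolding class_act_class[OF a hom_vecs_vecs[OF that]] using that by blast
  then show ?case using a by blast
next
  case (idp s)
  have f: "gen (Idp s) \<in> carrier (free_algebra A (klr_gens \<alpha>))"
    using idp by (auto simp: klr_gens_def intro!: free_algebra_gen)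
  have "act (gen (Idp s)) v \<in> hom_vecs (0 + e)" if "v \<in> hom_vecs e" for v e
    using that act_vecs[OF f hom_vecs_vecs[OF that]] G_zero
    by (auto simp: hom_vecs_def act_idp)
  then show ?case using f class_act_class[OF f] hom_vecs_vecs by auto
next
  case (y s m)
  have f: "yy m * idp s \<in> carrier (free_algebra A (klr_gens \<alpha>))"
    using y by (intro free_algebra_mult free_algebra_gen) (auto simp: klr_gens_def)
  have "act (yy m * idp s) v \<in> hom_vecs (2 * int (symm D (ent s m)) + e)" if v: "v \<in> hom_vecs e" for v e
  proof -
    have "act (yy m * idp s) v t \<in> G (2 * int (symm D (ent s m)) + e - deg t)" if t: "t \<in> S" for t
      using G_mult[OF c_homog[OF t], of m "v t" "e - deg t"] v t y G_zero
      by (auto simp: mult act_yy act_idp hom_vecs_def algebra_simps)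
    then show ?thesis using act_vecs[OF f hom_vecs_vecs[OF v]] by (simp add: hom_vecs_def)
  qed
  then show ?case using f class_act_class[OF f] hom_vecs_vecs by auto
next
  case (psi s k)
  have f: "psi k * idp s \<in> carrier (free_algebra A (klr_gens \<alpha>))"
    using psi by (intro free_algebra_mult free_algebra_gen) (auto simp: klr_gens_def)
  show ?case using f class_act_class[OF f] hom_vecs_vecs psi_homog psi by auto
next
  case (add d x y)
  then obtain f g where f: "f \<in> carrier (free_algebra A (klr_gens \<alpha>))" "x = klr_class A D \<alpha> f"
    and g: "g \<in> carrier (free_algebra A (klr_gens \<alpha>))" "y = klr_class A D \<alpha> g" by blast
  have "class_act (klr_class A D \<alpha> (f + g)) v \<in> hom_vecs (d + e)" if v: "v \<in> hom_vecs e" for v e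
  proof -
    have "class_act (klr_class A D \<alpha> (f + g)) v = class_act x v \<oplus>\<^bsub>fun_module A S\<^esub> class_act y v"
      using f g hom_vecs_vecs[OF v] by (simp add: class_act_class free_algebra_add free_act_add fun_eq_iff)
    moreover have "class_act x v \<in> hom_vecs (d + e)" "class_act y v \<in> hom_vecs (d + e)"
      using add v by blast+
    ultimately show ?thesis
      by (auto simp: hom_vecs_def vecs_def add_A G_add)
  qed
  then show ?case using f g by (auto simp: klr_class_add free_algebra_add)
next
  case (mult d x d' y)
  then obtain f g where f: "f \<in> carrier (free_algebra A (klr_gens \<alpha>))" "x = klr_class A D \<alpha> f"
    and g: "g \<in> carrier (free_algebra A (klr_gens \<alpha>))" "y = klr_class A D \<alpha> g" by blast
  have "class_act (klr_class A D \<alpha> (f * g)) v \<in> hom_vecs (d + d' + e)" if v: "v \<in> hom_vecs e" for v e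
  proof -
    have "class_act (klr_class A D \<alpha> (f * g)) v = class_act x (class_act y v)"
      using f g hom_vecs_vecs[OF v]
      by (simp add: class_act_class free_algebra_mult free_action.mult[OF free_action_axioms] act_vecs)
    moreover have "class_act y v \<in> hom_vecs (d' + e)" using mult v by blast
    then have "class_act x (class_act y v) \<in> hom_vecs (d + (d' + e))" using mult by blast
    ultimately show ?thesis by (simp add: add.assoc)
  qed
  then show ?case using f g by (auto simp: klr_class_mult free_algebra_mult)
qed

lemma graded_module_fun_module:
  "graded_module (subring_of A) G (klr_algebra A D (size \<alpha>)) (klr_homog A G D (size \<alpha>))
    (fun_module A S) mod_act hom_vecs"
proof -
  have "(\<lambda>t. a * v t) \<in> hom_vecs (d + e)" if "a \<in> G d" "v \<in> hom_vecs e" for a v d e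
  proof -
    have "a * v t \<in> G (d + e - deg t)" if "t \<in> S" for t
      using G_mult[OF \<open>a \<in> G d\<close>, of "v t" "e - deg t"] \<open>v \<in> hom_vecs e\<close> that
      by (simp add: hom_vecs_def add_diff_eq)
    then show ?thesis using that G_A[OF that(1)] by (auto simp: hom_vecs_def vecs_def mult_A)
  qed
  moreover have "mod_act r v \<in> hom_vecs (d + e)"
    if "r \<in> klr_homog A G D (size \<alpha>) d" "v \<in> hom_vecs e" for r v d e
    using that klr_block_homog_act[of d "r \<alpha>"] by (auto simp: klr_homog_def mod_act_def)
  ultimately show ?thesis
    unfolding graded_module_def
    using algebra_module_fun_module hom_vecs_additive ex1_decomposes by simp
qed

lemma unit_vec_homog: "t \<in> S \<Longrightarrow> unit_vec t \<in> hom_vecs (deg t)"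
  using unit_vec_carrier[of t S] by (auto simp: hom_vecs_def unit_vec_def G_one G_zero)

end

locale irreducible_seminormal = graded_seminormal A D \<alpha> S \<sigma> rs c B G comp deg
  for A :: "'a::comm_ring_1 set" and D :: "('i, 'a) klr_datum" and \<alpha> and S :: "'t set"
    and \<sigma> rs c B G comp deg +
  assumes G_units: "a \<in> G e \<Longrightarrow> a \<noteq> 0 \<Longrightarrow> \<exists>b\<in>A. a * b = 1"
    and nonempty: "S \<noteq> {}"
    and separated: "s \<in> S \<Longrightarrow> t \<in> S \<Longrightarrow> rs s = rs t \<Longrightarrow> s \<noteq> t \<Longrightarrow>
      \<exists>m\<in>{1..size \<alpha>}. c s m \<noteq> c t m"
    and connected: "N \<subseteq> S \<Longrightarrow> N \<noteq> {} \<Longrightarrow>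
      (\<And>t k. t \<in> N \<Longrightarrow> 1 \<le> k \<Longrightarrow> k < size \<alpha> \<Longrightarrow> \<sigma> k t \<in> S \<Longrightarrow> \<sigma> k t \<in> N) \<Longrightarrow> N = S"
    and B_nonzero: "t \<in> S \<Longrightarrow> 1 \<le> k \<Longrightarrow> k < size \<alpha> \<Longrightarrow> \<sigma> k t \<in> S \<Longrightarrow> B k t \<noteq> 0"
begin

lemma graded_submodule_trivial:
  assumes N: "graded_submodule (subring_of A) (klr_algebra A D (size \<alpha>)) (fun_module A S) mod_act hom_vecs N"
    and nz: "N \<noteq> {\<lambda>_. 0}"
  shows "N = vecs A S"
proof -
  let ?F = "carrier (free_algebra A (klr_gens \<alpha>))"
  interpret V: Module.module "subring_of A" "fun_module A S" by (rule module_fun_module)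
  have sub: "submodule N (subring_of A) (fun_module A S)" using N by (simp add: graded_submodule_def)
  have NV: "N \<subseteq> vecs A S" using V.submoduleE(1)[OF sub] by simp
  have N_smult: "(\<lambda>t. a * v t) \<in> N" if "a \<in> A" "v \<in> N" for a v
    using V.submoduleE(4)[OF sub, of a v] that by (simp add: subring_of_def)
  have N_add: "(\<lambda>t. v t + w t) \<in> N" if "v \<in> N" "w \<in> N" for v w
    using V.submoduleE(5)[OF sub that] by simp
  have N_zero: "(\<lambda>_. 0) \<in> N"
    using V.submoduleE(2)[OF sub] N_smult[OF zero_A] by auto
  have N_act: "act f v \<in> N" if "f \<in> ?F" "v \<in> N" for f v
  proof -
    have "mod_act (klr_elt A D \<alpha> f) v \<in> N"
      using N that klr_elt_carrier[OF that(1)] by (auto simp: graded_submodule_def)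
    then show ?thesis using mod_act_elt[OF that(1) refl] that NV by auto
  qed
  obtain v where v: "v \<in> N" "v \<noteq> (\<lambda>_. 0)" using nz N_zero by blast
  then obtain f where "decomposes (fun_module A S) (\<lambda>e. N \<inter> hom_vecs e) v f"
    using N by (auto simp: graded_submodule_def)
  then have f: "\<And>e. f e \<in> N \<inter> hom_vecs e" "v = (\<lambda>t. \<Sum>e | f e \<noteq> (\<lambda>_. 0). f e t)"
    by (subst (asm) decomposes_iff; use NV in blast)+
  have "\<exists>e. f e \<noteq> (\<lambda>_. 0)"
  proof (rule ccontr)
    assume "\<nexists>e. f e \<noteq> (\<lambda>_. 0)"
    then have "v = (\<lambda>_. 0)" by (subst f(2)) simp
    with v show False by simp
  qed
  \<comment> \<open>Only nonzero homogeneous scalars are known to be invertible, so the argument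
    passes to a homogeneous component of v, which lies in N because the submodule is graded.\<close>
  then obtain e where e: "f e \<noteq> (\<lambda>_. 0)" by blast
  define w where "w = f e"
  have w: "w \<in> N" "w \<in> hom_vecs e" using f(1)[of e] by (auto simp: w_def)
  obtain t where t: "w t \<noteq> 0" using e by (auto simp: w_def fun_eq_iff)
  then have tS: "t \<in> S" using w NV by (auto simp: vecs_def)
  \<comment> \<open>The tableaux other than t are removed one at a time while the value at t is
    kept. Each removing operator is diagonal and therefore does not revive earlier ones.\<close>
  have proj: "\<exists>w'\<in>N. w' t = w t \<and> (\<forall>s\<in>T. w' s = 0)" if "finite T" "T \<subseteq> S - {t}" for T
    using that
  proof (induction T rule: finite_induct)
    case empty then show ?case using w by auto
  next
    case (insert s T)
    then obtain w' where w': "w' \<in> N" "w' t = w t" "\<forall>s\<in>T. w' s = 0" by auto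
    have s: "s \<in> S" "s \<noteq> t" using insert by auto
    show ?case
    proof (cases "rs s = rs t")
      case True
      then obtain m where m: "1 \<le> m" "m \<le> size \<alpha>" "c t m \<noteq> c s m"
        using separated[OF s(1) tS] s by force
      have "c t m - c s m \<in> G (2 * int (symm D (ent (rs t) m)))"
        using G_add[OF _ G_uminus] c_homog[OF tS m(1,2)] c_homog[OF s(1) m(1,2)] True by fastforce
      then obtain u where u: "u \<in> A" "(c t m - c s m) * u = 1" using G_units m by force
      \<comment> \<open>A Lagrange interpolation factor: it is 1 at t and 0 at s. Equal residues
        make the difference of the two contents homogeneous, hence invertible.\<close>
      define g :: "('i, 'a) klr_free" where "g = scal u * (yy m - scal (c s m))"
      have g: "g \<in> ?F"
        unfolding g_def using u m c_A[OF s(1)]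
        by (intro free_algebra_closed free_algebra_gen) (auto simp: klr_gens_def)
      have val: "act g w' x = u * (c x m - c s m) * w' x" if "x \<in> S" for x
        using that by (simp add: g_def mult free_act_diff act_yy algebra_simps)
      have "act g w' t = ((c t m - c s m) * u) * w' t" using val[OF tS] by (simp add: mult_ac)
      then have "act g w' t = w t" using u w' by simp
      moreover have "act g w' x = 0" if "x \<in> insert s T" for x
        using that val w' insert.prems by auto
      ultimately show ?thesis using N_act[OF g w'(1)] by blast
    next
      case False
      have g: "gen (Idp (rs t)) \<in> ?F"
        using rs_seq[OF tS] by (intro free_algebra_gen) (auto simp: klr_gens_def)
      have "act (gen (Idp (rs t))) w' t = w t" using tS w' by (simp add: act_idp)
      moreover have "act (gen (Idp (rs t))) w' x = 0" if "x \<in> insert s T" for x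
      proof -
        have "x \<in> S" using that s insert.prems by auto
        then show ?thesis using that w' False by (auto simp: act_idp)
      qed
      ultimately show ?thesis using N_act[OF g w'(1)] by blast
    qed
  qed
  have "finite (S - {t})" using finite_S by simp
  then obtain w' where w': "w' \<in> N" "w' t = w t" "\<forall>s\<in>S - {t}. w' s = 0" using proj by blast
  have "w t \<in> G (e - deg t)" using w tS by (simp add: hom_vecs_def)
  then obtain u where u: "u \<in> A" "w t * u = 1" using G_units t by blast
  have "(\<lambda>x. u * w' x) = unit_vec t"
  proof
    fix x show "u * w' x = unit_vec t x"
      using w' u NV by (cases "x \<in> S") (auto simp: unit_vec_def vecs_def mult.commute)
  qed
  then have ut: "unit_vec t \<in> N" using N_smult[OF u(1) w'(1)] by simp
  have step: "unit_vec (\<sigma> k s) \<in> N"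
    if s: "s \<in> S" "unit_vec s \<in> N" and k: "1 \<le> k" "k < size \<alpha>" and \<sigma>: "\<sigma> k s \<in> S" for s k
  proof -
    have ss: "\<sigma> k (\<sigma> k s) = s" by (rule \<sigma>_twice[OF s(1)])
    have "B k (\<sigma> k s) \<noteq> 0" "B k (\<sigma> k s) \<in> G (deg s - deg (\<sigma> k s) -
        root_form D (ent (rs (\<sigma> k s)) k) (ent (rs (\<sigma> k s)) (k + 1)))"
      using B_nonzero[OF \<sigma> k] B_homog[OF \<sigma> k] ss s by auto
    then obtain u where u: "u \<in> A" "B k (\<sigma> k s) * u = 1" using G_units by blast
    have p: "gen (Psi k) \<in> ?F" using k by (intro free_algebra_gen) (auto simp: klr_gens_def)
    \<comment> \<open>Subtracting the diagonal part of psi_k v_s isolates the neighbour, whose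
      coefficient is homogeneous and nonzero and so can be divided out.\<close>
    have "u * (act (psi k) (unit_vec s) x + (- d k s) * unit_vec s x) =
        (B k (\<sigma> k s) * u) * unit_vec (\<sigma> k s) x" for x
      unfolding act_psi_unit_vec[OF s(1) k] using \<sigma> by (simp add: algebra_simps)
    then have "unit_vec (\<sigma> k s) = (\<lambda>x. u * (act (psi k) (unit_vec s) x + (- d k s) * unit_vec s x))"
      unfolding u(2) by (simp add: fun_eq_iff)
    also have "\<dots> \<in> N"
      by (intro N_smult N_add N_act p s u uminus_A d_A k)
    finally show ?thesis .
  qed
  have "{s \<in> S. unit_vec s \<in> N} = S"
    by (rule connected) (use ut tS step in auto)
  then have all: "unit_vec s \<in> N" if "s \<in> S" for s using that by blast
  have "vecs A S \<subseteq> N"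
  proof
    fix v assume v: "v \<in> vecs A S"
    have "(\<lambda>x. \<Sum>s\<in>T. v s * unit_vec s x) \<in> N" if "finite T" "T \<subseteq> S" for T
      using that
    proof (induction T rule: finite_induct)
      case (insert s T)
      then have "(\<lambda>x. v s * unit_vec s x) \<in> N" using v all by (intro N_smult) (auto simp: vecs_def)
      then show ?case using insert N_add[of "\<lambda>x. v s * unit_vec s x"] by simp
    qed (simp add: N_zero)
    then have "(\<lambda>x. \<Sum>s\<in>S. v s * unit_vec s x) \<in> N" using finite_S by blast
    also have "(\<lambda>x. \<Sum>s\<in>S. v s * unit_vec s x) = v"
      using v finite_S by (auto simp: unit_vec_def vecs_def fun_eq_iff if_distrib cong: if_cong)
    finally show "v \<in> N" .
  qed
  then show ?thesis using NV by blast
qed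

lemma graded_irreducible_fun_module:
  "graded_irreducible (subring_of A) G (klr_algebra A D (size \<alpha>)) (klr_homog A G D (size \<alpha>))
    (fun_module A S) mod_act hom_vecs"
proof -
  obtain t where t: "t \<in> S" using nonempty by blast
  then have "unit_vec t \<in> vecs A S" "unit_vec t \<noteq> (\<lambda>_. 0 :: 'a)"
    using unit_vec_carrier by (auto simp: unit_vec_def fun_eq_iff)
  then have "vecs A S \<noteq> {\<lambda>_. 0}" by blast
  then show ?thesis
    unfolding graded_irreducible_def
    using graded_module_fun_module graded_submodule_trivial by auto
qed

end

section \<open>Laurent polynomials\<close>

definition tdeg :: "('x \<Rightarrow>\<^sub>0 int) \<Rightarrow> int" where
  "tdeg m = (\<Sum>x \<in> Poly_Mapping.keys m. Poly_Mapping.lookup m x)"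

lemma tdeg_superset:
  "finite W \<Longrightarrow> Poly_Mapping.keys m \<subseteq> W \<Longrightarrow> tdeg m = (\<Sum>x\<in>W. Poly_Mapping.lookup m x)"
  unfolding tdeg_def by (rule sum.mono_neutral_left) (auto simp: in_keys_iff)

lemma tdeg_add: "tdeg (m + m') = tdeg m + tdeg m'"
  using Poly_Mapping.keys_add[of m m']
  by (simp add: tdeg_superset[of "Poly_Mapping.keys m \<union> Poly_Mapping.keys m'"] lookup_add sum.distrib)

lemma tdeg_zero [simp]: "tdeg 0 = 0"
  by (simp add: tdeg_def)

lemma laurent_homog_iff:
  "f \<in> laurent_homog X d \<longleftrightarrow> f \<in> laurent_ring X \<and> (\<forall>m\<in>Poly_Mapping.keys f. tdeg m = d)"
  by (auto simp: laurent_homog_def tdeg_def)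

lemma coeff_ring_laurent: "coeff_ring (laurent_ring X :: ('x, 'k::idom) laurent set)"
proof
  fix f g :: "('x, 'k) laurent"
  assume fg: "f \<in> laurent_ring X" "g \<in> laurent_ring X"
  show "f + g \<in> laurent_ring X"
    using fg Poly_Mapping.keys_add[of f g] by (auto simp: laurent_ring_def)
  have "Poly_Mapping.keys (m + m') \<subseteq> X"
    if "m \<in> Poly_Mapping.keys f" "m' \<in> Poly_Mapping.keys g" for m m'
    using Poly_Mapping.keys_add[of m m'] fg that unfolding laurent_ring_def by blast
  then show "f * g \<in> laurent_ring X"
    using keys_mult[of f g] unfolding laurent_ring_def by blast
  show "- f \<in> laurent_ring X"
    using fg by (auto simp: laurent_ring_def in_keys_iff)
qed (simp add: laurent_ring_def)

definition lcomp :: "int \<Rightarrow> ('x, 'k::idom) laurent \<Rightarrow> ('x, 'k) laurent" where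
  "lcomp e f = Abs_poly_mapping (\<lambda>m. Poly_Mapping.lookup f m when tdeg m = e)"

lemma lookup_lcomp: "Poly_Mapping.lookup (lcomp e f) m = (Poly_Mapping.lookup f m when tdeg m = e)"
proof -
  have "finite {m. (Poly_Mapping.lookup f m when tdeg m = e) \<noteq> 0}"
    by (rule finite_subset[OF _ finite_lookup[of f]]) (auto simp: when_def)
  then show ?thesis by (simp add: lcomp_def)
qed

lemma graded_coeff_laurent:
  "graded_coeff (laurent_ring X) (laurent_homog X :: int \<Rightarrow> ('x, 'k::idom) laurent set) lcomp"
proof -
  interpret coeff_ring "laurent_ring X :: ('x, 'k) laurent set" by (rule coeff_ring_laurent)
  have fin: "finite {e. lcomp e f \<noteq> 0}" for f :: "('x, 'k) laurent"
  proof (rule finite_subset)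
    show "{e. lcomp e f \<noteq> 0} \<subseteq> tdeg ` Poly_Mapping.keys f"
    proof
      fix e assume "e \<in> {e. lcomp e f \<noteq> 0}"
      then obtain m where "Poly_Mapping.lookup (lcomp e f) m \<noteq> 0"
        by (metis (mono_tags) mem_Collect_eq poly_mapping_eqI lookup_zero)
      then show "e \<in> tdeg ` Poly_Mapping.keys f" by (auto simp: lookup_lcomp in_keys_iff)
    qed
  qed simp
  show ?thesis
  proof
    fix f g :: "('x, 'k) laurent" and d e e' :: int
    show "f \<in> laurent_homog X e \<Longrightarrow> f \<in> laurent_ring X" by (simp add: laurent_homog_iff)
    show "f \<in> laurent_homog X e \<Longrightarrow> g \<in> laurent_homog X e \<Longrightarrow> f + g \<in> laurent_homog X e"
      using Poly_Mapping.keys_add[of f g] add_A[of f g] by (auto simp: laurent_homog_iff)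
    show "f \<in> laurent_homog X e \<Longrightarrow> - f \<in> laurent_homog X e"
      using uminus_A[of f] by (auto simp: laurent_homog_iff in_keys_iff)
    show "f \<in> laurent_homog X d \<Longrightarrow> g \<in> laurent_homog X e \<Longrightarrow> f * g \<in> laurent_homog X (d + e)"
      using keys_mult[of f g] mult_A[of f g] by (auto simp: laurent_homog_iff tdeg_add dest!: subsetD)
    show "(1 :: ('x, 'k) laurent) \<in> laurent_homog X 0"
      using one_A by (simp add: laurent_homog_iff)
    show "f \<in> laurent_ring X \<Longrightarrow> lcomp e f \<in> laurent_homog X e"
      by (auto simp: laurent_homog_iff laurent_ring_def in_keys_iff lookup_lcomp)
    show "lcomp e (f + g) = lcomp e f + lcomp e g"
      by (rule poly_mapping_eqI) (simp add: lookup_lcomp lookup_add when_add_distrib)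
    show "finite {e. lcomp e f \<noteq> 0}" by (rule fin)
    show "(\<Sum>e | lcomp e f \<noteq> 0. lcomp e f) = f"
    proof (rule poly_mapping_eqI)
      fix m
      have "Poly_Mapping.lookup (\<Sum>e | lcomp e f \<noteq> 0. lcomp e f) m =
          (\<Sum>e | lcomp e f \<noteq> 0. if e = tdeg m then Poly_Mapping.lookup f m else 0)"
        by (auto simp: lookup_sum lookup_lcomp when_def intro!: sum.cong)
      also have "\<dots> = Poly_Mapping.lookup f m"
        using fin[of f] lookup_lcomp[of "tdeg m" f m] by auto
      finally show "Poly_Mapping.lookup (\<Sum>e | lcomp e f \<noteq> 0. lcomp e f) m = Poly_Mapping.lookup f m" .
    qed
    show "f \<in> laurent_homog X e \<Longrightarrow> lcomp e' f = (if e' = e then f else 0)"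
    proof (rule poly_mapping_eqI)
      fix m assume "f \<in> laurent_homog X e"
      then have "Poly_Mapping.lookup f m = 0 \<or> tdeg m = e"
        using laurent_homog_iff[of f X e] by (auto simp: in_keys_iff)
      then show "Poly_Mapping.lookup (lcomp e' f) m = Poly_Mapping.lookup (if e' = e then f else 0) m"
        by (auto simp: lookup_lcomp when_def)
    qed
  qed
qed

text \<open>
  A total order of the monomials in finitely many variables, compatible with multiplication: the
  total degree comes first, and ties are broken lexicographically for an enumeration of the variables.
\<close>

definition mono_key :: "(nat \<Rightarrow> 'x) \<Rightarrow> nat \<Rightarrow> ('x \<Rightarrow>\<^sub>0 int) \<Rightarrow> nat \<Rightarrow>\<^sub>0 int" where
  "mono_key e N m = Abs_poly_mapping (\<lambda>i. case i of 0 \<Rightarrow> tdeg m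
     | Suc i \<Rightarrow> if i < N then Poly_Mapping.lookup m (e i) else 0)"

lemma lookup_mono_key:
  "Poly_Mapping.lookup (mono_key e N m) i = (case i of 0 \<Rightarrow> tdeg m
     | Suc i \<Rightarrow> if i < N then Poly_Mapping.lookup m (e i) else 0)"
proof -
  have "{i. (case i of 0 \<Rightarrow> tdeg m | Suc i \<Rightarrow> if i < N then Poly_Mapping.lookup m (e i) else 0) \<noteq> 0}
      \<subseteq> {..N}"
  proof
    fix i assume "i \<in> {i. (case i of 0 \<Rightarrow> tdeg m
      | Suc i \<Rightarrow> if i < N then Poly_Mapping.lookup m (e i) else 0) \<noteq> 0}"
    then show "i \<in> {..N}" by (cases i) (auto split: if_splits)
  qed
  then have "finite {i. (case i of 0 \<Rightarrow> tdeg m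
      | Suc i \<Rightarrow> if i < N then Poly_Mapping.lookup m (e i) else 0) \<noteq> 0}"
    by (rule finite_subset) simp
  then show ?thesis by (simp add: mono_key_def)
qed

lemma mono_key_add: "mono_key e N (m + m') = mono_key e N m + mono_key e N m'"
  by (rule poly_mapping_eqI) (auto simp: lookup_mono_key lookup_add tdeg_add split: nat.split)

text \<open>The order of the keys is decided at the least index where they differ, and index 0 holds
  the total degree.\<close>

lemma mono_key_le_tdeg: "mono_key e N m \<le> mono_key e N m' \<Longrightarrow> tdeg m \<le> tdeg m'"
proof -
  assume "mono_key e N m \<le> mono_key e N m'"
  then consider "Poly_Mapping.lookup (mono_key e N m) = Poly_Mapping.lookup (mono_key e N m')"
    | "less_fun (Poly_Mapping.lookup (mono_key e N m)) (Poly_Mapping.lookup (mono_key e N m'))"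
    unfolding less_eq_poly_mapping.rep_eq by blast
  then show ?thesis
  proof cases
    case 1
    then have "Poly_Mapping.lookup (mono_key e N m) 0 = Poly_Mapping.lookup (mono_key e N m') 0" by simp
    then show ?thesis by (simp add: lookup_mono_key)
  next
    case 2
    then obtain k where "Poly_Mapping.lookup (mono_key e N m) k < Poly_Mapping.lookup (mono_key e N m') k"
      "\<forall>k'<k. Poly_Mapping.lookup (mono_key e N m) k' = Poly_Mapping.lookup (mono_key e N m') k'"
      unfolding less_fun_def by blast
    then have "Poly_Mapping.lookup (mono_key e N m) 0 \<le> Poly_Mapping.lookup (mono_key e N m') 0"
      by (cases k) auto
    then show ?thesis by (simp add: lookup_mono_key)
  qed
qed

text \<open>The positions from 1 on record the exponents of the listed variables, and no others
  occur; so ties in the total degree are broken completely.\<close>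

lemma inj_on_mono_key: "inj_on (mono_key e N) {m. Poly_Mapping.keys m \<subseteq> e ` {..<N}}"
proof (rule inj_onI, rule poly_mapping_eqI)
  fix m m' x
  assume m: "m \<in> {m. Poly_Mapping.keys m \<subseteq> e ` {..<N}}" "m' \<in> {m. Poly_Mapping.keys m \<subseteq> e ` {..<N}}"
    and eq: "mono_key e N m = mono_key e N m'"
  show "Poly_Mapping.lookup m x = Poly_Mapping.lookup m' x"
  proof (cases "x \<in> e ` {..<N}")
    case True
    then obtain i where i: "i < N" "x = e i" by auto
    have "Poly_Mapping.lookup (mono_key e N m) (Suc i) = Poly_Mapping.lookup (mono_key e N m') (Suc i)"
      using eq by simp
    then show ?thesis using i by (simp add: lookup_mono_key)
  next
    case False
    then have "x \<notin> Poly_Mapping.keys m" "x \<notin> Poly_Mapping.keys m'" using m by auto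
    then show ?thesis by (simp add: in_keys_iff)
  qed
qed

text \<open>The product of the two largest monomials arises from a single pair of monomials, so its
  coefficient is a product of two nonzero elements of a domain and cannot cancel.\<close>

lemma extremal_monomial:
  fixes f g :: "('m::comm_monoid_add) \<Rightarrow>\<^sub>0 'b::idom" and h :: "'m \<Rightarrow> 'c::linordered_ab_group_add"
  assumes h_add: "\<And>m m'. h (m + m') = h m + h m'"
    and inj: "inj_on h (Poly_Mapping.keys f \<union> Poly_Mapping.keys g)"
    and nz: "f \<noteq> 0" "g \<noteq> 0"
  obtains m m' where "m \<in> Poly_Mapping.keys f" "m' \<in> Poly_Mapping.keys g" "m + m' \<in> Poly_Mapping.keys (f * g)"
    "\<And>u. u \<in> Poly_Mapping.keys f \<Longrightarrow> h u \<le> h m" "\<And>u. u \<in> Poly_Mapping.keys g \<Longrightarrow> h u \<le> h m'"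
proof -
  have max: "\<exists>m\<in>Poly_Mapping.keys f. \<forall>u\<in>Poly_Mapping.keys f. h u \<le> h m" if "f \<noteq> 0" for f :: "'m \<Rightarrow>\<^sub>0 'b"
  proof -
    have "Poly_Mapping.keys f \<noteq> {}" using that by (metis keys_eq_empty)
    then show ?thesis
      using Max_in[of "h ` Poly_Mapping.keys f"] Max_ge[of "h ` Poly_Mapping.keys f"] by fastforce
  qed
  obtain m where m: "m \<in> Poly_Mapping.keys f" "\<forall>u\<in>Poly_Mapping.keys f. h u \<le> h m" using max nz by blast
  obtain m' where m': "m' \<in> Poly_Mapping.keys g" "\<forall>u\<in>Poly_Mapping.keys g. h u \<le> h m'" using max nz by blast
  have uniq: "u = m \<and> w = m'" if u: "u \<in> Poly_Mapping.keys f" and w: "w \<in> Poly_Mapping.keys g" and eq: "u + w = m + m'" for u w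
  proof -
    have "h u + h w = h m + h m'" using h_add eq by metis
    moreover have "h u \<le> h m" "h w \<le> h m'" using m m' u w by auto
    ultimately have "h u = h m" "h w = h m'"
      using add_less_le_mono[of "h u" "h m" "h w" "h m'"] add_le_less_mono[of "h u" "h m" "h w" "h m'"]
      by (auto simp: le_less)
    then show ?thesis using inj u w m m' by (auto simp: inj_on_def)
  qed
  let ?s = "\<lambda>f w. Poly_Mapping.single w (Poly_Mapping.lookup f w)"
  have "f * g = (\<Sum>u\<in>Poly_Mapping.keys f. \<Sum>w\<in>Poly_Mapping.keys g. ?s f u * ?s g w)"
    by (subst poly_mapping_sum_singles[of f], subst poly_mapping_sum_singles[of g]) (simp add: sum_product)
  then have "Poly_Mapping.lookup (f * g) (m + m') = (\<Sum>u\<in>Poly_Mapping.keys f. \<Sum>w\<in>Poly_Mapping.keys g.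
      if u = m \<and> w = m' then Poly_Mapping.lookup f m * Poly_Mapping.lookup g m' else 0)"
    using uniq by (auto simp: lookup_sum mult_single lookup_single when_def intro!: sum.cong)
  also have "\<dots> = (\<Sum>u\<in>Poly_Mapping.keys f. if u = m then Poly_Mapping.lookup f m * Poly_Mapping.lookup g m' else 0)"
    using m' by (intro sum.cong refl) auto
  also have "\<dots> = Poly_Mapping.lookup f m * Poly_Mapping.lookup g m'" using m by simp
  finally have "m + m' \<in> Poly_Mapping.keys (f * g)" using m m' by (simp add: in_keys_iff)
  then show thesis using that m m' by blast
qed

text \<open>The indeterminates may be infinite in number and carry no order, but two given elements
  involve finitely many, which are enumerated. The statement on minimal degrees is the one on
  maximal degrees for the negated key.\<close>

lemma laurent_extremal:
  fixes f g :: "('x, 'k::idom) laurent"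
  assumes nz: "f \<noteq> 0" "g \<noteq> 0"
  shows "\<exists>m\<in>Poly_Mapping.keys f. \<exists>m'\<in>Poly_Mapping.keys g. m + m' \<in> Poly_Mapping.keys (f * g) \<and>
      (\<forall>u\<in>Poly_Mapping.keys f. tdeg u \<le> tdeg m) \<and> (\<forall>u\<in>Poly_Mapping.keys g. tdeg u \<le> tdeg m')" (is ?max)
    and "\<exists>m\<in>Poly_Mapping.keys f. \<exists>m'\<in>Poly_Mapping.keys g. m + m' \<in> Poly_Mapping.keys (f * g) \<and>
      (\<forall>u\<in>Poly_Mapping.keys f. tdeg m \<le> tdeg u) \<and> (\<forall>u\<in>Poly_Mapping.keys g. tdeg m' \<le> tdeg u)" (is ?min)
proof -
  define W where "W = \<Union> (Poly_Mapping.keys ` (Poly_Mapping.keys f \<union> Poly_Mapping.keys g))"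
  have "finite W" by (auto simp: W_def)
  then obtain N and e :: "nat \<Rightarrow> 'x" where "W = e ` {i. i < N}"
    using finite_imp_nat_seg_image_inj_on by blast
  then have W: "W = e ` {..<N}" by (auto simp: lessThan_def)
  have inj: "inj_on (mono_key e N) (Poly_Mapping.keys f \<union> Poly_Mapping.keys g)"
    by (rule inj_on_subset[OF inj_on_mono_key]) (auto simp: W[symmetric] W_def)
  show ?max
    by (rule extremal_monomial[OF mono_key_add inj nz]) (meson mono_key_le_tdeg)
  define h where "h = (\<lambda>m. - mono_key e N m)"
  have inj': "inj_on h (Poly_Mapping.keys f \<union> Poly_Mapping.keys g)"
    using inj by (auto simp: inj_on_def h_def)
  have h_add: "h (m + m') = h m + h m'" for m m'
    by (simp add: h_def mono_key_add)
  have le: "h m \<le> h m' \<Longrightarrow> tdeg m' \<le> tdeg m" for m m'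
    using mono_key_le_tdeg by (simp add: h_def)
  show ?min
    by (rule extremal_monomial[OF h_add inj' nz]) (meson le)
qed

lemma laurent_mult_eq_0: "(f :: ('x, 'k::idom) laurent) * g = 0 \<Longrightarrow> f = 0 \<or> g = 0"
  using laurent_extremal(1)[of f g] by auto

text \<open>Highest and lowest degrees both add under multiplication. If they agree for the product,
  they agree for each factor.\<close>

lemma laurent_homog_factor:
  fixes f g :: "('x, 'k::idom) laurent"
  assumes fg: "f \<in> laurent_ring X" "g \<in> laurent_ring X" "f * g \<in> laurent_homog X d" "f * g \<noteq> 0"
  shows "\<exists>e. f \<in> laurent_homog X e"
proof -
  have nz: "f \<noteq> 0" "g \<noteq> 0" using fg by auto
  obtain m m' where m: "m \<in> Poly_Mapping.keys f" "m' \<in> Poly_Mapping.keys g"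
      "m + m' \<in> Poly_Mapping.keys (f * g)" "\<forall>u\<in>Poly_Mapping.keys f. tdeg u \<le> tdeg m"
      "\<forall>u\<in>Poly_Mapping.keys g. tdeg u \<le> tdeg m'"
    using laurent_extremal(1)[OF nz] by blast
  obtain l l' where l: "l \<in> Poly_Mapping.keys f" "l' \<in> Poly_Mapping.keys g"
      "l + l' \<in> Poly_Mapping.keys (f * g)" "\<forall>u\<in>Poly_Mapping.keys f. tdeg l \<le> tdeg u"
      "\<forall>u\<in>Poly_Mapping.keys g. tdeg l' \<le> tdeg u"
    using laurent_extremal(2)[OF nz] by blast
  have "tdeg m + tdeg m' = d" "tdeg l + tdeg l' = d"
    using fg m(3) l(3) by (auto simp: laurent_homog_iff tdeg_add)
  moreover have "tdeg l \<le> tdeg m" "tdeg l' \<le> tdeg m'" using m l by auto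
  ultimately have "tdeg l = tdeg m" by linarith
  then have "\<forall>u\<in>Poly_Mapping.keys f. tdeg u = tdeg m" using m l by (metis order_antisym)
  then show ?thesis using fg by (auto simp: laurent_homog_iff)
qed

lemma laurent_homog_unique:
  "f \<in> laurent_homog X d \<Longrightarrow> f \<in> laurent_homog X e \<Longrightarrow> f \<noteq> 0 \<Longrightarrow> d = e"
  by (metis laurent_homog_iff all_not_in_conv keys_eq_empty)

section \<open>Potentials of weighted rewriting systems\<close>

inductive wpath :: "('t \<Rightarrow> int \<Rightarrow> 't \<Rightarrow> bool) \<Rightarrow> 't \<Rightarrow> int \<Rightarrow> 't \<Rightarrow> bool" for E where
  empty: "wpath E t 0 t"
| edge: "E t w u \<Longrightarrow> wpath E u p s \<Longrightarrow> wpath E t (w + p) s"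

lemma wpath_trans: "wpath E t p u \<Longrightarrow> wpath E u q s \<Longrightarrow> wpath E t (p + q) s"
  by (induction rule: wpath.induct) (auto simp: add.assoc intro: wpath.edge)

text \<open>A weighted form of Newman's lemma.\<close>

lemma potential_exists:
  fixes \<mu> :: "'t \<Rightarrow> nat"
  assumes dec: "\<And>t w u. t \<in> S \<Longrightarrow> E t w u \<Longrightarrow> u \<in> S \<and> \<mu> u < \<mu> t"
    and reduce: "\<And>t. t \<in> S \<Longrightarrow> t \<noteq> t0 \<Longrightarrow> \<exists>w u. E t w u"
    and normal: "\<And>w u. \<not> E t0 w u"
    and confluent: "\<And>t w1 u1 w2 u2. t \<in> S \<Longrightarrow> E t w1 u1 \<Longrightarrow> E t w2 u2 \<Longrightarrow>
      \<exists>s p1 p2. wpath E u1 p1 s \<and> wpath E u2 p2 s \<and> w1 + p1 = w2 + p2"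
  shows "\<exists>deg. \<forall>t\<in>S. \<forall>w u. E t w u \<longrightarrow> deg t = deg u + w"
proof -
  have closed: "s \<in> S" if "wpath E t p s" "t \<in> S" for t p s
    using that by (induction rule: wpath.induct) (auto dest: dec)
  have ex: "\<exists>p. wpath E t p t0" if "t \<in> S" for t
    using that
  proof (induction "\<mu> t" arbitrary: t rule: less_induct)
    case less
    show ?case
    proof (cases "t = t0")
      case True then show ?thesis by (auto intro: wpath.empty)
    next
      case False
      then obtain w u where u: "E t w u" using reduce less by blast
      then obtain p where "wpath E u p t0" using less dec by blast
      then show ?thesis using u wpath.edge by fast
    qed
  qed
  have unique: "p = q" if "wpath E t p t0" "wpath E t q t0" "t \<in> S" for t p q
    using that
  proof (induction "\<mu> t" arbitrary: t p q rule: less_induct)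
    case less
    have inv: "\<exists>w u p'. E t w u \<and> wpath E u p' t0 \<and> p = w + p'" if "wpath E t p t0" "t \<noteq> t0" for p
      using that by (cases rule: wpath.cases) auto
    show ?case
    proof (cases "t = t0")
      case True
      have "p = 0" if "wpath E t0 p t0" for p
        using that normal by (cases rule: wpath.cases) auto
      then show ?thesis using less.prems True by blast
    next
      case False
      obtain w1 u1 p1 where 1: "E t w1 u1" "wpath E u1 p1 t0" "p = w1 + p1"
        using inv[OF less.prems(1) False] by blast
      obtain w2 u2 p2 where 2: "E t w2 u2" "wpath E u2 p2 t0" "q = w2 + p2"
        using inv[OF less.prems(2) False] by blast
      obtain s q1 q2 where s: "wpath E u1 q1 s" "wpath E u2 q2 s" "w1 + q1 = w2 + q2"
        using confluent[OF less.prems(3) 1(1) 2(1)] by blast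
      have u: "u1 \<in> S" "u2 \<in> S" "\<mu> u1 < \<mu> t" "\<mu> u2 < \<mu> t"
        using dec[OF less.prems(3)] 1(1) 2(1) by auto
      \<comment> \<open>Continuing both branches from their meeting point s along one path to t0
        lets the induction hypothesis at u1 and at u2 compare p1 with q1 + r and p2 with q2 +
        r.\<close>
      obtain r where r: "wpath E s r t0" using ex closed[OF s(1) u(1)] by blast
      have "p1 = q1 + r" using less.hyps[OF u(3) 1(2) wpath_trans[OF s(1) r] u(1)] .
      moreover have "p2 = q2 + r" using less.hyps[OF u(4) 2(2) wpath_trans[OF s(2) r] u(2)] .
      ultimately show ?thesis using 1 2 s by simp
    qed
  qed
  \<comment> \<open>The potential of t is the weight of any path from t to the normal form.\<close>
  define deg where "deg t = (THE p. wpath E t p t0)" for t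
  have deg: "deg t = p" if "wpath E t p t0" "t \<in> S" for t p
    unfolding deg_def using that unique by blast
  have "deg t = deg u + w" if "t \<in> S" "E t w u" for t w u
  proof -
    have u: "u \<in> S" using dec that by blast
    then obtain p where p: "wpath E u p t0" using ex by blast
    then have "wpath E t (w + p) t0" using that by (auto intro: wpath.edge)
    then show ?thesis using deg p u that by fastforce
  qed
  then show ?thesis by blast
qed

section \<open>Standard tableaux\<close>

abbreviation box_of :: "nat list list \<Rightarrow> (box \<Rightarrow> nat) \<Rightarrow> nat \<Rightarrow> box" where
  "box_of lam t m \<equiv> inv_into (diagram lam) t m"

definition adj :: "box \<Rightarrow> box \<Rightarrow> bool" where
  "adj b b' = (case b of (k, r, c) \<Rightarrow> b' = (k, r, c + 1) \<or> b' = (k, r + 1, c))"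

text \<open>Boxes are compared lexicographically by component, row and column, and a step right or
  down increases them. Hence a pair of entries that is out of order is never in adjacent
  boxes.\<close>

lemma adj_less: "adj b b' \<Longrightarrow> b < b'"
  by (auto simp: adj_def split: prod.splits)

lemma transpose_less:
  assumes "(x::nat) < y" "\<not> (x = k \<and> y = k + 1)"
  shows "transpose k (k + 1) x < transpose k (k + 1) y"
  using assms by (auto simp: transpose_def)

lemma card_diagram:
  assumes "lam \<in> multipartitions l n"
  shows "card (diagram lam) = n"
proof -
  have shift: "(\<Sum>i\<in>{1..N}. f (i - 1)) = (\<Sum>i\<in>{0..<N}. f i)" for f :: "nat \<Rightarrow> nat" and N
    by (rule sum.reindex_bij_witness[of _ "\<lambda>i. i + 1" "\<lambda>i. i - 1"]) auto
  have "diagram lam = (SIGMA k:{1..length lam}. SIGMA r:{1..length (lam ! (k - 1))}.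
      {1..lam ! (k - 1) ! (r - 1)})"
    by (auto simp: diagram_def)
  then have "card (diagram lam) = (\<Sum>k\<in>{1..length lam}. \<Sum>r\<in>{1..length (lam ! (k - 1))}. lam ! (k - 1) ! (r - 1))"
    by simp
  also have "\<dots> = (\<Sum>k\<in>{1..length lam}. sum_list (lam ! (k - 1)))"
    by (simp only: shift[of "\<lambda>r. lam ! (k - 1) ! r" for k] sum_list_sum_nth)
  also have "\<dots> = sum_list (map sum_list lam)"
    by (simp only: shift[of "\<lambda>k. sum_list (lam ! k)"]) (simp add: sum_list_sum_nth)
  finally show ?thesis using assms by (simp add: multipartitions_def)
qed

locale shape =
  fixes lam :: "nat list list" and n :: nat
  assumes partitions: "p \<in> set lam \<Longrightarrow> is_partition p"
    and size: "card (diagram lam) = n"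
begin

lemma finite_diagram: "finite (diagram lam)"
proof (rule finite_subset)
  show "diagram lam \<subseteq> (SIGMA k:{1..length lam}. SIGMA r:{1..length (lam ! (k - 1))}.
      {1..lam ! (k - 1) ! (r - 1)})"
    by (auto simp: diagram_def)
qed auto

lemma diagram_down:
  assumes "(k, r, c) \<in> diagram lam" "1 \<le> r'" "r' \<le> r" "1 \<le> c'" "c' \<le> c"
  shows "(k, r', c') \<in> diagram lam"
proof -
  let ?p = "lam ! (k - 1)"
  have k: "1 \<le> k" "k \<le> length lam" "r \<le> length ?p" "c \<le> ?p ! (r - 1)"
    using assms(1) by (auto simp: diagram_def)
  then have "sorted_wrt (\<ge>) ?p" using partitions[of ?p] by (simp add: is_partition_def)
  then have "?p ! (r - 1) \<le> ?p ! (r' - 1)"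
    using assms k by (cases "r = r'") (auto dest: sorted_wrt_nth_less[of _ _ "r' - 1" "r - 1"])
  then show ?thesis using assms k by (auto simp: diagram_def)
qed

lemma diagram_pos: "(k, r, c) \<in> diagram lam \<Longrightarrow> 1 \<le> k \<and> k \<le> length lam \<and> 1 \<le> r \<and> 1 \<le> c"
  by (auto simp: diagram_def)

text \<open>The c boxes to the left in the row, and the r boxes above in the column, all belong to
  the diagram (the box itself included), so r and c are at most n. This places all diagonals in the
  range where the content system separates them.\<close>

lemma diagram_bound:
  assumes "(k, r, c) \<in> diagram lam"
  shows "- int n < int c - int r" "int c - int r < int n"
proof -
  have pos: "1 \<le> r" "1 \<le> c" using diagram_pos assms by auto
  have "card ((\<lambda>c. (k, r, c)) ` {1..c}) \<le> n" unfolding size[symmetric]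
    using diagram_down[OF assms] pos by (intro card_mono finite_diagram) auto
  moreover have "card ((\<lambda>r. (k, r, c)) ` {1..r}) \<le> n" unfolding size[symmetric]
    using diagram_down[OF assms] pos by (intro card_mono finite_diagram) auto
  ultimately have "c \<le> n" "r \<le> n" by (simp_all add: card_image inj_on_def)
  then show "- int n < int c - int r" "int c - int r < int n" using pos by auto
qed

lemma Std_bij: "t \<in> Std lam \<Longrightarrow> bij_betw t (diagram lam) {1..n}"
  by (simp add: Std_def size)

text \<open>One moves along the row and then down the column through the corner (k, r, c'), which
  belongs to the diagram of a partition.\<close>

lemma Std_nw:
  assumes t: "t \<in> Std lam" and b: "(k, r, c) \<in> diagram lam" "(k, r', c') \<in> diagram lam"
    and le: "r \<le> r'" "c \<le> c'" "(r, c) \<noteq> (r', c')"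
  shows "t (k, r, c) < t (k, r', c')"
proof -
  have m: "(k, r, c') \<in> diagram lam"
    using diagram_down[OF b(2)] le diagram_pos[OF b(1)] diagram_pos[OF b(2)] by auto
  have 1: "c < c' \<Longrightarrow> t (k, r, c) < t (k, r, c')" using t b m unfolding Std_def by blast
  have 2: "r < r' \<Longrightarrow> t (k, r, c') < t (k, r', c')" using t b m unfolding Std_def by blast
  show ?thesis
    using 1 2 le by (cases "c = c'"; cases "r = r'") auto
qed

lemma box_in:
  assumes "t \<in> Std lam" "1 \<le> m" "m \<le> n"
  shows "box_of lam t m \<in> diagram lam" "t (box_of lam t m) = m"
proof -
  have "m \<in> t ` diagram lam" using Std_bij[OF assms(1)] assms by (auto simp: bij_betw_def)
  then show "box_of lam t m \<in> diagram lam" "t (box_of lam t m) = m"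
    by (auto intro: inv_into_into f_inv_into_f)
qed

lemma box_eq: "t \<in> Std lam \<Longrightarrow> b \<in> diagram lam \<Longrightarrow> box_of lam t (t b) = b"
  using Std_bij by (auto simp: bij_betw_def inv_into_f_f)

lemma entry_range: "t \<in> Std lam \<Longrightarrow> b \<in> diagram lam \<Longrightarrow> 1 \<le> t b \<and> t b \<le> n"
  using Std_bij[of t] by (auto simp: bij_betw_def)

lemma box_inj:
  assumes "t \<in> Std lam" "1 \<le> m" "m \<le> n" "1 \<le> m'" "m' \<le> n" "box_of lam t m = box_of lam t m'"
  shows "m = m'"
  using box_in(2)[OF assms(1)] assms by metis

text \<open>Exchanging k and k + 1 can only break the order between these two entries. If they lay
  in one row or column without being adjacent, a box between them would need an entry strictly
  between k and k + 1.\<close>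

lemma swap_tab_Std_iff:
  assumes t: "t \<in> Std lam" and k: "1 \<le> k" "k < n"
  shows "swap_tab lam k t \<in> Std lam \<longleftrightarrow> \<not> adj (box_of lam t k) (box_of lam t (k + 1))"
proof
  assume s: "swap_tab lam k t \<in> Std lam"
  show "\<not> adj (box_of lam t k) (box_of lam t (k + 1))"
  proof
    assume a: "adj (box_of lam t k) (box_of lam t (k + 1))"
    obtain l r c where b: "box_of lam t k = (l, r, c)" by (cases "box_of lam t k") auto
    have in1: "box_of lam t k \<in> diagram lam" "t (box_of lam t k) = k"
      and in2: "box_of lam t (k + 1) \<in> diagram lam" "t (box_of lam t (k + 1)) = k + 1"
      using box_in[OF t] k by auto
    have "swap_tab lam k t (box_of lam t k) < swap_tab lam k t (box_of lam t (k + 1))"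
      using a Std_nw[OF s, of l r c] in1 in2 unfolding b adj_def by auto
    then show False using in1 in2 by (simp add: swap_tab_def transpose_def)
  qed
next
  assume na: "\<not> adj (box_of lam t k) (box_of lam t (k + 1))"
  have bij: "bij_betw (transpose k (k + 1)) {1..n} {1..n}"
    by (rule bij_betw_byWitness[of _ "transpose k (k + 1)"]) (use k in \<open>auto simp: transpose_def\<close>)
  have "bij_betw (transpose k (k + 1) \<circ> t) (diagram lam) {1..n}"
    by (rule bij_betw_trans[OF Std_bij[OF t] bij])
  then have "bij_betw (swap_tab lam k t) (diagram lam) {1..n}"
    by (rule bij_betw_cong[THEN iffD1, rotated]) (simp add: swap_tab_def)
  moreover have "swap_tab lam k t (l, r, c) < swap_tab lam k t (l, r, c')"
    if b: "(l, r, c) \<in> diagram lam" "(l, r, c') \<in> diagram lam" "c < c'" for l r c c'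
  proof -
    have lt: "t (l, r, c) < t (l, r, c')" using Std_nw[OF t] b by simp
    have "\<not> (t (l, r, c) = k \<and> t (l, r, c') = k + 1)"
    proof
      assume e: "t (l, r, c) = k \<and> t (l, r, c') = k + 1"
      then have "box_of lam t k = (l, r, c)" "box_of lam t (k + 1) = (l, r, c')"
        using box_eq[OF t] b by metis+
      then have "c + 1 < c'" using na b by (auto simp: adj_def)
      moreover have "(l, r, c + 1) \<in> diagram lam"
        using diagram_down[OF b(2)] diagram_pos[OF b(1)] b by auto
      ultimately have "t (l, r, c) < t (l, r, c + 1)" "t (l, r, c + 1) < t (l, r, c')"
        using Std_nw[OF t] b by auto
      then show False using e by simp
    qed
    then show ?thesis using transpose_less[OF lt] b by (simp add: swap_tab_def)
  qed
  moreover have "swap_tab lam k t (l, r, c) < swap_tab lam k t (l, r', c)"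
    if b: "(l, r, c) \<in> diagram lam" "(l, r', c) \<in> diagram lam" "r < r'" for l r r' c
  proof -
    have lt: "t (l, r, c) < t (l, r', c)" using Std_nw[OF t] b by simp
    have "\<not> (t (l, r, c) = k \<and> t (l, r', c) = k + 1)"
    proof
      assume e: "t (l, r, c) = k \<and> t (l, r', c) = k + 1"
      then have "box_of lam t k = (l, r, c)" "box_of lam t (k + 1) = (l, r', c)"
        using box_eq[OF t] b by metis+
      then have "r + 1 < r'" using na b by (auto simp: adj_def)
      moreover have "(l, r + 1, c) \<in> diagram lam"
        using diagram_down[OF b(2)] diagram_pos[OF b(1)] b by auto
      ultimately have "t (l, r, c) < t (l, r + 1, c)" "t (l, r + 1, c) < t (l, r', c)"
        using Std_nw[OF t] b by auto
      then show False using e by simp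
    qed
    then show ?thesis using transpose_less[OF lt] b by (simp add: swap_tab_def)
  qed
  moreover have "swap_tab lam k t \<in> extensional (diagram lam)" by (simp add: swap_tab_def)
  ultimately show "swap_tab lam k t \<in> Std lam" unfolding Std_def size by blast
qed

lemma box_swap_tab:
  assumes t: "t \<in> Std lam" and k: "1 \<le> k" "k < n" "1 \<le> m" "m \<le> n"
  shows "box_of lam (swap_tab lam k t) m = box_of lam t (transpose k (k + 1) m)"
proof -
  have "1 \<le> transpose k (k + 1) m" "transpose k (k + 1) m \<le> n" using k by (auto simp: transpose_def)
  note b = box_in[OF t this]
  have "inj_on (swap_tab lam k t) (diagram lam)"
  proof (rule inj_onI)
    fix x y assume xy: "x \<in> diagram lam" "y \<in> diagram lam" "swap_tab lam k t x = swap_tab lam k t y"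
    then have "t x = t y" by (auto simp: swap_tab_def transpose_eq_iff)
    then show "x = y" using box_eq[OF t] xy by metis
  qed
  moreover have "swap_tab lam k t (box_of lam t (transpose k (k + 1) m)) = m"
    using b by (simp add: swap_tab_def)
  ultimately show ?thesis using b(1) inv_into_f_eq by metis
qed

lemma swap_tab_twice: "t \<in> Std lam \<Longrightarrow> swap_tab lam k (swap_tab lam k t) = t"
  by (rule extensionalityI[of _ "diagram lam"]) (auto simp: swap_tab_def Std_def)

lemma swap_tab_commute:
  "\<bar>int k - int m\<bar> > 1 \<Longrightarrow> swap_tab lam k (swap_tab lam m t) = swap_tab lam m (swap_tab lam k t)"
  by (auto simp: swap_tab_def transpose_def fun_eq_iff restrict_def)

lemma swap_tab_braid:
  "swap_tab lam k (swap_tab lam (k + 1) (swap_tab lam k t)) =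
   swap_tab lam (k + 1) (swap_tab lam k (swap_tab lam (k + 1) t))"
  by (auto simp: swap_tab_def transpose_def fun_eq_iff restrict_def)

lemma swap_tab_far_iff:
  assumes t: "t \<in> Std lam" "swap_tab lam k t \<in> Std lam"
    and k: "1 \<le> k" "k < n" "1 \<le> m" "m < n" "\<bar>int k - int m\<bar> > 1"
  shows "swap_tab lam m (swap_tab lam k t) \<in> Std lam \<longleftrightarrow> swap_tab lam m t \<in> Std lam"
proof -
  have "m \<noteq> k" "m \<noteq> k + 1" "m + 1 \<noteq> k" using k by auto
  then show ?thesis
    using swap_tab_Std_iff[OF t(1) k(3,4)] swap_tab_Std_iff[OF t(2) k(3,4)]
      box_swap_tab[OF t(1) k(1,2), of m] box_swap_tab[OF t(1) k(1,2), of "m + 1"] k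
    by (simp add: transpose_def)
qed

text \<open>Both sides say that no two of the boxes containing \<open>k\<close>, \<open>k + 1\<close>, \<open>k + 2\<close> are adjacent.\<close>

lemma swap_tab_braid_iff:
  assumes t: "t \<in> Std lam" and k: "1 \<le> k" "k + 1 < n"
  shows "swap_tab lam k t \<in> Std lam \<and> swap_tab lam (k + 1) (swap_tab lam k t) \<in> Std lam \<and>
      swap_tab lam k (swap_tab lam (k + 1) (swap_tab lam k t)) \<in> Std lam \<longleftrightarrow>
    swap_tab lam (k + 1) t \<in> Std lam \<and> swap_tab lam k (swap_tab lam (k + 1) t) \<in> Std lam \<and>
      swap_tab lam (k + 1) (swap_tab lam k (swap_tab lam (k + 1) t)) \<in> Std lam"
    (is "?L1 \<and> ?L2 \<and> ?L3 \<longleftrightarrow> ?R1 \<and> ?R2 \<and> ?R3")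
proof -
  define a b c where "a = box_of lam t k" and "b = box_of lam t (k + 1)" and "c = box_of lam t (k + 2)"
  note box = box_swap_tab
  have L1: "?L1 \<longleftrightarrow> \<not> adj a b" and R1: "?R1 \<longleftrightarrow> \<not> adj b c"
    using swap_tab_Std_iff[OF t, of k] swap_tab_Std_iff[OF t, of "k + 1"] k
    by (simp_all add: a_def b_def c_def)
  have L: "box_of lam (swap_tab lam k t) k = b" "box_of lam (swap_tab lam k t) (k + 1) = a"
      "box_of lam (swap_tab lam k t) (k + 2) = c" if ?L1
    using box[OF t, of k k] box[OF t, of k "k + 1"] box[OF t, of k "k + 2"] k
    by (simp_all add: a_def b_def c_def transpose_def)
  have L2: "?L2 \<longleftrightarrow> \<not> adj a c" if ?L1
    using swap_tab_Std_iff[OF that, of "k + 1"] k L[OF that] by simp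
  have L3: "?L3 \<longleftrightarrow> \<not> adj b c" if 1: ?L1 and 2: ?L2
    using swap_tab_Std_iff[OF 2, of k] k L[OF 1] box[OF 1, of "k + 1" k] box[OF 1, of "k + 1" "k + 1"]
    by (simp add: transpose_def)
  have R: "box_of lam (swap_tab lam (k + 1) t) k = a" "box_of lam (swap_tab lam (k + 1) t) (k + 1) = c"
      "box_of lam (swap_tab lam (k + 1) t) (k + 2) = b" if ?R1
    using box[OF t, of "k + 1" k] box[OF t, of "k + 1" "k + 1"] box[OF t, of "k + 1" "k + 2"] k
    by (simp_all add: a_def b_def c_def transpose_def)
  have R2: "?R2 \<longleftrightarrow> \<not> adj a c" if ?R1
    using swap_tab_Std_iff[OF that, of k] k R[OF that] by simp
  have R3: "?R3 \<longleftrightarrow> \<not> adj a b" if 1: ?R1 and 2: ?R2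
    using swap_tab_Std_iff[OF 2, of "k + 1"] k R[OF 1] box[OF 1, of k "k + 1"] box[OF 1, of k "k + 2"]
    by (simp add: transpose_def)
  show ?thesis using L1 L2 L3 R1 R2 R3 by blast
qed

text \<open>The last exchange takes place in the boxes that contain k + 1 and k + 2 in t, and these
  are not adjacent since \<open>swap_tab lam (k + 1) t\<close> is standard.\<close>

lemma swap_tab_sixth:
  assumes k: "1 \<le> k" "k + 1 < n"
    and five: "{t, swap_tab lam k t, swap_tab lam (k + 1) (swap_tab lam k t), swap_tab lam (k + 1) t,
      swap_tab lam k (swap_tab lam (k + 1) t)} \<subseteq> Std lam"
  shows "swap_tab lam k (swap_tab lam (k + 1) (swap_tab lam k t)) \<in> Std lam"
proof -
  let ?t1 = "swap_tab lam k t"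
  have t: "t \<in> Std lam" "?t1 \<in> Std lam" "swap_tab lam (k + 1) ?t1 \<in> Std lam" "swap_tab lam (k + 1) t \<in> Std lam"
    using five by auto
  have "\<not> adj (box_of lam t (k + 1)) (box_of lam t (k + 2))"
    using swap_tab_Std_iff[OF t(1), of "k + 1"] t(4) k by simp
  moreover have "box_of lam (swap_tab lam (k + 1) ?t1) k = box_of lam t (k + 1)"
      "box_of lam (swap_tab lam (k + 1) ?t1) (k + 1) = box_of lam t (k + 2)"
    using box_swap_tab[OF t(2), of "k + 1" k] box_swap_tab[OF t(2), of "k + 1" "k + 1"]
      box_swap_tab[OF t(1), of k k] box_swap_tab[OF t(1), of k "k + 2"] k
    by (simp_all add: transpose_def)
  ultimately show ?thesis using swap_tab_Std_iff[OF t(3), of k] k by simp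
qed

lemma box_of_one:
  assumes t: "t \<in> Std lam" and n: "1 \<le> n"
  obtains l where "box_of lam t 1 = (l, 1, 1)" "1 \<le> l" "l \<le> length lam"
proof -
  obtain l r c where b: "box_of lam t 1 = (l, r, c)" by (cases "box_of lam t 1") auto
  have D: "(l, r, c) \<in> diagram lam" "t (l, r, c) = 1" using box_in[OF t, of 1] n b by auto
  have "(l, 1, 1) \<in> diagram lam" using diagram_down[OF D(1)] diagram_pos[OF D(1)] by auto
  then have "(r, c) = (1, 1)"
    using Std_nw[OF t, of l 1 1 r c] D diagram_pos[OF D(1)] entry_range[OF t, of "(l, 1, 1)"] by fastforce
  then show thesis using that b diagram_pos[OF D(1)] by auto
qed

text \<open>Two successive adjacent steps cannot turn a corner: k and k + 2 would be opposite
  corners of a 2 x 2 square, and both remaining boxes would have to contain k + 1.\<close>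

lemma chain_boxes:
  assumes t: "t \<in> Std lam" and k: "1 \<le> k" "k + 1 < n"
    and a: "adj (box_of lam t k) (box_of lam t (k + 1))" "adj (box_of lam t (k + 1)) (box_of lam t (k + 2))"
  obtains l r c where "box_of lam t k = (l, r, c)"
    "(box_of lam t (k + 1) = (l, r, c + 1) \<and> box_of lam t (k + 2) = (l, r, c + 2)) \<or>
     (box_of lam t (k + 1) = (l, r + 1, c) \<and> box_of lam t (k + 2) = (l, r + 2, c))"
proof -
  obtain l r c where b: "box_of lam t k = (l, r, c)" by (cases "box_of lam t k") auto
  have D: "box_of lam t k \<in> diagram lam" "box_of lam t (k + 1) \<in> diagram lam"
      "box_of lam t (k + 2) \<in> diagram lam"
    and v: "t (box_of lam t k) = k" "t (box_of lam t (k + 1)) = k + 1" "t (box_of lam t (k + 2)) = k + 2"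
    using box_in[OF t] k by auto
  have pos: "1 \<le> r" "1 \<le> c" using diagram_pos D(1) b by auto
  have no: "box_of lam t (k + 2) \<noteq> (l, r + 1, c + 1)"
  proof
    assume e: "box_of lam t (k + 2) = (l, r + 1, c + 1)"
    have in1: "(l, r + 1, c) \<in> diagram lam" "(l, r, c + 1) \<in> diagram lam"
      using diagram_down[of l "r + 1" "c + 1"] D(3) e pos by auto
    have "t (l, r, c) < t (l, r + 1, c)" "t (l, r + 1, c) < t (l, r + 1, c + 1)"
        "t (l, r, c) < t (l, r, c + 1)" "t (l, r, c + 1) < t (l, r + 1, c + 1)"
      using Std_nw[OF t] in1 D b e by auto
    then have "t (l, r + 1, c) = k + 1" "t (l, r, c + 1) = k + 1" using v b e by auto
    then have "box_of lam t (k + 1) = (l, r + 1, c)" "box_of lam t (k + 1) = (l, r, c + 1)"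
      using box_eq[OF t] in1 by metis+
    then show False by simp
  qed
  show thesis
    by (rule that[OF b]) (use a no b in \<open>auto simp: adj_def split: prod.splits\<close>)
qed

text \<open>At the first entry m placed differently, the two boxes lie on one diagonal of one
  component. In the tableau using the box further down, the upper one already holds an entry less
  than m, which the other tableau then has in that box as well, although it holds m.\<close>

lemma Std_eqI:
  assumes s: "s \<in> Std lam" and t: "t \<in> Std lam"
    and diag: "\<And>m l r c l' r' c'. 1 \<le> m \<Longrightarrow> m \<le> n \<Longrightarrow> box_of lam s m = (l, r, c) \<Longrightarrow>
      box_of lam t m = (l', r', c') \<Longrightarrow> l = l' \<and> int c - int r = int c' - int r'"
  shows "s = t"
proof -
  have box: "box_of lam s m = box_of lam t m" if "1 \<le> m" "m \<le> n" for m
    using that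
  proof (induction m rule: less_induct)
    case (less m)
    have no: False if s: "s \<in> Std lam" and t: "t \<in> Std lam"
        and b: "box_of lam t m = (l, r, c)" "box_of lam s m = (l, r', c')" "r < r'" "int c - int r = int c' - int r'"
        and IH: "\<And>m'. m' < m \<Longrightarrow> 1 \<le> m' \<Longrightarrow> m' \<le> n \<Longrightarrow> box_of lam s m' = box_of lam t m'"
      for s t l r c r' c'
    proof -
      have D: "(l, r, c) \<in> diagram lam" "t (l, r, c) = m" "(l, r', c') \<in> diagram lam" "s (l, r', c') = m"
        using box_in[OF t less.prems] box_in[OF s less.prems] b by auto
      have "s (l, r, c) < m" using Std_nw[OF s D(1,3)] b D by auto
      moreover have "1 \<le> s (l, r, c)" "s (l, r, c) \<le> n" using entry_range[OF s D(1)] by auto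
      ultimately have "box_of lam t (s (l, r, c)) = (l, r, c)" using IH box_eq[OF s D(1)] by metis
      then have "t (l, r, c) = s (l, r, c)"
        using box_in(2)[OF t \<open>1 \<le> s (l, r, c)\<close> \<open>s (l, r, c) \<le> n\<close>] by simp
      then show False using D \<open>s (l, r, c) < m\<close> by simp
    qed
    obtain l r c where b: "box_of lam s m = (l, r, c)" by (cases "box_of lam s m") auto
    obtain l' r' c' where b': "box_of lam t m = (l', r', c')" by (cases "box_of lam t m") auto
    have d: "l = l'" "int c - int r = int c' - int r'" using diag[OF less.prems b b'] by auto
    have IH: "m' < m \<Longrightarrow> 1 \<le> m' \<Longrightarrow> m' \<le> n \<Longrightarrow> box_of lam s m' = box_of lam t m'" for m'
      using less.IH by blast
    have "\<not> r < r'" using no[OF t s] b b' d IH by metis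
    moreover have "\<not> r' < r" using no[OF s t] b b' d IH by metis
    ultimately show ?case using b b' d by auto
  qed
  show ?thesis
  proof (rule extensionalityI[of _ "diagram lam"])
    fix b assume b: "b \<in> diagram lam"
    have r: "1 \<le> t b" "t b \<le> n" using entry_range[OF t b] by auto
    have "box_of lam s (t b) = b" using box[OF r] box_eq[OF t b] by simp
    then show "s b = t b" using box_in(2)[OF s r] by simp
  qed (use s t in \<open>auto simp: Std_def\<close>)
qed

section \<open>Descents and the row reading tableau\<close>

definition desc :: "nat \<Rightarrow> (box \<Rightarrow> nat) \<Rightarrow> bool" where
  "desc k t \<longleftrightarrow> 1 \<le> k \<and> k < n \<and> box_of lam t (k + 1) < box_of lam t k"

definition row_tab :: "box \<Rightarrow> nat" where
  "row_tab = (\<lambda>b\<in>diagram lam. card {b' \<in> diagram lam. b' \<le> b})"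

lemma desc_Std: "t \<in> Std lam \<Longrightarrow> desc k t \<Longrightarrow> swap_tab lam k t \<in> Std lam"
  using swap_tab_Std_iff adj_less unfolding desc_def by (metis less_asym)

lemma row_tab_less:
  assumes "b \<in> diagram lam" "b' \<in> diagram lam" "b < b'"
  shows "row_tab b < row_tab b'"
proof -
  have "{x \<in> diagram lam. x \<le> b} \<subset> {x \<in> diagram lam. x \<le> b'}"
  proof
    show "{x \<in> diagram lam. x \<le> b} \<subseteq> {x \<in> diagram lam. x \<le> b'}"
      using assms(3) by (blast intro: order_trans less_imp_le)
    have "b' \<in> {x \<in> diagram lam. x \<le> b'}" "b' \<notin> {x \<in> diagram lam. x \<le> b}"
      using assms by (simp_all only: mem_Collect_eq order_refl simp_thms not_le)
    then show "{x \<in> diagram lam. x \<le> b} \<noteq> {x \<in> diagram lam. x \<le> b'}" by metis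
  qed
  then have "card {x \<in> diagram lam. x \<le> b} < card {x \<in> diagram lam. x \<le> b'}"
    using finite_diagram by (intro psubset_card_mono) auto
  then show ?thesis using assms by (simp add: row_tab_def)
qed

lemma row_tab_le: "b \<in> diagram lam \<Longrightarrow> row_tab b \<le> n"
  unfolding row_tab_def size[symmetric] by (auto intro!: card_mono finite_diagram)

lemma row_tab_Std: "row_tab \<in> Std lam"
proof -
  have inj: "inj_on row_tab (diagram lam)"
    using row_tab_less by (intro linorder_inj_onI') force
  have "1 \<le> row_tab b" if b: "b \<in> diagram lam" for b
  proof -
    have "card {b} \<le> card {x \<in> diagram lam. x \<le> b}"
      using b finite_diagram by (intro card_mono) auto
    then show ?thesis using b by (simp add: row_tab_def)
  qed
  then have "row_tab ` diagram lam \<subseteq> {1..n}" using row_tab_le by auto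
  then have "row_tab ` diagram lam = {1..n}"
    using inj by (intro card_subset_eq) (auto simp: card_image size)
  then show ?thesis
    using inj row_tab_less by (auto simp: Std_def size bij_betw_def row_tab_def[THEN fun_cong] extensional_def)
qed

text \<open>Without descents the boxes of 1, ..., n increase, so the entry of a box counts the boxes
  up to it.\<close>

lemma no_desc_row_tab:
  assumes t: "t \<in> Std lam" and nd: "\<And>k. \<not> desc k t"
  shows "t = row_tab"
proof (rule extensionalityI[of _ "diagram lam"])
  have step: "box_of lam t k < box_of lam t (k + 1)" if "1 \<le> k" "k < n" for k
  proof -
    have "box_of lam t k \<noteq> box_of lam t (k + 1)"
    proof
      assume "box_of lam t k = box_of lam t (k + 1)"
      then have "k = k + 1" using that by (intro box_inj[OF t]) auto
      then show False by simp
    qed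
    then show ?thesis using nd[of k] that by (metis desc_def linorder_less_linear)
  qed
  have mono: "box_of lam t i < box_of lam t j" if "i < j" "1 \<le> i" "j \<le> n" for i j
    using that
  proof (induction j)
    case (Suc j)
    show ?case
    proof (cases "i = j")
      case True then show ?thesis using step[of j] Suc by simp
    next
      case False
      then have "box_of lam t i < box_of lam t j" using Suc by simp
      also have "\<dots> < box_of lam t (Suc j)" using step[of j] Suc False by simp
      finally show ?thesis .
    qed
  qed simp
  fix b assume b: "b \<in> diagram lam"
  have le: "b' \<le> b \<longleftrightarrow> t b' \<le> t b" if b': "b' \<in> diagram lam" for b'
    using mono[of "t b'" "t b"] mono[of "t b" "t b'"] entry_range[OF t b] entry_range[OF t b'] box_eq[OF t b] box_eq[OF t b']
    by (metis leD le_less_linear less_imp_le nat_neq_iff order_refl)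
  have "t ` {b' \<in> diagram lam. b' \<le> b} = {1..t b}"
  proof
    show "t ` {b' \<in> diagram lam. b' \<le> b} \<subseteq> {1..t b}" using le entry_range[OF t] by auto
    show "{1..t b} \<subseteq> t ` {b' \<in> diagram lam. b' \<le> b}"
    proof
      fix m assume m: "m \<in> {1..t b}"
      then have "1 \<le> m" "m \<le> n" using entry_range[OF t b] by auto
      note bm = box_in[OF t this]
      then show "m \<in> t ` {b' \<in> diagram lam. b' \<le> b}"
        using le[OF bm(1)] m by (intro image_eqI[of _ _ "box_of lam t m"]) auto
    qed
  qed
  moreover have "inj_on t {b' \<in> diagram lam. b' \<le> b}"
    using Std_bij[OF t] by (auto simp: bij_betw_def intro: inj_on_subset)
  ultimately have "card {b' \<in> diagram lam. b' \<le> b} = card {1..t b}" using card_image by fastforce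
  then show "t b = row_tab b" using b by (simp add: row_tab_def)
qed (use t in \<open>auto simp: Std_def row_tab_def\<close>)

text \<open>A rearrangement sum: the weights \<open>n - row_tab b\<close> decrease along the reading
  order and, as \<open>row_tab b\<close> is at most n, without truncation. Removing a descent moves
  the larger of two entries to the smaller weight.\<close>

definition height :: "(box \<Rightarrow> nat) \<Rightarrow> nat" where
  "height t = (\<Sum>b\<in>diagram lam. t b * (n - row_tab b))"

lemma height_desc:
  assumes t: "t \<in> Std lam" and d: "desc k t"
  shows "height (swap_tab lam k t) < height t"
proof -
  define a b where "a = box_of lam t k" and "b = box_of lam t (k + 1)"
  have k: "1 \<le> k" "k < n" and ba: "b < a" using d by (auto simp: desc_def a_def b_def)
  have ab: "a \<in> diagram lam" "b \<in> diagram lam" "t a = k" "t b = k + 1"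
    using box_in[OF t] k by (auto simp: a_def b_def)
  have eq: "(\<Sum>x\<in>diagram lam. f x) = f a + f b + (\<Sum>x\<in>diagram lam - {a} - {b}. f x)" for f :: "box \<Rightarrow> nat"
  proof -
    have "b \<in> diagram lam - {a}" using ab ba by auto
    then have "(\<Sum>x\<in>diagram lam - {a}. f x) = f b + (\<Sum>x\<in>diagram lam - {a} - {b}. f x)"
      using finite_diagram by (intro sum.remove) auto
    then show ?thesis using sum.remove[OF finite_diagram ab(1), of f] by simp
  qed
  have other: "swap_tab lam k t x = t x" if "x \<in> diagram lam - {a} - {b}" for x
  proof -
    have "t x \<noteq> k" "t x \<noteq> k + 1" using that ab box_eq[OF t] by (metis Diff_iff insertCI)+
    then show ?thesis using that by (simp add: swap_tab_def transpose_def)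
  qed
  have "n - row_tab a < n - row_tab b"
    using row_tab_less[OF ab(2,1) ba] row_tab_le[OF ab(1)] by linarith
  then show ?thesis
    unfolding height_def eq using other ab by (simp add: swap_tab_def transpose_def)
qed

lemma row_tab_no_desc: "\<not> desc k row_tab"
proof
  assume d: "desc k row_tab"
  then have k: "1 \<le> k" "k + 1 \<le> n" by (auto simp: desc_def)
  then have "row_tab (box_of lam row_tab (k + 1)) < row_tab (box_of lam row_tab k)"
    using d box_in(1)[OF row_tab_Std] by (intro row_tab_less) (auto simp: desc_def)
  then show False using box_in(2)[OF row_tab_Std] k by simp
qed

text \<open>Removing descents leads from a member of N to the row reading tableau; the same route
  from an arbitrary tableau is then followed backwards, each exchange being its own inverse.\<close>

lemma Std_connected:
  assumes N: "N \<subseteq> Std lam" "N \<noteq> {}"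
    and closed: "\<And>t k. t \<in> N \<Longrightarrow> 1 \<le> k \<Longrightarrow> k < n \<Longrightarrow> swap_tab lam k t \<in> Std lam \<Longrightarrow> swap_tab lam k t \<in> N"
  shows "N = Std lam"
proof -
  have down: "row_tab \<in> N" if "t \<in> N" for t
    using that
  proof (induction "height t" arbitrary: t rule: less_induct)
    case less
    have t: "t \<in> Std lam" using less N by blast
    show ?case
    proof (cases "\<exists>k. desc k t")
      case True
      then obtain k where k: "desc k t" by blast
      have "swap_tab lam k t \<in> N"
        using closed[OF less.prems] desc_Std[OF t k] k by (auto simp: desc_def)
      then show ?thesis using less.hyps height_desc[OF t k] by blast
    next
      case False then show ?thesis using no_desc_row_tab[OF t] less by metis
    qed
  qed
  have up: "s \<in> N" if "s \<in> Std lam" for s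
    using that
  proof (induction "height s" arbitrary: s rule: less_induct)
    case less
    show ?case
    proof (cases "\<exists>k. desc k s")
      case True
      then obtain k where k: "desc k s" by blast
      have "swap_tab lam k s \<in> N"
        using less.hyps height_desc[OF less.prems k] desc_Std[OF less.prems k] by blast
      then show ?thesis
        using closed[of "swap_tab lam k s" k] k swap_tab_twice[OF less.prems, of k] less.prems
        by (auto simp: desc_def)
    next
      case False
      then show ?thesis using no_desc_row_tab[OF less.prems] down N by blast
    qed
  qed
  then show ?thesis using N by blast
qed

lemma finite_Std: "finite (Std lam)"
proof (rule finite_subset)
  show "Std lam \<subseteq> (\<Pi>\<^sub>E b\<in>diagram lam. {1..n})"
  proof
    fix t assume t: "t \<in> Std lam"
    then have "t \<in> extensional (diagram lam)" by (simp add: Std_def)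
    then show "t \<in> (\<Pi>\<^sub>E b\<in>diagram lam. {1..n})" using entry_range[OF t] by (simp add: PiE_iff)
  qed
qed (auto intro: finite_PiE finite_diagram)

lemma Std_degree:
  fixes w :: "nat \<Rightarrow> (box \<Rightarrow> nat) \<Rightarrow> int"
  assumes anti: "\<And>t k. t \<in> Std lam \<Longrightarrow> 1 \<le> k \<Longrightarrow> k < n \<Longrightarrow> swap_tab lam k t \<in> Std lam \<Longrightarrow>
      w k (swap_tab lam k t) = - w k t"
    and square: "\<And>t k m. t \<in> Std lam \<Longrightarrow> 1 \<le> k \<Longrightarrow> k < n \<Longrightarrow> 1 \<le> m \<Longrightarrow> m < n \<Longrightarrow> \<bar>int k - int m\<bar> > 1 \<Longrightarrow>
      swap_tab lam k t \<in> Std lam \<Longrightarrow> swap_tab lam m t \<in> Std lam \<Longrightarrow>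
      w k t + w m (swap_tab lam k t) = w m t + w k (swap_tab lam m t)"
    and hexagon: "\<And>t k. 1 \<le> k \<Longrightarrow> k + 1 < n \<Longrightarrow>
      {t, swap_tab lam k t, swap_tab lam (k + 1) (swap_tab lam k t), swap_tab lam (k + 1) t,
        swap_tab lam k (swap_tab lam (k + 1) t)} \<subseteq> Std lam \<Longrightarrow>
      w k t + w (k + 1) (swap_tab lam k t) + w k (swap_tab lam (k + 1) (swap_tab lam k t)) =
      w (k + 1) t + w k (swap_tab lam (k + 1) t) + w (k + 1) (swap_tab lam k (swap_tab lam (k + 1) t))"
  obtains deg :: "(box \<Rightarrow> nat) \<Rightarrow> int" where
    "\<And>t k. t \<in> Std lam \<Longrightarrow> 1 \<le> k \<Longrightarrow> k < n \<Longrightarrow> swap_tab lam k t \<in> Std lam \<Longrightarrow>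
      deg t = deg (swap_tab lam k t) + w k t"
proof -
  \<comment> \<open>Only descents become edges, which makes the system terminate; an exchange that
    is not a descent is the reverse of one and is recovered at the end from
    \<open>anti\<close>.\<close>
  define E where "E t x u \<longleftrightarrow> (\<exists>k. desc k t \<and> u = swap_tab lam k t \<and> x = w k t)" for t x u
  have box: "box_of lam (swap_tab lam k t) m = box_of lam t (transpose k (k + 1) m)"
    if "t \<in> Std lam" "desc k t" "1 \<le> m" "m \<le> n" for k t m
    using box_swap_tab[OF that(1)] that by (auto simp: desc_def)
  have E: "E t (w k t) (swap_tab lam k t)" if "desc k t" for k t using that by (auto simp: E_def)
  have path1: "wpath E t (w k t) (swap_tab lam k t)" if "desc k t" for k t
    using wpath.edge[OF E[OF that] wpath.empty[of E "swap_tab lam k t"]] by simp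
  have path2: "wpath E t (w k t + w m (swap_tab lam k t)) (swap_tab lam m (swap_tab lam k t))"
    if "desc k t" "desc m (swap_tab lam k t)" for k m t
    by (rule wpath.edge[OF E[OF that(1)] path1[OF that(2)]])
  \<comment> \<open>Descents at k and k + 1 put the boxes of k, k + 1, k + 2 in decreasing order, so
    all six sides of the hexagon are descents and its two halves end in the same tableau.\<close>
  have hex: "\<exists>s p1 p2. wpath E (swap_tab lam k t) p1 s \<and> wpath E (swap_tab lam (k + 1) t) p2 s \<and>
      w k t + p1 = w (k + 1) t + p2" if t: "t \<in> Std lam" and d: "desc k t" "desc (k + 1) t" for t k
  proof -
    have k: "1 \<le> k" "k + 1 < n" using d by (auto simp: desc_def)
    let ?t1 = "swap_tab lam k t" and ?t2 = "swap_tab lam (k + 1) t"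
    have lt: "box_of lam t (k + 1) < box_of lam t k" "box_of lam t (k + 2) < box_of lam t (k + 1)"
      using d by (auto simp: desc_def)
    have S: "?t1 \<in> Std lam" "?t2 \<in> Std lam" using desc_Std[OF t] d by auto
    have d1: "desc (k + 1) ?t1"
      using k lt box[OF t d(1), of "k + 1"] box[OF t d(1), of "k + 2"] by (auto simp: desc_def transpose_def)
    have d2: "desc k ?t2"
      using k lt box[OF t d(2), of "k + 1"] box[OF t d(2), of k] by (auto simp: desc_def transpose_def)
    have S': "swap_tab lam (k + 1) ?t1 \<in> Std lam" "swap_tab lam k ?t2 \<in> Std lam"
      using desc_Std S d1 d2 by auto
    have d1': "desc k (swap_tab lam (k + 1) ?t1)"
      using k lt box[OF S(1) d1, of k] box[OF S(1) d1, of "k + 1"]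
        box[OF t d(1), of k] box[OF t d(1), of "k + 2"] by (auto simp: desc_def transpose_def)
    have d2': "desc (k + 1) (swap_tab lam k ?t2)"
      using k lt box[OF S(2) d2, of "k + 1"] box[OF S(2) d2, of "k + 2"]
        box[OF t d(2), of k] box[OF t d(2), of "k + 2"] by (auto simp: desc_def transpose_def)
    have "w k t + (w (k + 1) ?t1 + w k (swap_tab lam (k + 1) ?t1)) =
        w (k + 1) t + (w k ?t2 + w (k + 1) (swap_tab lam k ?t2))"
      using hexagon[OF k, of t] t S S' by (simp add: add.assoc)
    then show ?thesis
      using path2[OF d1 d1'] path2[OF d2 d2'] swap_tab_braid[of k t] by metis
  qed
  have "\<exists>deg. \<forall>t\<in>Std lam. \<forall>x u. E t x u \<longrightarrow> deg t = deg u + x"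
  proof (rule potential_exists[where \<mu> = height and ?t0.0 = row_tab])
    fix t x u assume "t \<in> Std lam" "E t x u"
    then show "u \<in> Std lam \<and> height u < height t" using desc_Std height_desc by (auto simp: E_def)
  next
    fix t assume "t \<in> Std lam" "t \<noteq> row_tab"
    then show "\<exists>x u. E t x u" using no_desc_row_tab by (auto simp: E_def)
  next
    fix x u show "\<not> E row_tab x u" using row_tab_no_desc by (auto simp: E_def)
  next
    fix t x1 u1 x2 u2 assume t: "t \<in> Std lam" and e: "E t x1 u1" "E t x2 u2"
    then obtain k m where k: "desc k t" "u1 = swap_tab lam k t" "x1 = w k t"
      and m: "desc m t" "u2 = swap_tab lam m t" "x2 = w m t" by (auto simp: E_def)
    have kn: "1 \<le> k" "k < n" "1 \<le> m" "m < n" using k m by (auto simp: desc_def)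
    consider "k = m" | "m = k + 1" | "k = m + 1" | "\<bar>int k - int m\<bar> > 1" by linarith
    then show "\<exists>s p1 p2. wpath E u1 p1 s \<and> wpath E u2 p2 s \<and> x1 + p1 = x2 + p2"
    proof cases
      case 1 then show ?thesis using k m wpath.empty by metis
    next
      case 2 then show ?thesis using hex[OF t, of k] k m by metis
    next
      case 3 then show ?thesis using hex[OF t, of m] k m by metis
    next
      case 4
      have "desc m (swap_tab lam k t)"
        using 4 kn m box[OF t k(1), of m] box[OF t k(1), of "m + 1"] by (auto simp: desc_def transpose_def)
      moreover have "desc k (swap_tab lam m t)"
        using 4 kn k box[OF t m(1), of k] box[OF t m(1), of "k + 1"] by (auto simp: desc_def transpose_def)
      moreover have "w k t + w m (swap_tab lam k t) = w m t + w k (swap_tab lam m t)"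
        using square[OF t kn 4] desc_Std[OF t] k m by auto
      ultimately show ?thesis using path1 k m swap_tab_commute[OF 4, of t] by metis
    qed
  qed
  then obtain deg where "\<forall>t\<in>Std lam. \<forall>x u. E t x u \<longrightarrow> deg t = deg u + x" by blast
  then have deg: "deg t = deg (swap_tab lam k t) + w k t" if "t \<in> Std lam" "desc k t" for t k
    using that E by blast
  show thesis
  proof (rule that)
    fix t k assume t: "t \<in> Std lam" and k: "1 \<le> k" "k < n" and s: "swap_tab lam k t \<in> Std lam"
    show "deg t = deg (swap_tab lam k t) + w k t"
    proof (cases "desc k t")
      case True then show ?thesis using deg t by blast
    next
      case False
      have "box_of lam t k \<noteq> box_of lam t (k + 1)" using box_inj[OF t, of k "k + 1"] k by auto
      then have "desc k (swap_tab lam k t)"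
        using False k box_swap_tab[OF t k, of k] box_swap_tab[OF t k, of "k + 1"]
        by (auto simp: desc_def transpose_def)
      then show ?thesis using deg[OF s] swap_tab_twice[OF t, of k] anti[OF t k s] by simp
    qed
  qed
qed

section \<open>Residues and contents along a tableau\<close>

lemma at_entry_swap_tab:
  assumes "t \<in> Std lam" "1 \<le> k" "k < n" "1 \<le> m" "m \<le> n"
  shows "at_entry lam f (swap_tab lam k t) m = at_entry lam f t (transpose k (k + 1) m)"
  using assms by (simp add: at_entry_def box_swap_tab)

lemma length_residue_seq [simp]: "length (residue_seq lam n res t) = n"
  by (simp add: residue_seq_def)

lemma ent_residue_seq:
  "1 \<le> m \<Longrightarrow> m \<le> n \<Longrightarrow> ent (residue_seq lam n res t) m = at_entry lam res t m"
  by (simp add: residue_seq_def ent_def del: upt_Suc)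

text \<open>The right-hand side does not involve t: all standard tableaux of one shape belong to one
  block.\<close>

lemma mset_residue_seq:
  assumes t: "t \<in> Std lam"
  shows "mset (residue_seq lam n res t) =
    image_mset (\<lambda>(k, r, c). res k (int c - int r)) (mset_set (diagram lam))"
proof -
  have bij: "bij_betw (inv_into (diagram lam) t) {1..n} (diagram lam)"
    by (rule bij_betw_inv_into[OF Std_bij[OF t]])
  have "mset (residue_seq lam n res t) = image_mset (at_entry lam res t) (mset_set {1..n})"
    by (simp add: residue_seq_def atLeastLessThanSuc_atLeastAtMost del: upt_Suc)
  also have "\<dots> = image_mset (\<lambda>(k, r, c). res k (int c - int r))
      (image_mset (inv_into (diagram lam) t) (mset_set {1..n}))"
    by (simp add: image_mset.compositionality comp_def at_entry_def[abs_def])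
  also have "image_mset (inv_into (diagram lam) t) (mset_set {1..n}) = mset_set (diagram lam)"
    using bij by (simp add: image_mset_mset_set bij_betw_def)
  finally show ?thesis .
qed

end

section \<open>Seminormal representations from content systems\<close>

lemma poly_homog_laurent: "f \<in> poly_homog X d \<Longrightarrow> f \<in> laurent_homog X d"
  by (simp add: poly_homog_def)

lemma poly_ring_laurent: "f \<in> poly_ring X \<Longrightarrow> f \<in> laurent_ring X"
  by (simp add: poly_ring_def)

text \<open>There are at most two factors, each with leading coefficient -1, so the product is 1 or
  has leading coefficient 1 or -1.\<close>

lemma linear_factors_nonzero:
  assumes "a \<noteq> b"
  shows "(\<Prod>x\<in>{x \<in> {a, b}. P x}. [:f x, - 1:]) = (0 :: 'a::comm_ring_1 poly) \<Longrightarrow> False"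
proof -
  assume 0: "(\<Prod>x\<in>{x \<in> {a, b}. P x}. [:f x, - 1:]) = (0 :: 'a poly)"
  have "{x \<in> {a, b}. P x} = (if P a then if P b then {a, b} else {a} else if P b then {b} else {})"
    by auto
  then show False using 0 assms by (auto split: if_splits)
qed

locale content_data =
  fixes X :: "'x set"
    and D :: "('i, ('x, 'k::idom) laurent) klr_datum"
    and \<rho> :: "'i list"
    and n :: nat
    and con :: "nat \<Rightarrow> int \<Rightarrow> ('x, 'k) laurent"
    and res :: "nat \<Rightarrow> int \<Rightarrow> 'i"
    and lam :: "nat list list"
    and \<beta> :: "nat \<Rightarrow> (box \<Rightarrow> nat) \<Rightarrow> ('x, 'k) laurent"
  assumes datum: "klr_datum_over (poly_ring X) (poly_homog X) D"
    and content: "content_system X D \<rho> n con res"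
    and lam: "lam \<in> multipartitions (length \<rho>) n"
    and beta: "\<And>k t. 1 \<le> k \<Longrightarrow> k < n \<Longrightarrow> t \<in> Std lam \<Longrightarrow> swap_tab lam k t \<in> Std lam \<Longrightarrow>
      \<beta> k t \<in> laurent_ring X"
    and beta_quadratic: "\<And>k t. 1 \<le> k \<Longrightarrow> k < n \<Longrightarrow> t \<in> Std lam \<Longrightarrow> swap_tab lam k t \<in> Std lam \<Longrightarrow>
      is_Q D lam con res k t (\<beta> k (swap_tab lam k t) * \<beta> k t)"
    and beta_commute: "\<And>k l t. 1 \<le> k \<Longrightarrow> k < n \<Longrightarrow> 1 \<le> l \<Longrightarrow> l < n \<Longrightarrow> \<bar>int k - int l\<bar> \<noteq> 1 \<Longrightarrow>
      t \<in> Std lam \<Longrightarrow> swap_tab lam k t \<in> Std lam \<Longrightarrow> swap_tab lam l t \<in> Std lam \<Longrightarrow>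
      \<beta> k t * \<beta> l (swap_tab lam k t) = \<beta> l t * \<beta> k (swap_tab lam l t)"
    and beta_braid: "\<And>k t. 1 \<le> k \<Longrightarrow> k + 1 < n \<Longrightarrow>
      {t, swap_tab lam k t, swap_tab lam (k + 1) (swap_tab lam k t), swap_tab lam (k + 1) t,
        swap_tab lam k (swap_tab lam (k + 1) t)} \<subseteq> Std lam \<Longrightarrow>
      \<beta> k (swap_tab lam (k + 1) (swap_tab lam k t)) * \<beta> (k + 1) (swap_tab lam k t) * \<beta> k t =
      \<beta> (k + 1) (swap_tab lam k (swap_tab lam (k + 1) t)) * \<beta> k (swap_tab lam (k + 1) t) * \<beta> (k + 1) t"
begin

sublocale shape lam n
  by unfold_locales (use lam card_diagram[OF lam] in \<open>auto simp: multipartitions_def\<close>)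

abbreviation A :: "('x, 'k) laurent set" where "A \<equiv> laurent_ring X"
abbreviation s :: "nat \<Rightarrow> (box \<Rightarrow> nat) \<Rightarrow> box \<Rightarrow> nat" where "s \<equiv> swap_tab lam"
abbreviation c :: "(box \<Rightarrow> nat) \<Rightarrow> nat \<Rightarrow> ('x, 'k) laurent" where "c t k \<equiv> at_entry lam con t k"
abbreviation r :: "(box \<Rightarrow> nat) \<Rightarrow> nat \<Rightarrow> 'i" where "r t k \<equiv> at_entry lam res t k"
abbreviation rs :: "(box \<Rightarrow> nat) \<Rightarrow> 'i list" where "rs \<equiv> residue_seq lam n res"

definition \<alpha> :: "'i multiset" where
  "\<alpha> = image_mset (\<lambda>(k, r, c). res k (int c - int r)) (mset_set (diagram lam))"

text \<open>The coefficient of the value at \<open>s k t\<close> in the value at \<open>t\<close> of \<open>\<psi>\<^sub>k v\<close>.\<close>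

definition B :: "nat \<Rightarrow> (box \<Rightarrow> nat) \<Rightarrow> ('x, 'k) laurent" where
  "B k t = (if s k t \<in> Std lam then \<beta> k (s k t) else 0)"

lemma size_\<alpha> [simp]: "size \<alpha> = n"
  by (simp add: \<alpha>_def size)

lemma mset_rs: "t \<in> Std lam \<Longrightarrow> mset (rs t) = \<alpha>"
  by (simp add: mset_residue_seq \<alpha>_def)

lemma length_lam: "length lam = length \<rho>"
  using lam by (simp add: multipartitions_def)

lemma Q_diag: "Qpol D i i = 0"
  using datum by (simp add: klr_datum_over_def)

lemma Q_sym: "coeff2 (Qpol D i j) p q = coeff2 (Qpol D j i) q p"
  using datum unfolding klr_datum_over_def by blast

lemma Q_eval_sym: "eval2 (Qpol D i j) x y = eval2 (Qpol D j i) y x"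
  by (rule eval2_sym) (rule Q_sym)

lemma Q_homog: "i \<noteq> j \<Longrightarrow> coeff2 (Qpol D i j) p q \<in>
    laurent_homog X (- 2 * root_form D i j - int p * root_form D i i - int q * root_form D j j)"
  using datum poly_homog_laurent unfolding klr_datum_over_def by blast

lemma Q_A: "coeff2 (Qpol D i j) p q \<in> A"
  using Q_homog[of i j p q] Q_diag[of i] coeff_ring.zero_A[OF coeff_ring_laurent, of X]
  by (cases "i = j") (auto simp: laurent_homog_iff coeff2_def)

lemma W_A: "coeff (Wpol D i) p \<in> A"
proof (cases "p \<le> degree (Wpol D i)")
  case True
  then have "coeff (Wpol D i) p \<in> poly_homog X (2 * int (symm D i) * (int (degree (Wpol D i)) - int p))"
    using datum by (simp add: klr_datum_over_def)
  then show ?thesis by (auto simp: poly_homog_def poly_ring_laurent)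
next
  case False
  then show ?thesis using coeff_ring.zero_A[OF coeff_ring_laurent, of X] by (simp add: coeff_eq_0)
qed

lemma con_A: "1 \<le> l \<Longrightarrow> l \<le> length \<rho> \<Longrightarrow> con l a \<in> A"
  using content by (auto simp: content_system_def Let_def intro: poly_ring_laurent)

lemma con_inj:
  assumes "1 \<le> l" "l \<le> length \<rho>" "1 \<le> l'" "l' \<le> length \<rho>"
    "- int n < a" "a < int n" "- int n < a'" "a' < int n" "res l a = res l' a'" "con l a = con l' a'"
  shows "l = l' \<and> a = a'"
proof -
  have "\<forall>k \<in> {1..length \<rho>}. \<forall>l \<in> {1..length \<rho>}. \<forall>a b.
      - int n < a \<and> a < int n \<and> - int n < b \<and> b < int n \<longrightarrow>
      ((res k a, con k a) = (res l b, con l b) \<longleftrightarrow> (k, a) = (l, b))"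
    using content unfolding content_system_def Let_def by (elim conjE)
  then have "(res l a, con l a) = (res l' a', con l' a') \<longleftrightarrow> (l, a) = (l', a')"
    using assms(1-8) by (meson atLeastAtMost_iff)
  then show ?thesis using assms(9,10) by simp
qed

lemma W_root:
  assumes "1 \<le> l" "l \<le> length \<rho>"
  shows "poly (Wpol D (res l 0)) (con l 0) = 0"
proof -
  have W: "Wpol D (res l 0) = (\<Prod>l' \<in> {l' \<in> {1..length \<rho>}. ent \<rho> l' = res l 0}. [:- con l' 0, 1:])"
    and "res l 0 = ent \<rho> l"
    using content assms by (auto simp: content_system_def Let_def)
  then show ?thesis using assms unfolding W poly_prod by (intro prod_zero) auto
qed

text \<open>One of the linear factors prescribed by the content system vanishes at
  \<open>con l b\<close>. Equal residues would make the Q-polynomial zero, whereas a unit times a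
  product of such factors is not.\<close>

lemma neighbour:
  assumes l: "1 \<le> l" "l \<le> length \<rho>" and b: "b = a - 1 \<or> b = a + 1"
  shows "res l a \<noteq> res l b" "eval2 (Qpol D (res l a) (res l b)) (con l a) (con l b) = 0"
proof -
  let ?P = "\<Prod>b' \<in> {b' \<in> {a - 1, a + 1}. res l b' = res l b}. [:con l b', - 1:]"
  obtain \<epsilon> :: 'k where eps: "\<epsilon> dvd 1"
    and Q: "eval_fst (Qpol D (res l a) (res l b)) (con l a) =
      Polynomial.smult (Poly_Mapping.single 0 (Fract \<epsilon> 1)) ?P"
  proof -
    have "\<forall>k \<in> {1..length \<rho>}. \<forall>a. \<forall>j \<in> {res k (a - 1), res k (a + 1)}. \<exists>\<epsilon>::'k. \<epsilon> dvd 1 \<and>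
        eval_fst (Qpol D (res k a) j) (con k a) = Polynomial.smult (Poly_Mapping.single 0 (Fract \<epsilon> 1))
          (\<Prod>b \<in> {b \<in> {a - 1, a + 1}. res k b = j}. [:con k b, - 1:])"
      using content unfolding content_system_def Let_def by (elim conjE)
    moreover have "l \<in> {1..length \<rho>}" "res l b \<in> {res l (a - 1), res l (a + 1)}" using l b by auto
    ultimately show thesis using that by blast
  qed
  have "b \<in> {b' \<in> {a - 1, a + 1}. res l b' = res l b}" using b by auto
  then have "poly ?P (con l b) = 0" unfolding poly_prod by (intro prod_zero) auto
  then show "eval2 (Qpol D (res l a) (res l b)) (con l a) (con l b) = 0" by (simp add: eval2_def Q)
  show "res l a \<noteq> res l b"
  proof
    assume "res l a = res l b"
    then have 0: "Polynomial.smult (Poly_Mapping.single 0 (Fract \<epsilon> 1)) ?P = 0"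
      using Q Q_diag by (simp add: eval_fst_def)
    obtain \<epsilon>' where "\<epsilon> * \<epsilon>' = 1" using eps by (auto simp: dvd_def)
    then have "Poly_Mapping.single 0 (Fract \<epsilon>' 1) * Poly_Mapping.single 0 (Fract \<epsilon> 1) = (1 :: ('x, 'k) laurent)"
      by (simp add: mult_single mult.commute One_fract_def[symmetric])
    then have "?P = 0"
      using arg_cong[OF 0, of "Polynomial.smult (Poly_Mapping.single 0 (Fract \<epsilon>' 1))"] by simp
    then show False using linear_factors_nonzero[of "a - 1" "a + 1"] by auto
  qed
qed

lemma at_box:
  assumes t: "t \<in> Std lam" and m: "1 \<le> m" "m \<le> n"
  obtains l x y where "box_of lam t m = (l, x, y)" "(l, x, y) \<in> diagram lam" "1 \<le> l" "l \<le> length \<rho>"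
    "- int n < int y - int x" "int y - int x < int n"
    "r t m = res l (int y - int x)" "c t m = con l (int y - int x)"
proof -
  obtain l x y where b: "box_of lam t m = (l, x, y)" by (cases "box_of lam t m") auto
  then have D: "(l, x, y) \<in> diagram lam" using box_in(1)[OF t m] by simp
  show thesis
    using that[OF b D] diagram_pos[OF D] diagram_bound[OF D] b by (simp add: length_lam at_entry_def)
qed

lemma adjacent_swap:
  assumes t: "t \<in> Std lam" and k: "1 \<le> k" "k < n" and nS: "s k t \<notin> Std lam"
  shows "r t k \<noteq> r t (k + 1)" "eval2 (Qpol D (r t k) (r t (k + 1))) (c t k) (c t (k + 1)) = 0"
proof -
  have adj: "adj (box_of lam t k) (box_of lam t (k + 1))" using nS swap_tab_Std_iff[OF t k] by simp
  obtain l x y where b: "box_of lam t k = (l, x, y)" by (cases "box_of lam t k") auto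
  have D: "(l, x, y) \<in> diagram lam" using box_in(1)[OF t, of k] k b by simp
  then have l: "1 \<le> l" "l \<le> length \<rho>" using diagram_pos length_lam by auto
  obtain a where a: "a = (int y - int x) - 1 \<or> a = (int y - int x) + 1"
    and at: "at_entry lam res t (k + 1) = res l a" "at_entry lam con t (k + 1) = con l a"
  proof -
    consider "box_of lam t (k + 1) = (l, x, y + 1)" | "box_of lam t (k + 1) = (l, x + 1, y)"
      using adj unfolding b adj_def by auto
    then show thesis
    proof cases
      case 1
      then show thesis by (intro that[of "int y - int x + 1"]) (auto simp: at_entry_def algebra_simps)
    next
      case 2
      then show thesis by (intro that[of "int y - int x - 1"]) (auto simp: at_entry_def algebra_simps)
    qed
  qed
  have "at_entry lam res t k = res l (int y - int x)" "at_entry lam con t k = con l (int y - int x)"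
    by (simp_all add: at_entry_def b)
  then show "r t k \<noteq> r t (k + 1)" "eval2 (Qpol D (r t k) (r t (k + 1))) (c t k) (c t (k + 1)) = 0"
    using neighbour[OF l a] at by auto
qed

text \<open>Equal residues exclude adjacent boxes, so the exchange is standard and condition (a)
  applies. As Q_ii = 0, it says that the product of the two scalars times the squared difference is
  -1, which exhibits an inverse of the difference.\<close>

lemma inverse_difference:
  assumes t: "t \<in> Std lam" and k: "1 \<le> k" "k < n" and eq: "r t k = r t (k + 1)"
  shows "s k t \<in> Std lam"
    and "- (\<beta> k (s k t) * \<beta> k t) * (c t (k + 1) - c t k) \<in> A"
    and "(c t (k + 1) - c t k) * (- (\<beta> k (s k t) * \<beta> k t) * (c t (k + 1) - c t k)) = 1"
proof -
  interpret coeff_ring A by (rule coeff_ring_laurent)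
  show S: "s k t \<in> Std lam" using adjacent_swap(1)[OF t k] eq by blast
  have c: "c t k \<in> A" "c t (k + 1) \<in> A"
    using at_box[OF t, of k] at_box[OF t, of "k + 1"] k con_A by (metis less_imp_le le_add2 Suc_eq_plus1 Suc_leI)+
  have "\<beta> k t \<in> A" "\<beta> k (s k t) \<in> A"
    using beta[OF k t S] beta[OF k S] swap_tab_twice[OF t] t by auto
  then show "- (\<beta> k (s k t) * \<beta> k t) * (c t (k + 1) - c t k) \<in> A"
    using c add_A[OF c(2) uminus_A[OF c(1)]] by (intro mult_A uminus_A) auto
  show "(c t (k + 1) - c t k) * (- (\<beta> k (s k t) * \<beta> k t) * (c t (k + 1) - c t k)) = 1"
    using is_Q_unit[OF beta_quadratic[OF k t S] eq Q_diag] .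
qed

lemma seminormal: "seminormal A D \<alpha> (Std lam) s rs c B"
proof -
  interpret coeff_ring A by (rule coeff_ring_laurent)
  note sw = swap_tab_twice
  have ent: "ent (rs t) m = r t m" if "1 \<le> m" "m \<le> n" for t m using that by (rule ent_residue_seq)
  have conA: "c t k \<in> A" if "t \<in> Std lam" "1 \<le> k" "k \<le> n" for t k
    using at_box[OF that] con_A by metis
  show ?thesis
  proof (unfold_locales, unfold size_\<alpha>)
    show "finite (Std lam)" by (rule finite_Std)
    show "coeff2 (Qpol D i j) p q \<in> A" for i j p q by (rule Q_A)
    show "coeff (Wpol D i) p \<in> A" for i p by (rule W_A)
    show "coeff2 (Qpol D i j) p q = coeff2 (Qpol D j i) q p" for i j p q by (rule Q_sym)
    show "t \<in> Std lam \<Longrightarrow> rs t \<in> seqs_of \<alpha>" for t by (simp add: seqs_of_def mset_rs)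
    show "t \<in> Std lam \<Longrightarrow> 1 \<le> k \<Longrightarrow> k \<le> n \<Longrightarrow> c t k \<in> A" for t k by (rule conA)
    show "t \<in> Std lam \<Longrightarrow> 1 \<le> k \<Longrightarrow> k < n \<Longrightarrow> B k t \<in> A" for t k
      using beta[of k "s k t"] sw[of t k] zero_A by (auto simp: B_def)
    show "t \<in> Std lam \<Longrightarrow> 1 \<le> k \<Longrightarrow> k < n \<Longrightarrow> s k t \<notin> Std lam \<Longrightarrow> B k t = 0" for t k
      by (simp add: B_def)
    show "t \<in> Std lam \<Longrightarrow> s k (s k t) = t" for t k by (rule sw)
    show "t \<in> Std lam \<Longrightarrow> 1 < \<bar>int k - int m\<bar> \<Longrightarrow> s k (s m t) = s m (s k t)" for t k m
      by (rule swap_tab_commute)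
    show "t \<in> Std lam \<Longrightarrow> s k (s (k + 1) (s k t)) = s (k + 1) (s k (s (k + 1) t))" for t k
      by (rule swap_tab_braid)
  next
    fix t k assume t: "t \<in> Std lam" and k: "1 \<le> k" "k < n"
    show "\<exists>y\<in>A. (c t (k + 1) - c t k) * y = 1" if "ent (rs t) k = ent (rs t) (k + 1)"
      using inverse_difference[OF t k] that k by (metis ent Suc_eq_plus1 Suc_leI le_add2 less_imp_le)
    show "ent (rs t) k \<noteq> ent (rs t) (k + 1) \<and>
        eval2 (Qpol D (ent (rs t) k) (ent (rs t) (k + 1))) (c t k) (c t (k + 1)) = 0" if "s k t \<notin> Std lam"
      using adjacent_swap[OF t k that] k by (simp add: ent)
    show "B k t * B k (s k t) = eval2 (Qpol D (ent (rs t) k) (ent (rs t) (k + 1))) (c t k) (c t (k + 1)) -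
        (link (ent (rs t) k) (ent (rs t) (k + 1)) (c t k) (c t (k + 1)))\<^sup>2" if S: "s k t \<in> Std lam"
    proof -
      let ?z = "\<beta> k (s k t) * \<beta> k t"
      have "B k t * B k (s k t) = ?z" using S t by (simp add: B_def sw)
      moreover have "?z = eval2 (Qpol D (r t k) (r t (k + 1))) (c t k) (c t (k + 1)) -
          (link (r t k) (r t (k + 1)) (c t k) (c t (k + 1)))\<^sup>2"
      proof (cases "r t k = r t (k + 1)")
        case True
        let ?d = "c t (k + 1) - c t k"
        \<comment> \<open>With Q_ii = 0 the claim is that ?z is minus the square of the link. By
          uniqueness of inverses the link is - ?z * ?d, whose square is - ?z.\<close>
        have inv: "?d * (- ?z * ?d) = 1" by (rule inverse_difference(3)[OF t k True])
        have "(link (r t k) (r t (k + 1)) (c t k) (c t (k + 1)))\<^sup>2 = (- ?z * ?d)\<^sup>2"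
          using True uinv_eq[OF inv] by (simp add: link_def)
        also have "\<dots> = - ?z * (?d * (- ?z * ?d))"
          by (simp only: power2_eq_square mult_ac)
        also have "\<dots> = - ?z" unfolding inv by simp
        finally show ?thesis using True by (simp add: Q_diag eval2_def eval_fst_def)
      next
        case False
        then show ?thesis using beta_quadratic[OF k t S] by (simp add: is_Q_def Let_def link_def)
      qed
      ultimately show ?thesis using k by (simp add: ent)
    qed
  next
    fix t k m assume t: "t \<in> Std lam" and k: "1 \<le> k" "k < n" and m: "1 \<le> m" "m < n"
      and far: "1 < \<bar>int k - int m\<bar>"
    have far': "1 < \<bar>int m - int k\<bar>" using far by linarith
    show "B k t * B m (s k t) = B m t * B k (s m t)"
    proof (cases "s k t \<in> Std lam \<and> s m t \<in> Std lam")
      case True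
      then have S: "s m (s k t) \<in> Std lam" "s k (s m t) \<in> Std lam"
        using swap_tab_far_iff[OF t _ k m far] swap_tab_far_iff[OF t _ m k far'] by auto
      have e: "s k (s m (s k t)) = s m t" "s m (s m (s k t)) = s k t" "s k (s m t) = s m (s k t)"
        using swap_tab_commute[OF far, of t] sw[of "s m t" k] sw[of "s k t" m] True by simp_all
      \<comment> \<open>Condition (b) is taken at the corner of the square opposite to t, because
        \<open>B\<close> takes each scalar from the far end of its edge.\<close>
      have "\<beta> k (s m (s k t)) * \<beta> m (s m t) = \<beta> m (s m (s k t)) * \<beta> k (s k t)"
        using beta_commute[OF k m, of "s m (s k t)"] far S True by (simp add: e)
      then show ?thesis using True S by (simp add: B_def e mult.commute)
    next
      case False
      then have "B k t * B m (s k t) = 0" "B m t * B k (s m t) = 0"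
        using swap_tab_far_iff[OF t _ k m far] swap_tab_far_iff[OF t _ m k far'] by (auto simp: B_def)
      then show ?thesis by simp
    qed
  next
    fix t k assume t: "t \<in> Std lam" and k: "1 \<le> k" "k + 1 < n"
    let ?t1 = "s k t" and ?t2 = "s (k + 1) t"
    let ?t12 = "s (k + 1) ?t1" and ?t21 = "s k ?t2"
    show "B k t * B (k + 1) ?t1 * B k ?t12 = B (k + 1) t * B k ?t2 * B (k + 1) ?t21"
    proof (cases "?t1 \<in> Std lam \<and> ?t12 \<in> Std lam \<and> s k ?t12 \<in> Std lam")
      case True
      then have S: "?t2 \<in> Std lam" "?t21 \<in> Std lam" "s (k + 1) ?t21 \<in> Std lam"
        using swap_tab_braid_iff[OF t k] by auto
      have e: "s (k + 1) ?t21 = s k ?t12" by (rule swap_tab_braid[symmetric])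
      have e': "s k (s k ?t12) = ?t12" "s (k + 1) ?t12 = ?t1" "s (k + 1) (s k ?t12) = ?t21" "s k ?t21 = ?t2"
        using sw True S e by (metis (no_types, lifting))+
      \<comment> \<open>Likewise condition (c) starts at the corner of the hexagon opposite to
        t.\<close>
      have "\<beta> k ?t1 * \<beta> (k + 1) ?t12 * \<beta> k (s k ?t12) =
          \<beta> (k + 1) ?t2 * \<beta> k ?t21 * \<beta> (k + 1) (s k ?t12)"
        using beta_braid[OF k, of "s k ?t12"] True S unfolding e' by simp
      then show ?thesis using True S e by (simp add: B_def)
    next
      case False
      then have "\<not> (?t2 \<in> Std lam \<and> ?t21 \<in> Std lam \<and> s (k + 1) ?t21 \<in> Std lam)"
        using swap_tab_braid_iff[OF t k] by blast
      then have "B (k + 1) t * B k ?t2 * B (k + 1) ?t21 = 0" by (auto simp: B_def)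
      moreover have "B k t * B (k + 1) ?t1 * B k ?t12 = 0" using False by (auto simp: B_def)
      ultimately show ?thesis by simp
    qed
    show "ddiff (\<lambda>a. a) (Qpol D (ent (rs t) k) (ent (rs t) (k + 1))) (c t k) (c t (k + 1)) (c t (k + 2)) = 0"
      if nS: "?t1 \<notin> Std lam" "?t2 \<notin> Std lam" and e: "ent (rs t) k = ent (rs t) (k + 2)"
    proof -
      have e': "r t k = r t (k + 2)" using e k by (simp add: ent)
      have k': "1 \<le> k + 1" "k < n" using k by auto
      let ?Q = "Qpol D (r t k) (r t (k + 1))"
      \<comment> \<open>Both values of Q vanish because they belong to adjacent boxes. The factor in
        front is nonzero: the three boxes lie in a straight line, so k and k + 2 are on different
        diagonals, whose contents differ when the residues agree.\<close>
      have "(c t k - c t (k + 2)) * ddiff (\<lambda>a. a) ?Q (c t k) (c t (k + 1)) (c t (k + 2)) =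
          eval2 ?Q (c t k) (c t (k + 1)) - eval2 ?Q (c t (k + 2)) (c t (k + 1))"
        unfolding eval2_eq_peval2 by (rule ddiff_eq)
      also have "\<dots> = 0"
        using adjacent_swap(2)[OF t k(1) k'(2) nS(1)] adjacent_swap(2)[OF t k'(1) k(2) nS(2)] e'
          Q_eval_sym[of "r t k" "r t (k + 1)" "c t (k + 2)"] by simp
      finally have "c t k - c t (k + 2) = 0 \<or>
          ddiff (\<lambda>a. a) ?Q (c t k) (c t (k + 1)) (c t (k + 2)) = 0"
        by (rule laurent_mult_eq_0)
      moreover have "c t k \<noteq> c t (k + 2)"
      proof
        assume ec: "c t k = c t (k + 2)"
        have adj: "adj (box_of lam t k) (box_of lam t (k + 1))"
          "adj (box_of lam t (k + 1)) (box_of lam t (k + 2))"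
          using nS swap_tab_Std_iff[OF t, of k] swap_tab_Std_iff[OF t, of "k + 1"] k by auto
        obtain l x y where b: "box_of lam t k = (l, x, y)"
          "(box_of lam t (k + 1) = (l, x, y + 1) \<and> box_of lam t (k + 2) = (l, x, y + 2)) \<or>
           (box_of lam t (k + 1) = (l, x + 1, y) \<and> box_of lam t (k + 2) = (l, x + 2, y))"
          using chain_boxes[OF t k adj] by blast
        obtain x' y' where b': "box_of lam t (k + 2) = (l, x', y')" "int y' - int x' \<noteq> int y - int x"
          using b(2) by auto
        have D: "(l, x, y) \<in> diagram lam" "(l, x', y') \<in> diagram lam"
          using box_in(1)[OF t, of k] box_in(1)[OF t, of "k + 2"] k b(1) b'(1) by auto
        have "int y - int x = int y' - int x'"
          using con_inj[of l l "int y - int x" "int y' - int x'"] diagram_bound[OF D(1)] diagram_bound[OF D(2)]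
            diagram_pos[OF D(1)] ec e' b(1) b'(1) by (simp add: at_entry_def length_lam)
        then show False using b' by simp
      qed
      ultimately show ?thesis using k by (simp add: ent)
    qed
  next
    fix t k assume t: "t \<in> Std lam" and k: "1 \<le> k" "k < n" 
    show "rs (s k t) = swap_seq k (rs t)"
    proof (rule seq_eqI)
      fix m assume "1 \<le> m" "m \<le> length (rs (s k t))"
      then have m: "1 \<le> m" "m \<le> n" by auto
      then have "1 \<le> transpose k (k + 1) m" "transpose k (k + 1) m \<le> n"
        using k by (auto simp: transpose_def)
      then show "ent (rs (s k t)) m = ent (swap_seq k (rs t)) m"
        using k m at_entry_swap_tab[OF t k m] by (simp add: ent ent_swap_seq)
    qed simp
    show "c (s k t) m = c t (transpose k (k + 1) m)" if "1 \<le> m" "m \<le> n" for m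
      by (rule at_entry_swap_tab[OF t k that])
  next
    show "poly (Wpol D (ent (rs t) 1)) (c t 1) = 0" if t: "t \<in> Std lam" and n: "1 \<le> n" for t
    proof -
      obtain l where "box_of lam t 1 = (l, 1, 1)" "1 \<le> l" "l \<le> length lam"
        using box_of_one[OF t n] .
      then show ?thesis using W_root[of l] n by (simp add: ent at_entry_def length_lam)
    qed
  qed
qed

end

text \<open>\<open>Q_nonzero\<close> expresses that Q_k(t) is not zero. Then neither scalar in (a)
  is zero, and each has a single degree, while zero would belong to every component.\<close>

locale graded_content_data = content_data X D \<rho> n con res lam \<beta>
  for X :: "'x set" and D :: "('i, ('x, 'k::idom) laurent) klr_datum"
    and \<rho> n con res lam \<beta> +
  assumes graded: "graded_contents X D \<rho> con res"
    and Q_nonzero: "1 \<le> k \<Longrightarrow> k < n \<Longrightarrow> t \<in> Std lam \<Longrightarrow> swap_tab lam k t \<in> Std lam \<Longrightarrow>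
      \<not> is_Q D lam con res k t 0"
begin

sublocale G: graded_coeff A "laurent_homog X" lcomp
  by (rule graded_coeff_laurent)

abbreviation rf :: "(box \<Rightarrow> nat) \<Rightarrow> nat \<Rightarrow> nat \<Rightarrow> int" where
  "rf t k m \<equiv> root_form D (r t k) (r t m)"

section \<open>Degrees of contents, of Q-values and of the scalars\<close>

lemma cartan: "symmetrisable_cartan D"
  using datum by (simp add: klr_datum_over_def)

lemma c_homog:
  assumes t: "t \<in> Std lam" "1 \<le> m" "m \<le> n"
  shows "c t m \<in> laurent_homog X (2 * int (symm D (r t m)))"
proof -
  obtain l a where "r t m = res l a" "c t m = con l a" "1 \<le> l" "l \<le> length \<rho>"
    using at_box[OF t] by metis
  then show ?thesis using graded by (auto simp: graded_contents_def intro: poly_homog_laurent)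
qed

text \<open>The degrees of the coefficients compensate those of the powers of u and v, because
  (\<alpha>_i|\<alpha>_i) = 2 d_i is the degree of u, and similarly for v.\<close>

lemma eval2_Q_homog:
  assumes ij: "i \<noteq> j" and u: "u \<in> laurent_homog X (2 * int (symm D i))"
    and v: "v \<in> laurent_homog X (2 * int (symm D j))"
  shows "eval2 (Qpol D i j) u v \<in> laurent_homog X (- 2 * root_form D i j)"
proof -
  have "coeff2 (Qpol D i j) p q * u ^ p * v ^ q \<in> laurent_homog X (- 2 * root_form D i j)" for p q
    using G.G_mult[OF G.G_mult[OF Q_homog[OF ij, of p q] G.G_power[OF u, of p]] G.G_power[OF v, of q]]
    by (simp add: root_form_same[OF cartan] algebra_simps)
  then show ?thesis unfolding eval2_eq_peval2 peval2_def by (intro G.G_sum)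
qed

text \<open>For different residues this is the degree of the Q-value. For equal residues i the
  product is minus the square of an inverse of degree -2 d_i, in agreement with
  (\<alpha>_i|\<alpha>_i) = 2 d_i.\<close>

lemma beta_product:
  assumes t: "t \<in> Std lam" and k: "1 \<le> k" "k < n" and S: "s k t \<in> Std lam"
  shows "\<beta> k (s k t) * \<beta> k t \<in> laurent_homog X (- 2 * rf t k (k + 1))" "\<beta> k (s k t) * \<beta> k t \<noteq> 0"
proof -
  let ?z = "\<beta> k (s k t) * \<beta> k t"
  show "?z \<noteq> 0" using beta_quadratic[OF k t S] Q_nonzero[OF k t S] by auto
  have c: "c t k \<in> laurent_homog X (2 * int (symm D (r t k)))"
      "c t (k + 1) \<in> laurent_homog X (2 * int (symm D (r t (k + 1))))"
    using c_homog[OF t] k by auto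
  show "?z \<in> laurent_homog X (- 2 * rf t k (k + 1))"
  proof (cases "r t k = r t (k + 1)")
    case True
    let ?e = "2 * int (symm D (r t k))"
    let ?d = "c t (k + 1) - c t k"
    have d: "?d \<in> laurent_homog X ?e"
      using G.G_add[OF _ G.G_uminus] c True by fastforce
    have inv: "- ?z * ?d \<in> laurent_homog X (- ?e)"
      by (rule G.inverse_homog[OF d inverse_difference(2,3)[OF t k True]])
    have "(- ?z * ?d) * (- ?z * ?d) \<in> laurent_homog X (- ?e + - ?e)" by (rule G.G_mult[OF inv inv])
    moreover have "(- ?z * ?d) * (- ?z * ?d) = - ?z * (?d * (- ?z * ?d))" by (simp only: mult_ac)
    moreover have "\<dots> = - ?z" unfolding inverse_difference(3)[OF t k True] by simp
    ultimately have "- ?z \<in> laurent_homog X (- ?e + - ?e)" by metis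
    then have "?z \<in> laurent_homog X (- ?e + - ?e)" using G.G_uminus by fastforce
    then show ?thesis using True by (simp add: root_form_same[OF cartan])
  next
    case False
    have "?z = eval2 (Qpol D (r t k) (r t (k + 1))) (c t k) (c t (k + 1))"
      using beta_quadratic[OF k t S] False by (simp add: is_Q_def Let_def)
    then show ?thesis using eval2_Q_homog[OF False c] by simp
  qed
qed

definition bdeg :: "nat \<Rightarrow> (box \<Rightarrow> nat) \<Rightarrow> int" where
  "bdeg k t = (SOME e. \<beta> k t \<in> laurent_homog X e)"

lemma beta_homog:
  assumes t: "t \<in> Std lam" and k: "1 \<le> k" "k < n" and S: "s k t \<in> Std lam"
  shows "\<beta> k t \<in> laurent_homog X (bdeg k t)" "\<beta> k t \<noteq> 0"
proof -
  have bA: "\<beta> k t \<in> A" "\<beta> k (s k t) \<in> A"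
    using beta[OF k t S] beta[OF k S] swap_tab_twice[OF t] t by auto
  have "\<exists>e. \<beta> k t \<in> laurent_homog X e"
    using laurent_homog_factor[OF bA, of "- 2 * rf t k (k + 1)"] beta_product[OF t k S]
    by (simp add: mult.commute)
  then show "\<beta> k t \<in> laurent_homog X (bdeg k t)" unfolding bdeg_def by (rule someI_ex)
  show "\<beta> k t \<noteq> 0" using beta_product(2)[OF t k S] by auto
qed

lemma bdeg_swap:
  assumes t: "t \<in> Std lam" and k: "1 \<le> k" "k < n" and S: "s k t \<in> Std lam"
  shows "bdeg k (s k t) + bdeg k t = - 2 * rf t k (k + 1)"
proof -
  have "\<beta> k (s k t) \<in> laurent_homog X (bdeg k (s k t))"
    using beta_homog(1)[OF S k] swap_tab_twice[OF t] t by simp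
  then have "\<beta> k (s k t) * \<beta> k t \<in> laurent_homog X (bdeg k (s k t) + bdeg k t)"
    using beta_homog(1)[OF t k S] by (rule G.G_mult)
  then show ?thesis using beta_product[OF t k S] by (rule laurent_homog_unique)
qed

lemma r_swap:
  assumes "t \<in> Std lam" "1 \<le> k" "k < n" "1 \<le> m" "m \<le> n"
  shows "r (s k t) m = r t (transpose k (k + 1) m)"
  using at_entry_swap_tab assms by blast

text \<open>
  The required degree differences between neighbouring tableaux; conditions (b) and (c) on the
  \<open>\<beta>\<^sub>k\<close> say that they add up to zero around squares and hexagons.
\<close>

lemma degree_exists:
  obtains deg :: "(box \<Rightarrow> nat) \<Rightarrow> int" where
    "\<And>t k. t \<in> Std lam \<Longrightarrow> 1 \<le> k \<Longrightarrow> k < n \<Longrightarrow> s k t \<in> Std lam \<Longrightarrow>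
      deg t = deg (s k t) + (bdeg k t + rf t k (k + 1))"
proof (rule Std_degree[where w = "\<lambda>k t. bdeg k t + rf t k (k + 1)"])
  fix t k assume t: "t \<in> Std lam" and k: "1 \<le> k" "k < n" and S: "s k t \<in> Std lam"
  have "rf (s k t) k (k + 1) = rf t k (k + 1)"
    using r_swap[OF t k, of k] r_swap[OF t k, of "k + 1"] k root_form_sym[OF cartan, of "r t k"]
    by (simp add: transpose_def)
  then show "bdeg k (s k t) + rf (s k t) k (k + 1) = - (bdeg k t + rf t k (k + 1))"
    using bdeg_swap[OF t k S] by simp
next
  fix t k m assume t: "t \<in> Std lam" and k: "1 \<le> k" "k < n" and m: "1 \<le> m" "m < n"
    and far: "\<bar>int k - int m\<bar> > 1" and S: "s k t \<in> Std lam" "s m t \<in> Std lam"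
  have far': "\<bar>int m - int k\<bar> > 1" using far by linarith
  have ne: "m \<noteq> k" "m \<noteq> k + 1" "m + 1 \<noteq> k" using far by auto
  have S': "s m (s k t) \<in> Std lam" "s k (s m t) \<in> Std lam"
    using swap_tab_far_iff[OF t S(1) k m far] swap_tab_far_iff[OF t S(2) m k far'] S by auto
  have 1: "\<beta> k t * \<beta> m (s k t) \<in> laurent_homog X (bdeg k t + bdeg m (s k t))"
    using beta_homog(1)[OF t k S(1)] beta_homog(1)[OF S(1) m S'(1)] by (rule G.G_mult)
  have 2: "\<beta> m t * \<beta> k (s m t) \<in> laurent_homog X (bdeg m t + bdeg k (s m t))"
    using beta_homog(1)[OF t m S(2)] beta_homog(1)[OF S(2) k S'(2)] by (rule G.G_mult)
  have "\<beta> k t * \<beta> m (s k t) \<noteq> 0"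
    using beta_homog(2)[OF t k S(1)] beta_homog(2)[OF S(1) m S'(1)] laurent_mult_eq_0 by blast
  moreover have "\<beta> k t * \<beta> m (s k t) = \<beta> m t * \<beta> k (s m t)"
    using beta_commute[OF k m _ t S] far by simp
  ultimately have "bdeg k t + bdeg m (s k t) = bdeg m t + bdeg k (s m t)"
    using laurent_homog_unique 1 2 by metis
  moreover have "rf (s k t) m (m + 1) = rf t m (m + 1)" "rf (s m t) k (k + 1) = rf t k (k + 1)"
    using r_swap[OF t k, of m] r_swap[OF t k, of "m + 1"] r_swap[OF t m, of k] r_swap[OF t m, of "k + 1"]
      k m ne by (simp_all add: transpose_def)
  ultimately show "bdeg k t + rf t k (k + 1) + (bdeg m (s k t) + rf (s k t) m (m + 1)) =
      bdeg m t + rf t m (m + 1) + (bdeg k (s m t) + rf (s m t) k (k + 1))" by simp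
next
  fix t k assume k: "1 \<le> k" "k + 1 < n"
    and five: "{t, s k t, s (k + 1) (s k t), s (k + 1) t, s k (s (k + 1) t)} \<subseteq> Std lam"
  let ?t1 = "s k t" and ?t2 = "s (k + 1) t"
  let ?t12 = "s (k + 1) ?t1" and ?t21 = "s k ?t2"
  have S: "t \<in> Std lam" "?t1 \<in> Std lam" "?t12 \<in> Std lam" "?t2 \<in> Std lam" "?t21 \<in> Std lam"
    using five by auto
  have S0: "s k ?t12 \<in> Std lam" by (rule swap_tab_sixth[OF k five])
  have S0': "s (k + 1) ?t21 \<in> Std lam" using S0 swap_tab_braid[of k t] by simp
  have k': "1 \<le> k" "k < n" "1 \<le> k + 1" "k + 1 < n" using k by auto
  note h = beta_homog[OF _ k'(1,2)] and h' = beta_homog[OF _ k'(3,4)]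
  have 1: "\<beta> k ?t12 * \<beta> (k + 1) ?t1 * \<beta> k t \<in> laurent_homog X (bdeg k ?t12 + bdeg (k + 1) ?t1 + bdeg k t)"
    by (intro G.G_mult h(1) h'(1) S S0)
  have 2: "\<beta> (k + 1) ?t21 * \<beta> k ?t2 * \<beta> (k + 1) t \<in>
      laurent_homog X (bdeg (k + 1) ?t21 + bdeg k ?t2 + bdeg (k + 1) t)"
    by (intro G.G_mult h(1) h'(1) S S0')
  have "\<beta> k ?t12 * \<beta> (k + 1) ?t1 * \<beta> k t \<noteq> 0"
    using h(2)[OF S(3) S0] h'(2)[OF S(2,3)] h(2)[OF S(1,2)] laurent_mult_eq_0 by blast
  then have "bdeg k ?t12 + bdeg (k + 1) ?t1 + bdeg k t = bdeg (k + 1) ?t21 + bdeg k ?t2 + bdeg (k + 1) t"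
    using laurent_homog_unique[OF 1] 2 beta_braid[OF k five] by simp
  \<comment> \<open>Each half of the hexagon exchanges every pair among the three entries exactly
    once, so the root forms on the two sides are the same three numbers.\<close>
  moreover have "rf ?t1 (k + 1) (k + 2) = rf t k (k + 2)" "rf ?t12 k (k + 1) = rf t (k + 1) (k + 2)"
      "rf ?t2 k (k + 1) = rf t k (k + 2)" "rf ?t21 (k + 1) (k + 2) = rf t k (k + 1)"
    using r_swap[OF S(1) k'(1,2)] r_swap[OF S(1) k'(3,4)] r_swap[OF S(2) k'(3,4)] r_swap[OF S(4) k'(1,2)] k
    by (simp_all add: transpose_def)
  ultimately show "bdeg k t + rf t k (k + 1) + (bdeg (k + 1) ?t1 + rf ?t1 (k + 1) (k + 1 + 1)) +
      (bdeg k ?t12 + rf ?t12 k (k + 1)) =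
      bdeg (k + 1) t + rf t (k + 1) (k + 1 + 1) + (bdeg k ?t2 + rf ?t2 k (k + 1)) +
      (bdeg (k + 1) ?t21 + rf ?t21 (k + 1) (k + 1 + 1))" by simp
qed (use that in blast)

lemma graded_seminormal:
  obtains deg where "graded_seminormal A D \<alpha> (Std lam) s rs c B (laurent_homog X) lcomp deg"
proof -
  obtain deg where deg: "\<And>t k. t \<in> Std lam \<Longrightarrow> 1 \<le> k \<Longrightarrow> k < n \<Longrightarrow> s k t \<in> Std lam \<Longrightarrow>
      deg t = deg (s k t) + (bdeg k t + rf t k (k + 1))"
    by (rule degree_exists) blast
  have "graded_seminormal A D \<alpha> (Std lam) s rs c B (laurent_homog X) lcomp deg"
  proof (intro graded_seminormal.intro seminormal graded_coeff_laurent graded_seminormal_axioms.intro,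
      unfold size_\<alpha>)
    show "symmetrisable_cartan D" by (rule cartan)
    show "c t k \<in> laurent_homog X (2 * int (symm D (ent (rs t) k)))"
      if "t \<in> Std lam" "1 \<le> k" "k \<le> n" for t k
      using c_homog[OF that] that by (simp add: ent_residue_seq)
    show "B k t \<in> laurent_homog X (deg (s k t) - deg t - root_form D (ent (rs t) k) (ent (rs t) (k + 1)))"
      if t: "t \<in> Std lam" and k: "1 \<le> k" "k < n" and S: "s k t \<in> Std lam" for t k
    proof -
      have "\<beta> k (s k t) \<in> laurent_homog X (bdeg k (s k t))"
        using beta_homog(1)[OF S k] swap_tab_twice[OF t] t by simp
      \<comment> \<open>\<open>B k t\<close> is the scalar at the neighbour, whose degree follows
        from that at t through the degree of their product.\<close>
      moreover have "bdeg k (s k t) = deg (s k t) - deg t - rf t k (k + 1)"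
        using deg[OF t k S] bdeg_swap[OF t k S] by simp
      ultimately show ?thesis using S k by (simp add: B_def ent_residue_seq)
    qed
  qed
  then show thesis by (rule that)
qed

lemma irreducible_seminormal:
  assumes gs: "graded_seminormal A D \<alpha> (Std lam) s rs c B (laurent_homog X) lcomp deg"
    and gf: "graded_field A (laurent_homog X)"
  shows "irreducible_seminormal A D \<alpha> (Std lam) s rs c B (laurent_homog X) lcomp deg"
proof (intro irreducible_seminormal.intro gs irreducible_seminormal_axioms.intro, unfold size_\<alpha>)
  show "\<exists>b\<in>A. a * b = 1" if "a \<in> laurent_homog X e" "a \<noteq> 0" for a e
  proof -
    have "a \<in> Units (subring_of A)" using gf that unfolding graded_field_def by blast
    then show ?thesis by (auto simp: Units_def subring_of_def)
  qed
  show "Std lam \<noteq> {}" using row_tab_Std by blast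
  show "N = Std lam" if "N \<subseteq> Std lam" "N \<noteq> {}"
    "\<And>t k. t \<in> N \<Longrightarrow> 1 \<le> k \<Longrightarrow> k < n \<Longrightarrow> s k t \<in> Std lam \<Longrightarrow> s k t \<in> N" for N
    using Std_connected that by blast
  show "B k t \<noteq> 0" if t: "t \<in> Std lam" and k: "1 \<le> k" "k < n" and S: "s k t \<in> Std lam" for t k
    using beta_homog(2)[OF S k] swap_tab_twice[OF t] t S by (simp add: B_def)
  show "\<exists>m\<in>{1..n}. c x m \<noteq> c t m" if x: "x \<in> Std lam" and t: "t \<in> Std lam" and rs: "rs x = rs t" and "x \<noteq> t" for x t
  proof (rule ccontr)
    assume "\<not> (\<exists>m\<in>{1..n}. c x m \<noteq> c t m)"
    then have ceq: "c x m = c t m" if "1 \<le> m" "m \<le> n" for m using that by auto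
    have "x = t"
    \<comment> \<open>Equal residue and content at each entry force equal component and diagonal by
      the injectivity of the content system, and these determine a standard tableau.\<close>
    proof (rule Std_eqI[OF x t])
      fix m l a b l' a' b' assume m: "1 \<le> m" "m \<le> n"
        and bx: "box_of lam x m = (l, a, b)" "box_of lam t m = (l', a', b')"
      have D: "(l, a, b) \<in> diagram lam" "(l', a', b') \<in> diagram lam"
        using box_in(1)[OF x m] box_in(1)[OF t m] bx by auto
      have "r x m = r t m" using rs ent_residue_seq[OF m, of res] by metis
      then show "l = l' \<and> int b - int a = int b' - int a'"
        using con_inj[of l l' "int b - int a" "int b' - int a'"] diagram_bound[OF D(1)] diagram_bound[OF D(2)]
          diagram_pos[OF D(1)] diagram_pos[OF D(2)] ceq[OF m] bx by (simp add: at_entry_def length_lam)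
    qed
    then show False using \<open>x \<noteq> t\<close> by simp
  qed
qed

end

text \<open>The graded assertions presuppose nonzero Q_k(t): otherwise (a) forces one of two scalars
  to vanish, so that it no longer fixes the degree of the other, nor does psi_k lead back and forth
  between the two basis vectors.\<close>

theorem proposition3p3p2:
  fixes X :: "'x set"
    and D :: "('i, ('x, 'k::idom) laurent) klr_datum"
    and \<rho> :: "'i list"
    and n :: nat
    and con :: "nat \<Rightarrow> int \<Rightarrow> ('x, 'k) laurent"
    and res :: "nat \<Rightarrow> int \<Rightarrow> 'i"
    and lam :: "nat list list"
    and \<beta> :: "nat \<Rightarrow> (box \<Rightarrow> nat) \<Rightarrow> ('x, 'k) laurent"
  defines "K \<equiv> subring_of (laurent_ring X :: ('x, 'k) laurent set)"
    and "G \<equiv> (laurent_homog X :: int \<Rightarrow> ('x, 'k) laurent set)"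
    and "R \<equiv> klr_algebra (laurent_ring X) D n"
    and "H \<equiv> klr_homog (laurent_ring X) (laurent_homog X) D n"
    and "\<sigma> \<equiv> swap_tab lam"
    and "c \<equiv> (\<lambda>m t. at_entry lam con t m)"
    and "r \<equiv> (\<lambda>m t. at_entry lam res t m)"
    and "elt \<equiv> (\<lambda>t. klr_elt (laurent_ring X) D (mset (residue_seq lam n res t)))"
  assumes datum: "klr_datum_over (poly_ring X) (poly_homog X) D"
    and level: "\<rho> \<noteq> []" "\<And>i. degree (Wpol D i) = count_list \<rho> i"
    and content: "content_system X D \<rho> n con res"
    and lam: "lam \<in> multipartitions (length \<rho>) n"
    and beta: "\<And>k t. 1 \<le> k \<Longrightarrow> k < n \<Longrightarrow> t \<in> Std lam \<Longrightarrow> \<sigma> k t \<in> Std lam \<Longrightarrow>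
      \<beta> k t \<in> laurent_ring X"
    and a: "\<And>k t. 1 \<le> k \<Longrightarrow> k < n \<Longrightarrow> t \<in> Std lam \<Longrightarrow> \<sigma> k t \<in> Std lam \<Longrightarrow>
      is_Q D lam con res k t (\<beta> k (\<sigma> k t) * \<beta> k t)"
    and b: "\<And>k l t. 1 \<le> k \<Longrightarrow> k < n \<Longrightarrow> 1 \<le> l \<Longrightarrow> l < n \<Longrightarrow> \<bar>int k - int l\<bar> \<noteq> 1 \<Longrightarrow>
      t \<in> Std lam \<Longrightarrow> \<sigma> k t \<in> Std lam \<Longrightarrow> \<sigma> l t \<in> Std lam \<Longrightarrow>
      \<beta> k t * \<beta> l (\<sigma> k t) = \<beta> l t * \<beta> k (\<sigma> l t)"
    and c: "\<And>k t. 1 \<le> k \<Longrightarrow> k + 1 < n \<Longrightarrow>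
      {t, \<sigma> k t, \<sigma> (k + 1) (\<sigma> k t), \<sigma> (k + 1) t, \<sigma> k (\<sigma> (k + 1) t)} \<subseteq> Std lam \<Longrightarrow>
      \<beta> k (\<sigma> (k + 1) (\<sigma> k t)) * \<beta> (k + 1) (\<sigma> k t) * \<beta> k t =
      \<beta> (k + 1) (\<sigma> k (\<sigma> (k + 1) t)) * \<beta> k (\<sigma> (k + 1) t) * \<beta> (k + 1) t"
  shows "\<exists>(V :: (('x, 'k) laurent, (box \<Rightarrow> nat) \<Rightarrow> ('x, 'k) laurent) module) act v.
    algebra_module K R V act \<and>
    free_basis K V (Std lam) v \<and>
    (\<forall>t \<in> Std lam.
      (\<forall>s. length s = n \<longrightarrow>
        act (klr_elt (laurent_ring X) D (mset s) (idp s)) (v t) =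
        (if s = residue_seq lam n res t then v t else \<zero>\<^bsub>V\<^esub>)) \<and>
      (\<forall>k. 1 \<le> k \<and> k \<le> n \<longrightarrow> act (elt t (yy k)) (v t) = c k t \<odot>\<^bsub>V\<^esub> v t) \<and>
      (\<forall>k. 1 \<le> k \<and> k < n \<longrightarrow>
        (r k t = r (k + 1) t \<longrightarrow> c (k + 1) t - c k t \<in> Units K) \<and>
        act (elt t (psi k)) (v t) =
          (if \<sigma> k t \<in> Std lam then \<beta> k t \<odot>\<^bsub>V\<^esub> v (\<sigma> k t) else \<zero>\<^bsub>V\<^esub>) \<oplus>\<^bsub>V\<^esub>
          (if r k t = r (k + 1) t then inv\<^bsub>K\<^esub> (c (k + 1) t - c k t) \<odot>\<^bsub>V\<^esub> v t else \<zero>\<^bsub>V\<^esub>))) \<and>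
    (graded_contents X D \<rho> con res \<and>
     (\<forall>k t. 1 \<le> k \<and> k < n \<and> t \<in> Std lam \<and> \<sigma> k t \<in> Std lam \<longrightarrow> \<not> is_Q D lam con res k t 0) \<longrightarrow>
     (\<exists>U. graded_module K G R H V act U \<and>
       (\<forall>t \<in> Std lam. \<exists>d. v t \<in> U d) \<and>
       (graded_field (laurent_ring X) G \<longrightarrow> graded_irreducible K G R H V act U)))"
proof -
  interpret C: content_data X D \<rho> n con res lam \<beta>
    by unfold_locales (fact datum content lam beta[unfolded \<sigma>_def] a[unfolded \<sigma>_def]
      b[unfolded \<sigma>_def] c[unfolded \<sigma>_def])+
  interpret M: seminormal "laurent_ring X" D C.\<alpha> "Std lam" "swap_tab lam" "residue_seq lam n res"
    "at_entry lam con" C.B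
    by (rule C.seminormal)
  let ?V = "fun_module (laurent_ring X) (Std lam) :: (('x, 'k) laurent, (box \<Rightarrow> nat) \<Rightarrow> ('x, 'k) laurent) module"
  interpret K: cring K unfolding K_def by (rule M.cring_subring_of)
  have elt: "elt t f = klr_elt (laurent_ring X) D C.\<alpha> f" if "t \<in> Std lam" for t f
    using that by (simp add: elt_def C.mset_rs)
  have gen_act: "M.mod_act (klr_elt (laurent_ring X) D C.\<alpha> (gen g)) (unit_vec t) = M.act (gen g) (unit_vec t)"
    if "g \<in> klr_gens C.\<alpha>" "t \<in> Std lam" for g t
    using M.mod_act_elt[OF M.free_algebra_gen[OF that(1)] refl M.unit_vec_carrier[OF that(2)]] by simp
  have module: "algebra_module K R ?V M.mod_act"
    using M.algebra_module_fun_module by (simp add: K_def R_def)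
  have basis: "free_basis K ?V (Std lam) unit_vec"
    unfolding K_def by (rule M.free_basis_fun_module[OF C.finite_Std])
  have idp_act: "M.mod_act (klr_elt (laurent_ring X) D (mset s) (idp s)) (unit_vec t) =
      (if s = residue_seq lam n res t then unit_vec t else \<zero>\<^bsub>?V\<^esub>)"
    if t: "t \<in> Std lam" and s: "length s = n" for s t
  proof (cases "mset s = C.\<alpha>")
    case True
    then have g: "Idp s \<in> klr_gens C.\<alpha>" by (simp add: klr_gens_def seqs_of_def)
    have "M.act (idp s) (unit_vec t) x = (if s = residue_seq lam n res t then unit_vec t x else 0)" for x
      using t by (cases "x \<in> Std lam") (auto simp: M.act_idp unit_vec_def free_act_gen M.gen_act_def)
    then show ?thesis using gen_act[OF g t] True by (auto simp: fun_eq_iff)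
  next
    case False
    \<comment> \<open>An idempotent whose residues do not add up to \<alpha> lies in another block,
      which acts by zero.\<close>
    have "(idp s :: ('i, ('x, 'k) laurent) klr_free) \<in> carrier (free_algebra (laurent_ring X) (klr_gens (mset s)))"
      by (rule M.free_algebra_gen) (simp add: klr_gens_def seqs_of_def)
    moreover have "s \<noteq> residue_seq lam n res t" using False C.mset_rs[OF t] by auto
    ultimately show ?thesis
      using M.mod_act_elt[of "gen (Idp s)" "mset s" "unit_vec t"] False M.unit_vec_carrier[OF t] s by simp
  qed
  have yy_act: "M.mod_act (elt t (yy k)) (unit_vec t) = c k t \<odot>\<^bsub>?V\<^esub> unit_vec t"
    if t: "t \<in> Std lam" and k: "1 \<le> k" "k \<le> n" for t k
  proof -
    have "M.act (yy k) (unit_vec t) x = c k t * unit_vec t x" for x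
      using t by (cases "x \<in> Std lam") (auto simp: c_def unit_vec_def free_act_gen M.gen_act_def)
    then show ?thesis using gen_act[of "Y k" t] t k by (auto simp: elt klr_gens_def fun_eq_iff)
  qed
  \<comment> \<open>Identifies the inverse taken inside the coefficient ring with the diagonal
    coefficient, which was defined by an inverse in the ambient type.\<close>
  have unit: "c (k + 1) t - c k t \<in> Units K" "inv\<^bsub>K\<^esub> (c (k + 1) t - c k t) = M.d k t"
    if t: "t \<in> Std lam" and k: "1 \<le> k" "k < n" and eq: "r k t = r (k + 1) t" for t k
  proof -
    let ?x = "c (k + 1) t - c k t"
    have ent: "ent (residue_seq lam n res t) k = ent (residue_seq lam n res t) (k + 1)"
      using eq k by (simp add: r_def C.ent_residue_seq)
    then obtain y where y: "y \<in> laurent_ring X" "?x * y = 1"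
      using M.invertible[OF t] k by (auto simp: c_def)
    have "c k t \<in> laurent_ring X" "c (k + 1) t \<in> laurent_ring X"
      using M.c_A[OF t] k by (simp_all add: c_def)
    then have x: "?x \<in> laurent_ring X" using M.add_A[OF _ M.uminus_A] by fastforce
    have xy: "?x \<in> carrier K" "y \<in> carrier K" "?x \<otimes>\<^bsub>K\<^esub> y = \<one>\<^bsub>K\<^esub>" "y \<otimes>\<^bsub>K\<^esub> ?x = \<one>\<^bsub>K\<^esub>"
      using x y by (simp_all add: K_def subring_of_def mult.commute)
    then show "?x \<in> Units K" unfolding Units_def by blast
    show "inv\<^bsub>K\<^esub> ?x = M.d k t"
      using K.comm_inv_char[OF xy(1-3)] uinv_eq[OF y(2)] ent by (simp add: M.d_def link_def c_def)
  qed
  have psi_act: "M.mod_act (elt t (psi k)) (unit_vec t) =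
      (if \<sigma> k t \<in> Std lam then \<beta> k t \<odot>\<^bsub>?V\<^esub> unit_vec (\<sigma> k t) else \<zero>\<^bsub>?V\<^esub>) \<oplus>\<^bsub>?V\<^esub>
      (if r k t = r (k + 1) t then inv\<^bsub>K\<^esub> (c (k + 1) t - c k t) \<odot>\<^bsub>?V\<^esub> unit_vec t else \<zero>\<^bsub>?V\<^esub>)"
    if t: "t \<in> Std lam" and k: "1 \<le> k" "k < n" for t k
  proof -
    have B: "\<sigma> k t \<in> Std lam \<Longrightarrow> C.B k (\<sigma> k t) = \<beta> k t"
      using C.swap_tab_twice[OF t] t by (simp add: C.B_def \<sigma>_def)
    have d: "r k t \<noteq> r (k + 1) t \<Longrightarrow> M.d k t = 0"
      using M.d_zero[of t k] k by (simp add: r_def C.ent_residue_seq)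
    have "M.mod_act (elt t (psi k)) (unit_vec t) = M.act (psi k) (unit_vec t)"
      using gen_act[of "Psi k" t] t k by (simp add: elt klr_gens_def)
    \<comment> \<open>\<open>B\<close> at the neighbour is \<beta>_k at t, so the passage to basis
      vectors undoes the reversal built into \<open>B\<close>.\<close>
    also have "\<dots> = (\<lambda>x. (if \<sigma> k t \<in> Std lam then C.B k (\<sigma> k t) * unit_vec (\<sigma> k t) x else 0) + M.d k t * unit_vec t x)"
      unfolding \<sigma>_def by (rule M.act_psi_unit_vec[OF t]) (use k in simp_all)
    finally show ?thesis
      using B d unit[OF t k] by (auto simp: fun_eq_iff)
  qed
  have graded: "\<exists>U. graded_module K G R H ?V M.mod_act U \<and> (\<forall>t \<in> Std lam. \<exists>d. unit_vec t \<in> U d) \<and>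
      (graded_field (laurent_ring X) G \<longrightarrow> graded_irreducible K G R H ?V M.mod_act U)"
    if gc: "graded_contents X D \<rho> con res" and nz: "\<forall>k t. 1 \<le> k \<and> k < n \<and> t \<in> Std lam \<and> \<sigma> k t \<in> Std lam \<longrightarrow>
      \<not> is_Q D lam con res k t 0"
  proof -
    interpret GC: graded_content_data X D \<rho> n con res lam \<beta>
      by unfold_locales (use gc nz in \<open>auto simp: \<sigma>_def\<close>)
    obtain deg where gs: "graded_seminormal (laurent_ring X) D C.\<alpha> (Std lam) (swap_tab lam)
        (residue_seq lam n res) (at_entry lam con) C.B (laurent_homog X) lcomp deg"
      by (rule GC.graded_seminormal)
    interpret GM: graded_seminormal "laurent_ring X" D C.\<alpha> "Std lam" "swap_tab lam"
        "residue_seq lam n res" "at_entry lam con" C.B "laurent_homog X" lcomp deg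
      by (rule gs)
    have "graded_irreducible K G R H ?V M.mod_act GM.hom_vecs" if gf: "graded_field (laurent_ring X) G"
    proof -
      interpret IM: irreducible_seminormal "laurent_ring X" D C.\<alpha> "Std lam" "swap_tab lam"
          "residue_seq lam n res" "at_entry lam con" C.B "laurent_homog X" lcomp deg
        by (rule GC.irreducible_seminormal[OF gs gf[unfolded G_def]])
      show ?thesis using IM.graded_irreducible_fun_module by (simp add: K_def G_def R_def H_def)
    qed
    moreover have "graded_module K G R H ?V M.mod_act GM.hom_vecs"
      using GM.graded_module_fun_module by (simp add: K_def G_def R_def H_def)
    ultimately show ?thesis using GM.unit_vec_homog by blast
  qed
  show ?thesis
    using module basis idp_act yy_act unit(1) psi_act graded
    by (intro exI[of _ ?V] exI[of _ M.mod_act] exI[of _ unit_vec]) blast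
qed

end
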